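(* Let $\nu\in[0,1)$, $0<b<\infty$, and let $S_{\nu,b}$ and $(S_{\nu,b})_{\max}$ be the minimal and maximal operators generated by $\tau_\nu=-\frac{d^2}{dx^2}+\frac{\nu^2-1/4}{x^2}$ in $L^2(0,b)$. Then: (i) $S_{\nu,b}$ is non-negative and its deficiency indices are $n_\pm(S_{\nu,b})=2$. (ii) $\operatorname{dom}(S_{\nu,b})=H_0^2[0,b]$. (iii) $(S_{\nu,b})_{\max}=S_{\nu,b}^*$ and $$\operatorname{dom}(S_{\nu,b}^* )=\begin{cases}\widetilde H_0^2[0,b]\dotplus\operatorname{span}\{x^{1/2+\nu},\,x^{1/2-\nu}\}, & \nu\in(0,1),\\ \widetilde H_0^2[0,b]\dotplus\operatorname{span}\{x^{1/2},\,x^{1/2}\log(x)\}, & \nu=0.\end{cases}$$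
   Context: The maximal operator generated by $\tau_\nu$ in $L^2(0,b)$ acts as $\tau_\nu$ on all $f\in L^2(0,b)$ with $f,f'$ locally absolutely continuous on $(0,b)$ and $\tau_\nu f\in L^2(0,b)$. The minimal operator is the closure of the restriction of the maximal operator to functions with compact support in $(0,b)$. $H^2[0,b]$ is the usual Sobolev space, $H_0^2[0,b]=\{f\in H^2[0,b]: f(0)=f'(0)=f(b)=f'(b)=0\}$ and $\widetilde H_0^2[0,b]=\{f\in H^2[0,b]: f(0)=f'(0)=0\}$. The deficiency indices of a closed symmetric operator $A$ are $n_\pm(A)=\dim\ker(A^*\pm iI)$. The symbol $\dotplus$ denotes a direct sum of linear spaces. *)

theory Defs
  imports "HOL-Analysis.Analysis"
begin

section \<open>The complex Hilbert space of square-integrable functions on the line\<close>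

definition square_integrable :: "real measure \<Rightarrow> (real \<Rightarrow> complex) \<Rightarrow> bool" where
  "square_integrable M f \<longleftrightarrow>
     f \<in> borel_measurable M \<and> integrable M (\<lambda>x. (cmod (f x))\<^sup>2)"

lemma square_integrable_0: "square_integrable M (\<lambda>_. 0)"
  by (simp add: square_integrable_def)

lemma square_integrable_add:
  assumes "square_integrable M f" "square_integrable M g"
  shows "square_integrable M (\<lambda>x. f x + g x)"
  unfolding square_integrable_def
proof
  have [measurable]: "f \<in> borel_measurable M" "g \<in> borel_measurable M"
    using assms by (auto simp: square_integrable_def)
  show "(\<lambda>x. f x + g x) \<in> borel_measurable M" by measurable
  show "integrable M (\<lambda>x. (cmod (f x + g x))\<^sup>2)"
  proof (rule Bochner_Integration.integrable_bound)
    show "integrable M (\<lambda>x. 2 * (cmod (f x))\<^sup>2 + 2 * (cmod (g x))\<^sup>2)"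
      using assms by (auto simp: square_integrable_def)
    show "AE x in M. norm ((cmod (f x + g x))\<^sup>2)
            \<le> norm (2 * (cmod (f x))\<^sup>2 + 2 * (cmod (g x))\<^sup>2)"
    proof (rule AE_I2)
      fix x
      have "(cmod (f x + g x))\<^sup>2 \<le> (cmod (f x) + cmod (g x))\<^sup>2"
        by (intro power_mono norm_triangle_ineq) auto
      also have "\<dots> \<le> 2 * (cmod (f x))\<^sup>2 + 2 * (cmod (g x))\<^sup>2"
        using zero_le_power2[of "cmod (f x) - cmod (g x)"] by (simp add: power2_eq_square algebra_simps)
      finally show "norm ((cmod (f x + g x))\<^sup>2)
            \<le> norm (2 * (cmod (f x))\<^sup>2 + 2 * (cmod (g x))\<^sup>2)" by simp
    qed
  qed measurable
qed

lemma square_integrable_cmult: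
  assumes "square_integrable M f"
  shows "square_integrable M (\<lambda>x. c * f x)"
  using assms by (auto simp: square_integrable_def norm_mult power_mult_distrib)

lemma integrable_mult_cnj:
  assumes "square_integrable M f" "square_integrable M g"
  shows "integrable M (\<lambda>x. f x * cnj (g x))"
proof (rule Bochner_Integration.integrable_bound)
  have [measurable]: "f \<in> borel_measurable M" "g \<in> borel_measurable M"
    using assms by (auto simp: square_integrable_def)
  show "integrable M (\<lambda>x. (cmod (f x))\<^sup>2 + (cmod (g x))\<^sup>2)"
    using assms by (auto simp: square_integrable_def)
  have [measurable]: "(\<lambda>x. cnj (g x)) \<in> borel_measurable M"
    by (rule measurable_compose[OF _ borel_measurable_continuous_onI]) (auto intro: continuous_intros)
  show "(\<lambda>x. f x * cnj (g x)) \<in> borel_measurable M" by measurable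
  show "AE x in M. norm (f x * cnj (g x)) \<le> norm ((cmod (f x))\<^sup>2 + (cmod (g x))\<^sup>2)"
  proof (rule AE_I2)
    fix x
    have "2 * (cmod (f x) * cmod (g x)) \<le> (cmod (f x))\<^sup>2 + (cmod (g x))\<^sup>2"
      using zero_le_power2[of "cmod (f x) - cmod (g x)"] by (simp add: power2_eq_square algebra_simps)
    moreover have "0 \<le> cmod (f x) * cmod (g x)" by simp
    ultimately have "cmod (f x) * cmod (g x) \<le> (cmod (f x))\<^sup>2 + (cmod (g x))\<^sup>2" by linarith
    then show "norm (f x * cnj (g x)) \<le> norm ((cmod (f x))\<^sup>2 + (cmod (g x))\<^sup>2)"
      by (simp add: norm_mult)
  qed
qed

definition l2_rel :: "(real \<Rightarrow> complex) \<Rightarrow> (real \<Rightarrow> complex) \<Rightarrow> bool" where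
  "l2_rel f g \<longleftrightarrow> square_integrable lebesgue f \<and> square_integrable lebesgue g \<and>
     (AE x in lebesgue. f x = g x)"

quotient_type l2 = "real \<Rightarrow> complex" / partial: l2_rel
proof (rule part_equivpI)
  show "\<exists>f. l2_rel f f"
    by (rule exI[of _ "\<lambda>_. 0"]) (simp add: l2_rel_def square_integrable_0)
  show "symp l2_rel"
    by (rule sympI) (auto simp: l2_rel_def)
  show "transp l2_rel"
    by (rule transpI) (auto simp: l2_rel_def)
qed

lift_definition scaleC :: "complex \<Rightarrow> l2 \<Rightarrow> l2" (infixr \<open>*\<^sub>C\<close> 75)
  is "\<lambda>c f x. c * f x"
  by (auto simp: l2_rel_def intro: square_integrable_cmult)

lift_definition cinner :: "l2 \<Rightarrow> l2 \<Rightarrow> complex"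
  is "\<lambda>f g. integral\<^sup>L lebesgue (\<lambda>x. f x * cnj (g x))"
proof -
  fix f f' g g' assume "l2_rel f f'" "l2_rel g g'"
  then have sq: "square_integrable lebesgue f" "square_integrable lebesgue f'"
      "square_integrable lebesgue g" "square_integrable lebesgue g'"
    and ae: "AE x in lebesgue. f x = f' x" "AE x in lebesgue. g x = g' x"
    by (auto simp: l2_rel_def)
  show "integral\<^sup>L lebesgue (\<lambda>x. f x * cnj (g x)) = integral\<^sup>L lebesgue (\<lambda>x. f' x * cnj (g' x))"
    using integrable_mult_cnj sq ae
    by (intro integral_cong_AE borel_measurable_integrable) auto
qed

instantiation l2 :: real_vector
begin
lift_definition zero_l2 :: l2 is "\<lambda>_. 0"
  by (simp add: l2_rel_def square_integrable_0)
lift_definition plus_l2 :: "l2 \<Rightarrow> l2 \<Rightarrow> l2" is "\<lambda>f g x. f x + g x"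
  by (auto simp: l2_rel_def intro: square_integrable_add)
definition "uminus_l2 u = (-1) *\<^sub>C (u :: l2)"
definition "minus_l2 u v = u + - (v :: l2)"
definition "scaleR_l2 r u = complex_of_real r *\<^sub>C (u :: l2)"
instance
proof
  fix a b c :: l2 and r s :: real
  show "a + b + c = a + (b + c)"
    by transfer (auto simp: l2_rel_def algebra_simps intro!: square_integrable_add)
  show "a + b = b + a"
    by transfer (auto simp: l2_rel_def algebra_simps intro!: square_integrable_add)
  show "0 + a = a"
    by transfer (auto simp: l2_rel_def)
  show "- a + a = 0"
    unfolding uminus_l2_def
    by transfer (auto simp: l2_rel_def square_integrable_0 
        dest: square_integrable_add[OF square_integrable_cmult[of _ _ "-1"]])
  show "a - b = a + - b" by (rule minus_l2_def)
  show "r *\<^sub>R (a + b) = r *\<^sub>R a + r *\<^sub>R b"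
    unfolding scaleR_l2_def
    by transfer (auto simp: l2_rel_def distrib_left distrib_right mult.assoc
        intro!: square_integrable_add square_integrable_cmult)
  show "(r + s) *\<^sub>R a = r *\<^sub>R a + s *\<^sub>R a"
    unfolding scaleR_l2_def
    by transfer (auto simp: l2_rel_def distrib_left distrib_right mult.assoc
        intro!: square_integrable_add square_integrable_cmult)
  show "r *\<^sub>R s *\<^sub>R a = (r * s) *\<^sub>R a"
    unfolding scaleR_l2_def
    by transfer (auto simp: l2_rel_def mult.assoc intro!: square_integrable_cmult)
  show "1 *\<^sub>R a = a"
    unfolding scaleR_l2_def
    by transfer (auto simp: l2_rel_def)
qed
end

interpretation cvec: vector_space scaleC
proof
  fix a b :: complex and x y :: l2
  show "a *\<^sub>C (x + y) = a *\<^sub>C x + a *\<^sub>C y"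
    by transfer (auto simp: l2_rel_def distrib_left distrib_right mult.assoc
        intro!: square_integrable_add square_integrable_cmult)
  show "(a + b) *\<^sub>C x = a *\<^sub>C x + b *\<^sub>C x"
    by transfer (auto simp: l2_rel_def distrib_left distrib_right mult.assoc
        intro!: square_integrable_add square_integrable_cmult)
  show "a *\<^sub>C b *\<^sub>C x = (a * b) *\<^sub>C x"
    by transfer (auto simp: l2_rel_def mult.assoc intro!: square_integrable_cmult)
  show "1 *\<^sub>C x = x"
    by transfer (auto simp: l2_rel_def)
qed

lemma cinner_commute: "cinner u v = cnj (cinner v u)"
  by transfer (simp add: Bochner_Integration.integral_cnj[symmetric] mult.commute
      del: Bochner_Integration.integral_cnj)

lemma cinner_add_left: "cinner (u + v) w = cinner u w + cinner v w"
  by transfer (auto simp: l2_rel_def distrib_right integrable_mult_cnj)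

lemma cinner_scaleC_left: "cinner (c *\<^sub>C u) v = c * cinner u v"
  by transfer (simp add: mult.assoc)

lemma cinner_self: "Re (cinner u u) \<ge> 0" "cinner u u = 0 \<longleftrightarrow> u = 0"
proof -
  have *: "f x * cnj (f x) = complex_of_real ((cmod (f x))\<^sup>2)" for f :: "real \<Rightarrow> complex" and x
    by (rule complex_norm_square[symmetric])
  show "Re (cinner u u) \<ge> 0"
    by transfer (simp add: * del: of_real_power)
  show "cinner u u = 0 \<longleftrightarrow> u = 0"
    by transfer (auto simp: * l2_rel_def square_integrable_0 square_integrable_def
        integral_nonneg_eq_0_iff_AE simp del: of_real_power)
qed

instantiation l2 :: real_inner
begin
definition "inner_l2 u v = Re (cinner u v)"
definition "norm_l2 u = sqrt (inner u (u :: l2))"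
definition "sgn_l2 u = inverse (norm u) *\<^sub>R (u :: l2)"
definition "dist_l2 u v = norm (u - v :: l2)"
definition "uniformity_l2 = (INF e\<in>{0<..}. principal {(x, y :: l2). dist x y < e})"
definition "open_l2 U \<longleftrightarrow> (\<forall>x\<in>U. \<forall>\<^sub>F (x', y :: l2) in uniformity. x' = x \<longrightarrow> y \<in> U)"
instance
proof
  fix x y z :: l2 and r :: real and U :: "l2 set"
  show "dist x y = norm (x - y)" by (rule dist_l2_def)
  show "sgn x = x /\<^sub>R norm x" by (rule sgn_l2_def)
  show "uniformity = (INF e\<in>{0<..}. principal {(x, y :: l2). dist x y < e})"
    by (rule uniformity_l2_def)
  show "open U \<longleftrightarrow> (\<forall>x\<in>U. \<forall>\<^sub>F (x', y) in uniformity. x' = x \<longrightarrow> y \<in> U)"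
    by (rule open_l2_def)
  show "inner x y = inner y x"
    unfolding inner_l2_def by (subst cinner_commute) simp
  show "inner (x + y) z = inner x z + inner y z"
    by (simp add: inner_l2_def cinner_add_left)
  show "inner (r *\<^sub>R x) y = r * inner x y"
    by (simp add: inner_l2_def scaleR_l2_def cinner_scaleC_left)
  show "0 \<le> inner x x"
    by (simp add: inner_l2_def cinner_self)
  have "Im (cinner x x) = 0"
    using arg_cong[OF cinner_commute[of x x], of Im] by simp
  then show "inner x x = 0 \<longleftrightarrow> x = 0"
    using cinner_self(2)[of x] by (simp add: inner_l2_def complex_eq_iff)
  show "norm x = sqrt (inner x x)" by (rule norm_l2_def)
qed
end

text \<open>
  \<open>L\<^sup>2(0,b)\<close> is realised as the subspace of those classes in \<^typ>\<open>l2\<close> that vanish almost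
  everywhere off \<open>(0,b)\<close>; \<open>toL2 b f\<close> is the class of the restriction of \<open>f\<close> to \<open>(0,b)\<close>,
  extended by zero.  It has the dummy value \<open>0\<close> if \<open>f\<close> is not square integrable on \<open>(0,b)\<close>.
\<close>

lift_definition toL2 :: "real \<Rightarrow> (real \<Rightarrow> complex) \<Rightarrow> l2"
  is "\<lambda>b f. if square_integrable (lebesgue_on {0<..<b}) f
            then (\<lambda>x. if x \<in> {0<..<b} then f x else 0) else (\<lambda>_. 0)"
proof -
  fix b :: real and f :: "real \<Rightarrow> complex"
  let ?e = "\<lambda>x. if x \<in> {0<..<b} then f x else 0"
  have "square_integrable lebesgue ?e" if f: "square_integrable (lebesgue_on {0<..<b}) f"
  proof -
    have "integrable lebesgue (\<lambda>x. if x \<in> {0<..<b} then (cmod (f x))\<^sup>2 else 0)"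
      using f unfolding square_integrable_def
      by (simp add: integrable_restrict_space indicator_def of_bool_def if_distrib if_distribR
          cong: if_cong)
    moreover have "(\<lambda>x. if x \<in> {0<..<b} then (cmod (f x))\<^sup>2 else 0) = (\<lambda>x. (cmod (?e x))\<^sup>2)"
      by auto
    moreover have "?e \<in> borel_measurable lebesgue"
      using f by (subst borel_measurable_if) (auto simp: square_integrable_def)
    ultimately show ?thesis by (simp add: square_integrable_def)
  qed
  then show "l2_rel (if square_integrable (lebesgue_on {0<..<b}) f then ?e else (\<lambda>_. 0))
                    (if square_integrable (lebesgue_on {0<..<b}) f then ?e else (\<lambda>_. 0))"
    by (auto simp: l2_rel_def square_integrable_0)
qed

definition L2_interval :: "real \<Rightarrow> l2 set" where
  "L2_interval b = range (toL2 b)"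


section \<open>Unbounded operators\<close>

text \<open>
  An operator is identified with its graph, so that its domain is given by \<^const>\<open>Domain\<close> and
  its closure by the topological \<^const>\<open>closure\<close> in the product space.  The form
  \<^const>\<open>cinner\<close> is linear in its first argument.
\<close>

type_synonym l2_op = "(l2 \<times> l2) set"

definition adjoint_op :: "l2 set \<Rightarrow> l2_op \<Rightarrow> l2_op" where
  "adjoint_op H A =
     {(w, z). w \<in> H \<and> z \<in> H \<and> (\<forall>(u, v) \<in> A. cinner v w = cinner u z)}"

definition shift_op :: "l2_op \<Rightarrow> complex \<Rightarrow> l2_op" where
  "shift_op T c = {(u, v + c *\<^sub>C u) | u v. (u, v) \<in> T}"

definition ker_op :: "l2_op \<Rightarrow> l2 set" where
  "ker_op T = {u. (u, 0) \<in> T}"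

definition nonneg_op :: "l2_op \<Rightarrow> bool" where
  "nonneg_op T \<longleftrightarrow> (\<forall>(u, v) \<in> T. cinner v u \<in> \<real>\<^sub>\<ge>\<^sub>0)"

definition deficiency_plus :: "l2 set \<Rightarrow> l2_op \<Rightarrow> nat" where
  "deficiency_plus H A = cvec.dim (ker_op (shift_op (adjoint_op H A) \<i>))"

definition deficiency_minus :: "l2 set \<Rightarrow> l2_op \<Rightarrow> nat" where
  "deficiency_minus H A = cvec.dim (ker_op (shift_op (adjoint_op H A) (- \<i>)))"

definition direct_sum_decomp :: "l2 set \<Rightarrow> l2 set \<Rightarrow> l2 set \<Rightarrow> bool" where
  "direct_sum_decomp U V W \<longleftrightarrow> cvec.subspace V \<and> cvec.subspace W \<and> V \<inter> W = {0} \<and>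
     U = {v + w | v w. v \<in> V \<and> w \<in> W}"


section \<open>Absolute continuity and Sobolev spaces\<close>

definition abs_continuous_on :: "real \<Rightarrow> real \<Rightarrow> (real \<Rightarrow> complex) \<Rightarrow> bool" where
  "abs_continuous_on c d f \<longleftrightarrow>
     (\<forall>\<epsilon>>0. \<exists>\<delta>>0. \<forall>D :: (real \<times> real) set.
        finite D \<and> (\<forall>(s, t) \<in> D. c \<le> s \<and> s < t \<and> t \<le> d) \<and>
        disjoint_family_on (\<lambda>(s, t). {s<..<t}) D \<and> (\<Sum>(s, t)\<in>D. t - s) < \<delta>
        \<longrightarrow> (\<Sum>(s, t)\<in>D. cmod (f t - f s)) < \<epsilon>)"

definition loc_abs_continuous :: "real \<Rightarrow> (real \<Rightarrow> complex) \<Rightarrow> bool" where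
  "loc_abs_continuous b f \<longleftrightarrow> (\<forall>c d. 0 < c \<and> c < d \<and> d < b \<longrightarrow> abs_continuous_on c d f)"

text \<open>
  Elements of \<open>H\<^sup>2[0,b]\<close> are taken in their \<open>C\<^sup>1[0,b]\<close> representatives, for which the boundary
  values of \<open>f\<close> and \<open>f'\<close> make sense.  Values of \<open>f\<close> off \<open>[0,b]\<close> are irrelevant.
\<close>

definition H2 :: "real \<Rightarrow> (real \<Rightarrow> complex) set" where
  "H2 b = {f. \<exists>f' f''.
      (\<forall>x\<in>{0..b}. (f has_vector_derivative f' x) (at x within {0..b})) \<and>
      abs_continuous_on 0 b f \<and> abs_continuous_on 0 b f' \<and>
      (AE x in lebesgue_on {0<..<b}. (f' has_vector_derivative f'' x) (at x)) \<and>
      square_integrable (lebesgue_on {0<..<b}) f''}"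

definition H2_tilde_0 :: "real \<Rightarrow> (real \<Rightarrow> complex) set" where
  "H2_tilde_0 b = {f \<in> H2 b. f 0 = 0 \<and> vector_derivative f (at 0 within {0..b}) = 0}"

definition H2_0 :: "real \<Rightarrow> (real \<Rightarrow> complex) set" where
  "H2_0 b = {f \<in> H2 b. f 0 = 0 \<and> vector_derivative f (at 0 within {0..b}) = 0 \<and>
                        f b = 0 \<and> vector_derivative f (at b within {0..b}) = 0}"


section \<open>Minimal and maximal Bessel operators\<close>

text \<open>
  \<open>bessel_pair \<nu> b f g\<close>: \<open>f\<close> is admissible for the maximal operator and \<open>g = \<tau>\<^sub>\<nu> f\<close> almost
  everywhere.  As \<open>f'\<close> is locally absolutely continuous, \<open>f''\<close> exists almost everywhere only.
\<close>

definition bessel_pair ::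
    "real \<Rightarrow> real \<Rightarrow> (real \<Rightarrow> complex) \<Rightarrow> (real \<Rightarrow> complex) \<Rightarrow> bool" where
  "bessel_pair \<nu> b f g \<longleftrightarrow>
     square_integrable (lebesgue_on {0<..<b}) f \<and> square_integrable (lebesgue_on {0<..<b}) g \<and>
     (\<exists>f' f''.
        (\<forall>x\<in>{0<..<b}. (f has_vector_derivative f' x) (at x)) \<and>
        loc_abs_continuous b f \<and> loc_abs_continuous b f' \<and>
        (AE x in lebesgue_on {0<..<b}. (f' has_vector_derivative f'' x) (at x) \<and>
           g x = - f'' x + complex_of_real ((\<nu>\<^sup>2 - 1/4) / x\<^sup>2) * f x))"

definition bessel_max :: "real \<Rightarrow> real \<Rightarrow> l2_op" where
  "bessel_max \<nu> b = {(toL2 b f, toL2 b g) | f g. bessel_pair \<nu> b f g}"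

definition bessel_min :: "real \<Rightarrow> real \<Rightarrow> l2_op" where
  "bessel_min \<nu> b = closure {(toL2 b f, toL2 b g) | f g. bessel_pair \<nu> b f g \<and>
     (\<exists>K. compact K \<and> K \<subseteq> {0<..<b} \<and> (\<forall>x \<in> {0<..<b} - K. f x = 0))}"

end

theory Submission
  imports Defs
begin

text \<open>
  Let \<open>\<tau> = - d\<^sup>2/dx\<^sup>2 + (\<nu>\<^sup>2 - 1/4)/x\<^sup>2\<close> and let \<open>u1, u2\<close> be the solutions \<open>x\<^bsup>1/2+\<nu>\<^esup>, x\<^bsup>1/2-\<nu>\<^esup>\<close>
  (\<open>x\<^bsup>1/2\<^esup>, x\<^bsup>1/2\<^esup> ln x\<close> if \<open>\<nu> = 0\<close>) of \<open>\<tau> u = 0\<close>. Their Wronskian \<open>w\<close> is a non-zero constant, and both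
  belong to \<open>L\<^sup>2(0,b)\<close> because \<open>\<nu> < 1\<close>. Everything rests on one explicit right inverse of \<open>\<tau>\<close>, given by
  variation of constants:
  \<open>res g (x) = (u1(x) \<integral>\<^sub>0\<^sup>x u2 g - u2(x) \<integral>\<^sub>0\<^sup>x u1 g) / w\<close>. It maps \<open>L\<^sup>2(0,b)\<close> to solutions of \<open>\<tau> f = g\<close>
  with \<open>f = O(x\<^bsup>3/2\<^esup>)\<close> and \<open>f' = O(x\<^bsup>1/2\<^esup>)\<close> at \<open>0\<close>.
  
  If \<open>f\<close> is in the maximal domain and \<open>g = \<tau> f\<close>, the Wronskians of \<open>f\<close> with \<open>u1, u2\<close> have derivatives
  \<open>u1 g, u2 g\<close>, and Cramer's rule recovers \<open>f = \<alpha> u1 + \<beta> u2 + res g\<close> (\<open>jet_decomposition\<close>). Hence the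
  maximal operator consists of the pairs \<open>(\<alpha> u1 + \<beta> u2 + res g, g)\<close> with \<open>g \<in> L\<^sup>2(0,b)\<close>. The minimal one
  consists of the pairs \<open>(res g, g)\<close> for which \<open>g\<close> is orthogonal to \<open>u1\<close> and \<open>u2\<close> (\<open>bessel_min_eq\<close>):
  orthogonality means that \<open>res g\<close> and its derivative vanish at \<open>b\<close>; it holds if \<open>res g\<close> has compact
  support and survives limits; and conversely truncations of such a \<open>g\<close>, corrected to be orthogonal to \<open>u1, u2\<close>
  again, give compactly supported approximations.
  
  These two descriptions yield all claims.
  
  \<^item> The adjoint of the minimal operator is the maximal one by
  Green's identity, since what is orthogonal to the orthogonal complement of \<open>u1, u2\<close> is a
  combination of \<open>u1\<close> and \<open>u2\<close> (\<open>adjoint_min_graph\<close>).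
  \<^item> The range of \<open>res\<close> is the space of \<open>f \<in> H\<^sup>2[0,b]\<close> with \<open>f(0) = f'(0) = 0\<close>. Here Hardy's inequality
  shows that \<open>f/x\<^sup>2 \<in> L\<^sup>2\<close> in both inclusions, while the growth at \<open>0\<close> excludes \<open>u1\<close> and \<open>u2\<close>. This
  gives both domains.
  \<^item> For \<open>f = res g\<close> in the minimal domain \<open>\<langle>\<tau> f, f\<rangle> = \<integral> |f' - (1/2 + \<nu>) f / x|\<^sup>2\<close>, so the operator is
  non-negative.
  \<^item> The kernel of the maximal operator minus \<open>z\<close> is the set of solutions of
  \<open>f = \<alpha> u1 + \<beta> u2 + z res f\<close>. As \<open>res\<close> is a Volterra operator, each pair \<open>(\<alpha>,\<beta>)\<close> has exactly one
  solution, and the dimension is \<open>2\<close> for every complex \<open>z\<close> (\<open>dim_kernel_max_graph\<close>).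
  
  Absolute continuity enters through two facts: an absolutely continuous function is the integral
  of its almost everywhere derivative (\<open>ac_deriv_has_integral\<close>), and conversely an indefinite Lebesgue
  integral is absolutely continuous with the integrand as derivative almost everywhere
  (\<open>ac_deriv_indefinite_integral\<close>).
\<close>

section \<open>Absolutely continuous functions with a prescribed derivative\<close>

text \<open>
  The condition of \<^const>\<open>abs_continuous_on\<close> is split into the admissible families of
  intervals and the quantity that has to be small on them.
\<close>
definition small_intervals :: "real \<Rightarrow> real \<Rightarrow> real \<Rightarrow> (real \<times> real) set \<Rightarrow> bool" where
  "small_intervals c d \<delta> D \<longleftrightarrow> finite D \<and> (\<forall>(s, t) \<in> D. c \<le> s \<and> s < t \<and> t \<le> d) \<and>
     disjoint_family_on (\<lambda>(s, t). {s<..<t}) D \<and> (\<Sum>(s, t)\<in>D. t - s) < \<delta>"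

definition variation_over :: "(real \<Rightarrow> complex) \<Rightarrow> (real \<times> real) set \<Rightarrow> real" where
  "variation_over f D = (\<Sum>(s, t)\<in>D. cmod (f t - f s))"

lemma abs_continuous_on_iff:
  "abs_continuous_on c d f \<longleftrightarrow>
     (\<forall>\<epsilon>>0. \<exists>\<delta>>0. \<forall>D. small_intervals c d \<delta> D \<longrightarrow> variation_over f D < \<epsilon>)"
  unfolding abs_continuous_on_def small_intervals_def variation_over_def ..

lemma abs_continuous_onD:
  assumes "abs_continuous_on c d f" "\<epsilon> > 0"
  obtains \<delta> where "\<delta> > 0" "\<And>D. small_intervals c d \<delta> D \<Longrightarrow> variation_over f D < \<epsilon>"
  using assms unfolding abs_continuous_on_iff by meson

text \<open>
  Sums, products, conjugates and Lipschitz functions are absolutely continuous because their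
  increments are controlled by those of functions already known to have it.
\<close>
lemma abs_continuous_on_dominated:
  assumes f: "abs_continuous_on c d f" and g: "abs_continuous_on c d g"
    and M: "\<And>s t. c \<le> s \<Longrightarrow> s < t \<Longrightarrow> t \<le> d \<Longrightarrow>
        cmod (h t - h s) \<le> M * cmod (f t - f s) + M * cmod (g t - g s)"
  shows "abs_continuous_on c d h"
  unfolding abs_continuous_on_iff
proof (intro allI impI)
  fix \<epsilon> :: real assume "\<epsilon> > 0"
  define K where "K = \<bar>M\<bar> + 1"
  have K: "K > 0" "M \<le> K" by (auto simp: K_def)
  with \<open>\<epsilon> > 0\<close> have e: "\<epsilon> / (2 * K) > 0" by simp
  obtain d1 where d1: "d1 > 0" "\<And>D. small_intervals c d d1 D \<Longrightarrow> variation_over f D < \<epsilon> / (2 * K)"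
    using abs_continuous_onD[OF f e] by blast
  obtain d2 where d2: "d2 > 0" "\<And>D. small_intervals c d d2 D \<Longrightarrow> variation_over g D < \<epsilon> / (2 * K)"
    using abs_continuous_onD[OF g e] by blast
  show "\<exists>\<delta>>0. \<forall>D. small_intervals c d \<delta> D \<longrightarrow> variation_over h D < \<epsilon>"
  proof (intro exI[of _ "min d1 d2"] conjI allI impI)
    show "min d1 d2 > 0" using d1 d2 by simp
    fix D assume D: "small_intervals c d (min d1 d2) D"
    then have D12: "small_intervals c d d1 D" "small_intervals c d d2 D"
      by (auto simp: small_intervals_def)
    have "variation_over h D \<le> (\<Sum>(s, t)\<in>D. K * cmod (f t - f s) + K * cmod (g t - g s))"
      unfolding variation_over_def
    proof (rule sum_mono, clarify)
      fix s t assume st: "(s, t) \<in> D"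
      then have "cmod (h t - h s) \<le> M * cmod (f t - f s) + M * cmod (g t - g s)"
        using D by (intro M) (auto simp: small_intervals_def)
      also have "\<dots> \<le> K * cmod (f t - f s) + K * cmod (g t - g s)"
        using K by (intro add_mono mult_right_mono) auto
      finally show "cmod (h t - h s) \<le> K * cmod (f t - f s) + K * cmod (g t - g s)" .
    qed
    also have "\<dots> = K * variation_over f D + K * variation_over g D"
      by (simp add: sum.distrib sum_distrib_left case_prod_unfold variation_over_def)
    also have "\<dots> < K * (\<epsilon> / (2 * K)) + K * (\<epsilon> / (2 * K))"
      using D12 K by (intro add_strict_mono mult_strict_left_mono d1(2) d2(2)) auto
    also have "\<dots> = \<epsilon>" using K by (simp add: field_simps)
    finally show "variation_over h D < \<epsilon>" .
  qed
qed

lemma small_intervals_subset: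
  assumes "small_intervals c' d' \<delta> D" "c \<le> c'" "d' \<le> d"
  shows "small_intervals c d \<delta> D"
proof -
  have "\<forall>(s, t) \<in> D. c \<le> s \<and> s < t \<and> t \<le> d"
    using assms by (fastforce simp: small_intervals_def)
  then show ?thesis using assms(1) by (simp add: small_intervals_def)
qed

lemma abs_continuous_on_subset:
  "abs_continuous_on c d f \<Longrightarrow> c \<le> c' \<Longrightarrow> d' \<le> d \<Longrightarrow> abs_continuous_on c' d' f"
  unfolding abs_continuous_on_iff by (meson small_intervals_subset)

lemma abs_continuous_on_cong:
  assumes "abs_continuous_on c d f" "\<And>x. c \<le> x \<Longrightarrow> x \<le> d \<Longrightarrow> f x = g x"
  shows "abs_continuous_on c d g"
  by (rule abs_continuous_on_dominated[OF assms(1) assms(1), where M = 1]) (simp add: assms(2))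

lemma abs_continuous_on_id: "abs_continuous_on c d complex_of_real"
proof -
  have "variation_over complex_of_real D < \<epsilon>" if D: "small_intervals c d \<epsilon> D" for \<epsilon> D
  proof -
    have "variation_over complex_of_real D = (\<Sum>(s, t)\<in>D. t - s)"
      unfolding variation_over_def using D
      by (intro sum.cong) (auto simp: small_intervals_def simp flip: of_real_diff)
    then show ?thesis using D by (simp add: small_intervals_def)
  qed
  then show ?thesis unfolding abs_continuous_on_iff by blast
qed

lemma abs_continuous_on_imp_continuous_on:
  assumes f: "abs_continuous_on c d f"
  shows "continuous_on {c..d} f"
  unfolding continuous_on_iff
proof (intro ballI allI impI)
  fix x \<epsilon> :: real assume x: "x \<in> {c..d}" and "\<epsilon> > 0"
  from abs_continuous_onD[OF f this(2)] obtain \<delta> where d: "\<delta> > 0"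
    "\<And>D. small_intervals c d \<delta> D \<Longrightarrow> variation_over f D < \<epsilon>" by blast
  have *: "cmod (f t - f s) < \<epsilon>" if "c \<le> s" "s < t" "t \<le> d" "t - s < \<delta>" for s t
    using d(2)[of "{(s, t)}"] that
    by (simp add: small_intervals_def variation_over_def disjoint_family_on_def)
  show "\<exists>\<delta>>0. \<forall>x'\<in>{c..d}. dist x' x < \<delta> \<longrightarrow> dist (f x') (f x) < \<epsilon>"
  proof (intro exI[of _ \<delta>] conjI ballI impI d(1))
    fix y assume y: "y \<in> {c..d}" "dist y x < \<delta>"
    consider "y = x" | "y < x" | "x < y" by linarith
    then show "dist (f y) (f x) < \<epsilon>"
    proof cases
      case 1 then show ?thesis using \<open>\<epsilon> > 0\<close> by simp
    next
      case 2 then show ?thesis using *[of y x] x y by (auto simp: dist_norm norm_minus_commute)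
    next
      case 3 then show ?thesis using *[of x y] x y by (auto simp: dist_norm)
    qed
  qed
qed

lemma abs_continuous_on_mult:
  assumes f: "abs_continuous_on c d f" and g: "abs_continuous_on c d g"
  shows "abs_continuous_on c d (\<lambda>x. f x * g x)"
proof -
  have "bounded (f ` {c..d})" "bounded (g ` {c..d})"
    using f g by (auto intro!: compact_imp_bounded compact_continuous_image
        abs_continuous_on_imp_continuous_on)
  then obtain A B where A: "\<And>x. x \<in> {c..d} \<Longrightarrow> cmod (f x) \<le> A" and B: "\<And>x. x \<in> {c..d} \<Longrightarrow> cmod (g x) \<le> B"
    unfolding bounded_iff by fastforce
  define M where "M = max A B"
  show ?thesis
  proof (rule abs_continuous_on_dominated[OF f g, where M = M])
    fix s t assume st: "c \<le> s" "s < t" "t \<le> d"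
    have "f t * g t - f s * g s = g t * (f t - f s) + f s * (g t - g s)" by (simp add: algebra_simps)
    also have "cmod \<dots> \<le> cmod (g t) * cmod (f t - f s) + cmod (f s) * cmod (g t - g s)"
      by (metis norm_mult norm_triangle_ineq)
    also have "\<dots> \<le> M * cmod (f t - f s) + M * cmod (g t - g s)"
      using A[of s] B[of t] st by (intro add_mono mult_right_mono) (auto simp: M_def)
    finally show "cmod (f t * g t - f s * g s) \<le> M * cmod (f t - f s) + M * cmod (g t - g s)" .
  qed
qed

text \<open>
  \<open>ac_deriv c d F g\<close> is the calculus used throughout: \<open>F\<close> is an antiderivative of \<open>g\<close> on
  \<open>[c,d]\<close> in the sense of Lebesgue. Sum, product and conjugation rules hold as for ordinary
  derivatives, and \<open>F d - F c\<close> is the integral of \<open>g\<close>.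
\<close>
definition ac_deriv :: "real \<Rightarrow> real \<Rightarrow> (real \<Rightarrow> complex) \<Rightarrow> (real \<Rightarrow> complex) \<Rightarrow> bool" where
  "ac_deriv c d F g \<longleftrightarrow> abs_continuous_on c d F \<and>
     (\<exists>N. negligible N \<and> (\<forall>x \<in> {c<..<d} - N. (F has_vector_derivative g x) (at x)))"

lemma ac_derivD: "ac_deriv c d F g \<Longrightarrow> continuous_on {c..d} F"
  by (simp add: ac_deriv_def abs_continuous_on_imp_continuous_on)

lemma ac_deriv_subset:
  assumes "ac_deriv c d F g" "c \<le> c'" "d' \<le> d"
  shows "ac_deriv c' d' F g"
proof -
  have "{c'<..<d'} \<subseteq> {c<..<d}" using assms by auto
  then show ?thesis using assms abs_continuous_on_subset unfolding ac_deriv_def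
    by (meson DiffD1 DiffD2 DiffI subsetD)
qed

lemma ac_deriv_add:
  assumes "ac_deriv c d F f" "ac_deriv c d G g"
  shows "ac_deriv c d (\<lambda>x. F x + G x) (\<lambda>x. f x + g x)"
proof -
  obtain N1 N2 where N: "negligible N1" "\<forall>x \<in> {c<..<d} - N1. (F has_vector_derivative f x) (at x)"
    "negligible N2" "\<forall>x \<in> {c<..<d} - N2. (G has_vector_derivative g x) (at x)"
    using assms unfolding ac_deriv_def by blast
  have "abs_continuous_on c d (\<lambda>x. F x + G x)"
  proof (rule abs_continuous_on_dominated[where f = F and g = G and M = 1])
    fix s t
    show "cmod (F t + G t - (F s + G s)) \<le> 1 * cmod (F t - F s) + 1 * cmod (G t - G s)"
      using norm_triangle_ineq[of "F t - F s" "G t - G s"] by (simp add: algebra_simps)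
  qed (use assms in \<open>auto simp: ac_deriv_def\<close>)
  moreover have "\<forall>x \<in> {c<..<d} - (N1 \<union> N2). ((\<lambda>x. F x + G x) has_vector_derivative f x + g x) (at x)"
    using N by (auto intro: has_vector_derivative_add)
  moreover have "negligible (N1 \<union> N2)" using N by simp
  ultimately show ?thesis unfolding ac_deriv_def by blast
qed

lemma ac_deriv_mult:
  assumes "ac_deriv c d F f" "ac_deriv c d G g"
  shows "ac_deriv c d (\<lambda>x. F x * G x) (\<lambda>x. F x * g x + f x * G x)"
proof -
  obtain N1 N2 where N: "negligible N1" "\<forall>x \<in> {c<..<d} - N1. (F has_vector_derivative f x) (at x)"
    "negligible N2" "\<forall>x \<in> {c<..<d} - N2. (G has_vector_derivative g x) (at x)"
    using assms unfolding ac_deriv_def by blast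
  have "\<forall>x \<in> {c<..<d} - (N1 \<union> N2). ((\<lambda>x. F x * G x) has_vector_derivative F x * g x + f x * G x) (at x)"
    using N by (auto intro: has_vector_derivative_mult)
  moreover have "negligible (N1 \<union> N2)" using N by simp
  ultimately show ?thesis using assms abs_continuous_on_mult unfolding ac_deriv_def by blast
qed

lemma ac_deriv_const: "ac_deriv c d (\<lambda>_. k) (\<lambda>_. 0)"
  unfolding ac_deriv_def
  by (auto intro!: exI[of _ "{}"] abs_continuous_on_dominated[OF abs_continuous_on_id abs_continuous_on_id, where M=1])

lemma ac_deriv_cmult: "ac_deriv c d F f \<Longrightarrow> ac_deriv c d (\<lambda>x. k * F x) (\<lambda>x. k * f x)"
  using ac_deriv_mult[OF ac_deriv_const] by simp

lemma ac_deriv_diff: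
  assumes "ac_deriv c d F f" "ac_deriv c d G g"
  shows "ac_deriv c d (\<lambda>x. F x - G x) (\<lambda>x. f x - g x)"
  using ac_deriv_add[OF assms(1) ac_deriv_cmult[OF assms(2), of "-1"]] by simp

lemma ac_deriv_cnj:
  assumes "ac_deriv c d F f"
  shows "ac_deriv c d (\<lambda>x. cnj (F x)) (\<lambda>x. cnj (f x))"
proof -
  have "abs_continuous_on c d (\<lambda>x. cnj (F x))"
    by (rule abs_continuous_on_dominated[where f = F and g = F and M = 1])
      (use assms in \<open>auto simp: ac_deriv_def simp flip: complex_cnj_diff\<close>)
  then show ?thesis using assms unfolding ac_deriv_def
    by (metis (no_types, lifting) has_vector_derivative_cnj)
qed

lemma ac_deriv_C1:
  assumes "\<And>x. x \<in> {c..d} \<Longrightarrow> (F has_vector_derivative f x) (at x within {c..d})" "continuous_on {c..d} f"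
  shows "ac_deriv c d F f"
proof -
  have "bounded (f ` {c..d})"
    using assms by (auto intro!: compact_imp_bounded compact_continuous_image)
  then obtain M where M: "\<And>x. x \<in> {c..d} \<Longrightarrow> cmod (f x) \<le> M"
    unfolding bounded_iff by fastforce
  have "abs_continuous_on c d F"
  proof (rule abs_continuous_on_dominated[OF abs_continuous_on_id abs_continuous_on_id, where M = "M"])
    fix s t assume st: "c \<le> s" "s < t" "t \<le> d"
    have "norm (F t - F s) \<le> M * norm (t - s)"
    proof (rule differentiable_bound[where S = "{s..t}" and f' = "\<lambda>x h. h *\<^sub>R f x"])
      show "(F has_derivative (\<lambda>h. h *\<^sub>R f x)) (at x within {s..t})" if "x \<in> {s..t}" for x
        using assms(1)[of x] that st unfolding has_vector_derivative_def
        by (auto intro: has_derivative_subset)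
      show "onorm (\<lambda>h. h *\<^sub>R f x) \<le> M" if "x \<in> {s..t}" for x
        using M[of x] that st by (intro onorm_le) (auto simp: mult_right_mono mult.commute[of M] mult_left_mono)
    qed (use st in auto)
    moreover have "0 \<le> M" using M[of s] st order_trans[OF norm_ge_zero[of "f s"]] by auto
    ultimately show "cmod (F t - F s) \<le> M * cmod (complex_of_real t - complex_of_real s) + M * cmod (complex_of_real t - complex_of_real s)"
      using st by (simp flip: of_real_diff add: norm_of_real)
       (smt (verit) mult_nonneg_nonneg)
  qed
  moreover have "(F has_vector_derivative f x) (at x)" if "x \<in> {c<..<d} - {}" for x
    using assms(1)[of x] that at_within_Icc_at[of c x d] by auto
  ultimately show ?thesis unfolding ac_deriv_def by blast
qed

lemma ac_deriv_cong:
  assumes "ac_deriv c d F f" "\<And>x. x \<in> {c..d} \<Longrightarrow> F x = G x" "\<And>x. x \<in> {c<..<d} \<Longrightarrow> f x = g x"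
  shows "ac_deriv c d G g"
proof -
  obtain N1 where N: "negligible N1" "\<forall>x \<in> {c<..<d} - N1. (F has_vector_derivative f x) (at x)"
    using assms unfolding ac_deriv_def by blast
  have "(G has_vector_derivative g x) (at x)" if "x \<in> {c<..<d} - N1" for x
  proof (rule has_vector_derivative_transform_within_open[where S = "{c<..<d}" and f = F])
    show "(F has_vector_derivative g x) (at x)" using N(2) that assms(3) by auto
  qed (use that assms in auto)
  moreover have "abs_continuous_on c d G"
    using assms by (auto simp: ac_deriv_def intro: abs_continuous_on_cong)
  ultimately show ?thesis using N unfolding ac_deriv_def by blast
qed

section \<open>The fundamental theorem of calculus in Lebesgue's form\<close>

lemma absolutely_integrable_imp_integrable_on:
  fixes f :: "'a::euclidean_space \<Rightarrow> 'b::euclidean_space"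
  shows "f absolutely_integrable_on S \<Longrightarrow> f integrable_on S"
  by (simp add: absolutely_integrable_on_def)

text \<open>
  A null set has open neighbourhoods of arbitrarily small measure, and the intervals of a tagged
  division that lie in such a neighbourhood have small total length; absolute continuity then makes
  their contribution to the variation of \<open>F\<close> small. This is what replaces differentiability at the
  exceptional points in the next theorem.
\<close>
lemma abs_continuous_on_small_variation:
  assumes F: "abs_continuous_on c d F" and N: "negligible N" and "e > 0"
  shows "\<exists>U. open U \<and> N \<subseteq> U \<and>
    (\<forall>\<D>. \<D> tagged_partial_division_of {c..d} \<longrightarrow> (\<forall>(x, K) \<in> \<D>. K \<subseteq> U) \<longrightarrow>
        (\<Sum>(x, K)\<in>\<D>. cmod (F (Sup K) - F (Inf K))) < e)"
proof -
  from abs_continuous_onD[OF F \<open>e > 0\<close>] obtain \<delta> where d: "\<delta> > 0"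
    "\<And>D. small_intervals c d \<delta> D \<Longrightarrow> variation_over F D < e" by blast
  have "N \<in> sets lebesgue" using N by (rule negligible_imp_sets)
  then obtain U where U: "open U" "N \<subseteq> U" "U - N \<in> lmeasurable" "emeasure lebesgue (U - N) < ennreal \<delta>"
    using sets_lebesgue_outer_open d(1) by blast
  have Um: "U \<in> lmeasurable" "measure lebesgue U < \<delta>"
  proof -
    have "U = (U - N) \<union> N" using U by auto
    then show "U \<in> lmeasurable" using U(3) N by (metis fmeasurable.Un negligible_imp_measurable)
    have "measure lebesgue U = measure lebesgue (U - N)"
      using N U by (simp add: measure_Diff_null_set negligible_iff_null_sets)
    also have "\<dots> < \<delta>" using U(3,4) d(1) by (simp add: emeasure_eq_measure2 ennreal_less_iff)
    finally show "measure lebesgue U < \<delta>" .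
  qed
  show ?thesis
  proof (intro exI[of _ U] conjI allI impI U)
    fix \<D> assume D0: "\<D> tagged_partial_division_of {c..d}" and DU: "\<forall>(x, K) \<in> \<D>. K \<subseteq> U"
    define P where "P = {(x, K) \<in> \<D>. interior K \<noteq> {}}"
    have PD: "P \<subseteq> \<D>" by (auto simp: P_def)
    have P: "P tagged_partial_division_of {c..d}" using D0 PD by (rule tagged_partial_division_subset)
    have fin: "finite P" "finite \<D>" using P D0 by (auto simp: tagged_partial_division_of_def)
    have K: "\<exists>s t. K = {s..t} \<and> c \<le> s \<and> s \<le> t \<and> t \<le> d" if xK: "(x, K) \<in> \<D>" for x K
    proof -
      obtain s t where st: "K = {s..t}" "x \<in> K" "K \<subseteq> {c..d}"
        using tagged_partial_division_ofD(2)[OF D0 xK] tagged_partial_division_ofD(3)[OF D0 xK]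
          tagged_partial_division_ofD(4)[OF D0 xK] by (auto simp: box_real)
      then show ?thesis by (intro exI[of _ s] exI[of _ t]) auto
    qed
    have KP: "\<exists>s t. K = {s..t} \<and> c \<le> s \<and> s < t \<and> t \<le> d" if "(x, K) \<in> P" for x K
      using K[of x K] that by (fastforce simp: P_def)
    have "inj_on (\<lambda>(x, K). (Inf K, Sup K)) P"
    proof (rule inj_onI, clarify)
      fix x1 K1 x2 K2 assume a: "(x1, K1) \<in> P" "(x2, K2) \<in> P" "Inf K1 = Inf K2" "Sup K1 = Sup K2"
      obtain s t where st: "K1 = {s..t}" "s < t" using KP[OF a(1)] by auto
      obtain s' t' where st': "K2 = {s'..t'}" "s' < t'" using KP[OF a(2)] by auto
      have "K1 = K2" using a(3,4) st st' by simp
      then show "x1 = x2 \<and> K1 = K2"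
        using tagged_partial_division_ofD(5)[OF P a(1,2)] a(1) by (auto simp: P_def)
    qed
    then have sum_eq: "(\<Sum>(s, t)\<in>(\<lambda>(x, K). (Inf K, Sup K)) ` P. q s t) = (\<Sum>(x, K)\<in>P. q (Inf K) (Sup K))" for q :: "real \<Rightarrow> real \<Rightarrow> real"
      by (subst sum.reindex) (auto simp: case_prod_unfold)
    have "variation_over F ((\<lambda>(x, K). (Inf K, Sup K)) ` P) < e"
    proof (rule d(2), unfold small_intervals_def, intro conjI)
      show "finite ((\<lambda>(x, K). (Inf K, Sup K)) ` P)" using fin by simp
      show "\<forall>(s, t)\<in>(\<lambda>(x, K). (Inf K, Sup K)) ` P. c \<le> s \<and> s < t \<and> t \<le> d"
        using KP by fastforce
      show "disjoint_family_on (\<lambda>(s, t). {s<..<t}) ((\<lambda>(x, K). (Inf K, Sup K)) ` P)"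
        unfolding disjoint_family_on_def
      proof (intro ballI impI)
        fix p q assume pq: "p \<in> (\<lambda>(x, K). (Inf K, Sup K)) ` P" "q \<in> (\<lambda>(x, K). (Inf K, Sup K)) ` P" "p \<noteq> q"
        then obtain x1 K1 x2 K2 where a: "(x1, K1) \<in> P" "(x2, K2) \<in> P"
          "p = (Inf K1, Sup K1)" "q = (Inf K2, Sup K2)" by auto
        then have "interior K1 \<inter> interior K2 = {}"
          using tagged_partial_division_ofD(5)[OF P a(1,2)] pq(3) by auto
        then show "(\<lambda>(s, t). {s<..<t}) p \<inter> (\<lambda>(s, t). {s<..<t}) q = {}"
          using KP[OF a(1)] KP[OF a(2)] a(3,4) by (auto simp: interior_atLeastAtMost_real)
      qed
      have "(\<Sum>(s, t)\<in>(\<lambda>(x, K). (Inf K, Sup K)) ` P. t - s) = (\<Sum>(x, K)\<in>P. measure lborel K)"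
        unfolding sum_eq[of "\<lambda>s t. t - s"] by (intro sum.cong refl) (use KP in fastforce)
      also have "\<dots> = (\<Sum>K\<in>snd ` P. measure lborel K)"
        using sum.over_tagged_division_lemma[OF tagged_partial_division_of_Union_self[OF P], of "measure lborel"]
        by (simp add: content_eq_0_interior)
      also have "\<dots> = measure lebesgue (\<Union>(snd ` P))"
        unfolding content_division[OF partial_division_of_tagged_division[OF P], symmetric]
        by (intro sum.cong refl) (use KP in \<open>fastforce simp: measure_completion\<close>)
      also have "\<dots> \<le> measure lebesgue U"
        using DU PD Um lmeasurable_division[OF partial_division_of_tagged_division[OF P]]
        by (intro measure_mono_fmeasurable) (fastforce simp: fmeasurableD split: prod.splits)+
      finally show "(\<Sum>(s, t)\<in>(\<lambda>(x, K). (Inf K, Sup K)) ` P. t - s) < \<delta>" using Um by simp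
    qed
    moreover have "(\<Sum>(x, K)\<in>\<D>. cmod (F (Sup K) - F (Inf K))) = (\<Sum>(x, K)\<in>P. cmod (F (Sup K) - F (Inf K)))"
    proof (rule sum.mono_neutral_right[OF fin(2) PD], clarify)
      fix x K assume a: "(x, K) \<in> \<D>" "(x, K) \<notin> P"
      then obtain s t where "K = {s..t}" "s \<le> t" using K by blast
      moreover have "interior K = {}" using a by (auto simp: P_def)
      ultimately show "cmod (F (Sup K) - F (Inf K)) = 0" by (auto simp: interior_atLeastAtMost_real)
    qed
    ultimately show "(\<Sum>(x, K)\<in>\<D>. cmod (F (Sup K) - F (Inf K))) < e"
      by (simp add: sum_eq[of "\<lambda>s t. cmod (F t - F s)"] variation_over_def)
  qed
qed

text \<open>
  The Henstock-Kurzweil integral makes this direct. Outside the exceptional null set the gauge is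
  taken from the derivative, so that \<open>g x * (v - u)\<close> approximates \<open>F v - F u\<close>; on the null set \<open>g\<close>
  is replaced by \<open>0\<close> and the gauge by a neighbourhood on which \<open>F\<close> has small variation.
\<close>
theorem ac_deriv_has_integral:
  assumes F: "ac_deriv c d F g" and "c \<le> d"
  shows "(g has_integral F d - F c) {c..d}"
proof -
  obtain N0 where N0: "negligible N0" "\<forall>x \<in> {c<..<d} - N0. (F has_vector_derivative g x) (at x)"
    and ac: "abs_continuous_on c d F"
    using F unfolding ac_deriv_def by blast
  \<comment> \<open>at the endpoints no two-sided derivative is available, so they are treated as exceptional\<close>
  define N where "N = N0 \<union> {c, d}"
  have N: "negligible N" using N0 by (simp add: N_def)
  define g0 where "g0 = (\<lambda>x. if x \<in> N then 0 else g x)"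
  have D: "(F has_vector_derivative g0 x) (at x)" if "x \<in> {c..d}" "x \<notin> N" for x
  proof -
    have "x \<in> {c<..<d} - N0" using that by (auto simp: N_def less_le)
    then show ?thesis using N0(2) that by (auto simp: g0_def)
  qed
  have "(g0 has_integral F d - F c) {c..d}"
    unfolding has_integral_real
  proof (intro allI impI)
    fix e :: real assume "e > 0"
    \<comment> \<open>the tags outside \<open>N\<close> may contribute \<open>e / 2\<close>; adding \<open>1\<close> avoids division by zero if \<open>c = d\<close>\<close>
    define \<eta> where "\<eta> = e / (2 * (d - c + 1))"
    have \<eta>: "\<eta> > 0" using \<open>e > 0\<close> \<open>c \<le> d\<close> by (simp add: \<eta>_def)
    obtain U where U: "open U" "N \<subseteq> U"
      "\<And>\<D>. \<D> tagged_partial_division_of {c..d} \<Longrightarrow> (\<And>x K. (x, K) \<in> \<D> \<Longrightarrow> K \<subseteq> U) \<Longrightarrow>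
        (\<Sum>(x, K)\<in>\<D>. cmod (F (Sup K) - F (Inf K))) < e / 2"
      using abs_continuous_on_small_variation[OF ac N half_gt_zero[OF \<open>e > 0\<close>]]
      by (metis (no_types, lifting) case_prodI2)
    have "\<exists>r>0. \<forall>y. \<bar>y - x\<bar> < r \<longrightarrow> cmod (F y - F x - (y - x) *\<^sub>R g0 x) \<le> \<eta> * \<bar>y - x\<bar>"
      if "x \<in> {c..d}" "x \<notin> N" for x
      using D[OF that] \<eta> unfolding has_vector_derivative_def has_derivative_at_alt
      by (auto simp: real_norm_def)
    then obtain r where r: "\<And>x. x \<in> {c..d} \<Longrightarrow> x \<notin> N \<Longrightarrow> r x > 0"
      "\<And>x y. x \<in> {c..d} \<Longrightarrow> x \<notin> N \<Longrightarrow> \<bar>y - x\<bar> < r x \<Longrightarrow>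
           cmod (F y - F x - (y - x) *\<^sub>R g0 x) \<le> \<eta> * \<bar>y - x\<bar>"
      by metis
    define \<gamma> where "\<gamma> = (\<lambda>x. if x \<in> N then U else if x \<in> {c..d} then ball x (r x) else UNIV)"
    have "gauge \<gamma>" using U r by (auto simp: gauge_def \<gamma>_def)
    moreover have "cmod ((\<Sum>(x, K)\<in>\<D>. measure lborel K *\<^sub>R g0 x) - (F d - F c)) < e"
      if D: "\<D> tagged_division_of {c..d}" and fine: "\<gamma> fine \<D>" for \<D>
    proof -
      define A where "A = {(x, K) \<in> \<D>. x \<in> N}"
      define B where "B = {(x, K) \<in> \<D>. x \<notin> N}"
      have fin: "finite \<D>" using D by (rule tagged_division_of_finite)
      have AB: "\<D> = A \<union> B" "A \<inter> B = {}" "finite A" "finite B"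
        using fin by (auto simp: A_def B_def intro: finite_subset[OF _ fin])
      have K: "\<exists>s t. K = {s..t} \<and> c \<le> s \<and> s \<le> x \<and> x \<le> t \<and> t \<le> d" if xK: "(x, K) \<in> \<D>" for x K
      proof -
        obtain s t where st: "K = {s..t}" "x \<in> K" "K \<subseteq> {c..d}"
          using tagged_division_ofD(2)[OF D xK] tagged_division_ofD(3)[OF D xK] tagged_division_ofD(4)[OF D xK] by (auto simp: box_real)
        then show ?thesis by (intro exI[of _ s] exI[of _ t]) auto
      qed
      have "(\<Sum>(x, K)\<in>\<D>. measure lborel K *\<^sub>R g0 x) - (F d - F c)
          = (\<Sum>(x, K)\<in>\<D>. measure lborel K *\<^sub>R g0 x - (F (Sup K) - F (Inf K)))"
        using additive_tagged_division_1[OF \<open>c \<le> d\<close> D, of F]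
        by (simp add: sum_subtractf case_prod_unfold)
      also have "cmod \<dots> \<le> (\<Sum>(x, K)\<in>\<D>. cmod (measure lborel K *\<^sub>R g0 x - (F (Sup K) - F (Inf K))))"
        by (rule order_trans[OF norm_sum]) (simp add: case_prod_unfold)
      also have "\<dots> = (\<Sum>(x, K)\<in>A. cmod (measure lborel K *\<^sub>R g0 x - (F (Sup K) - F (Inf K))))
          + (\<Sum>(x, K)\<in>B. cmod (measure lborel K *\<^sub>R g0 x - (F (Sup K) - F (Inf K))))"
        using AB by (simp add: sum.union_disjoint)
      also have "(\<Sum>(x, K)\<in>A. cmod (measure lborel K *\<^sub>R g0 x - (F (Sup K) - F (Inf K))))
          = (\<Sum>(x, K)\<in>A. cmod (F (Sup K) - F (Inf K)))"
        by (intro sum.cong refl) (auto simp: A_def g0_def norm_minus_commute)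
      also have "\<dots> < e / 2"
      proof (rule U(3))
        show "A tagged_partial_division_of {c..d}"
          using D by (auto simp: tagged_division_of_def A_def intro: tagged_partial_division_subset)
        show "K \<subseteq> U" if "(x, K) \<in> A" for x K
          using fine that by (fastforce simp: A_def fine_def \<gamma>_def)
      qed
      also have "(\<Sum>(x, K)\<in>B. cmod (measure lborel K *\<^sub>R g0 x - (F (Sup K) - F (Inf K))))
          \<le> (\<Sum>(x, K)\<in>B. \<eta> * measure lborel K)"
      proof (rule sum_mono, clarify)
        fix x K assume xK: "(x, K) \<in> B"
        then obtain s t where st: "K = {s..t}" "c \<le> s" "s \<le> x" "x \<le> t" "t \<le> d" using K
          unfolding B_def by blast
        have x: "x \<in> {c..d}" "x \<notin> N" using xK st by (auto simp: B_def)
        have "K \<subseteq> ball x (r x)" using fine xK x by (force simp: B_def fine_def \<gamma>_def)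
        then have near: "\<bar>s - x\<bar> < r x" "\<bar>t - x\<bar> < r x" using st
          by (auto simp: dist_real_def subset_iff abs_minus_commute dest: spec[of _ s] spec[of _ t])
        have "measure lborel K *\<^sub>R g0 x - (F (Sup K) - F (Inf K))
            = (F s - F x - (s - x) *\<^sub>R g0 x) - (F t - F x - (t - x) *\<^sub>R g0 x)"
          using st by (simp add: algebra_simps)
        also have "cmod \<dots> \<le> \<eta> * \<bar>s - x\<bar> + \<eta> * \<bar>t - x\<bar>"
          by (rule order_trans[OF norm_triangle_ineq4 add_mono[OF r(2)[OF x near(1)] r(2)[OF x near(2)]]])
        also have "\<dots> = \<eta> * measure lborel K" using st by (simp add: algebra_simps)
        finally show "cmod (measure lborel K *\<^sub>R g0 x - (F (Sup K) - F (Inf K))) \<le> \<eta> * measure lborel K" .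
      qed
      also have "\<dots> \<le> (\<Sum>(x, K)\<in>\<D>. \<eta> * measure lborel K)"
        using \<eta> AB fin by (intro sum_mono2) auto
      also have "\<dots> = \<eta> * (\<Sum>(x, K)\<in>\<D>. measure lborel K)" by (simp add: sum_distrib_left case_prod_unfold)
      also have "(\<Sum>(x, K)\<in>\<D>. measure lborel K) = d - c"
        using additive_content_tagged_division[of \<D> c d] D \<open>c \<le> d\<close> by (simp add: box_real)
      also have "\<eta> * (d - c) \<le> e / 2"
        using \<open>e > 0\<close> \<open>c \<le> d\<close> by (simp add: \<eta>_def field_simps)
      finally show ?thesis by simp
    qed
    ultimately show "\<exists>\<gamma>. gauge \<gamma> \<and> (\<forall>\<D>. \<D> tagged_division_of {c..d} \<and> \<gamma> fine \<D> \<longrightarrow>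
        cmod ((\<Sum>(x, K)\<in>\<D>. measure lborel K *\<^sub>R g0 x) - (F d - F c)) < e)" by (intro exI[of _ \<gamma>]) simp
  qed
  then show ?thesis
    by (rule has_integral_spike[OF N, rotated]) (simp add: g0_def)
qed

text \<open>
  Lebesgue's differentiation theorem. The averages over \<open>[x, x + h]\<close> converge almost everywhere by
  \<open>integrable_ccontinuous_explicit\<close>; the same fact for the reflected function settles the averages
  over \<open>[x - h, x]\<close>.
\<close>
lemma has_vector_derivative_indefinite_integral_ae:
  fixes g :: "real \<Rightarrow> complex"
  assumes g: "g integrable_on {c..d}"
  obtains N where "negligible N"
    "\<And>x. x \<in> {c<..<d} - N \<Longrightarrow> ((\<lambda>x. integral {c..x} g) has_vector_derivative g x) (at x)"
proof -
  define h where "h = (\<lambda>x. if x \<in> {c..d} then g x else 0)"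
  have hU: "h integrable_on UNIV" using g unfolding h_def by (subst integrable_restrict_UNIV)
  have h: "h integrable_on {p..q}" for p q
    using hU integrable_on_subcbox[where f = h and S = UNIV and a = p and b = q] by (simp add: box_real)
  have h': "(\<lambda>x. h (- x)) integrable_on {p..q}" for p q
    using h[of "-q" "-p"] Henstock_Kurzweil_Integration.integrable_reflect_real[where f = h and b = "-p" and a = "-q"] by simp
  obtain N1 where N1: "negligible N1"
    "\<And>x e. x \<notin> N1 \<Longrightarrow> 0 < e \<Longrightarrow> \<exists>r>0. \<forall>k. 0 < k \<and> k < r \<longrightarrow> norm (integral {x..x + k} h /\<^sub>R k - h x) < e"
    using integrable_ccontinuous_explicit[where f = h] h by (auto simp: box_real)
  obtain N2 where N2: "negligible N2"
    "\<And>x e. x \<notin> N2 \<Longrightarrow> 0 < e \<Longrightarrow> \<exists>r>0. \<forall>k. 0 < k \<and> k < r \<longrightarrow> norm (integral {x..x + k} (\<lambda>x. h (- x)) /\<^sub>R k - h (- x)) < e"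
    using integrable_ccontinuous_explicit[where f = "\<lambda>x. h (- x)"] h' by (auto simp: box_real)
  define N where "N = N1 \<union> uminus ` N2"
  have "negligible (uminus ` N2)"
    using N2(1) by (intro negligible_differentiable_image_negligible) (auto intro!: derivative_intros)
  then have "negligible N" using N1(1) by (simp add: N_def)
  moreover have "((\<lambda>x. integral {c..x} g) has_vector_derivative g x) (at x)"
    if x: "x \<in> {c<..<d} - N" for x
  proof -
    have x': "x \<notin> N1" "- x \<notin> N2" using x by (force simp: N_def)+
    have hx: "h x = g x" using x by (simp add: h_def)
    have "(F has_vector_derivative h x) (at x)" if F: "F = (\<lambda>x. integral {c..x} h)" for F
      unfolding has_vector_derivative_def has_derivative_at_alt
    proof (intro conjI allI impI)
      show "bounded_linear (\<lambda>k. k *\<^sub>R h x)" by (simp add: bounded_linear_scaleR_left)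
      fix e :: real assume "e > 0"
      obtain r1 where r1: "r1 > 0" "\<And>k. 0 < k \<Longrightarrow> k < r1 \<Longrightarrow> norm (integral {x..x + k} h /\<^sub>R k - h x) < e"
        using N1(2)[OF x'(1) \<open>e > 0\<close>] by blast
      obtain r2 where r2: "r2 > 0" "\<And>k. 0 < k \<Longrightarrow> k < r2 \<Longrightarrow> norm (integral {-x..-x + k} (\<lambda>x. h (- x)) /\<^sub>R k - h x) < e"
        using N2(2)[OF x'(2) \<open>e > 0\<close>] by auto
      have comb: "F q - F p = integral {p..q} h" if "c \<le> p" "p \<le> q" for p q
        using Henstock_Kurzweil_Integration.integral_combine[OF that h] by (simp add: F algebra_simps)
      have step: "norm (v - k *\<^sub>R h x) \<le> e * k" if "k > 0" "norm (v /\<^sub>R k - h x) < e" for v k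
      proof -
        have "v - k *\<^sub>R h x = k *\<^sub>R (v /\<^sub>R k - h x)" using that(1) by (simp add: algebra_simps)
        then have "norm (v - k *\<^sub>R h x) = k * norm (v /\<^sub>R k - h x)" using that(1) by (metis norm_scaleR abs_of_pos)
        also have "\<dots> \<le> k * e" using that by (intro mult_left_mono) auto
        finally show ?thesis by (simp add: mult.commute)
      qed
      define r where "r = min (min r1 r2) (x - c)"
      have "norm (F y - F x - (y - x) *\<^sub>R h x) \<le> e * norm (y - x)" if "norm (y - x) < r" for y
      proof -
        consider "y = x" | "x < y" | "y < x" by linarith
        then show ?thesis
        proof cases
          case 2
          then have "F y - F x = integral {x..y} h" using x by (intro comb) auto
          then show ?thesis using step[OF _ r1(2), of "y - x"] 2 that by (simp add: r_def)
        next
          case 3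
          then have "F x - F y = integral {y..x} h" using x that by (intro comb) (auto simp: r_def)
          also have "\<dots> = integral {-x..-y} (\<lambda>x. h (- x))" using integral_reflect_real[where f = h and a = y and b = x] by simp
          finally have *: "F x - F y = integral {-x..-x + (x - y)} (\<lambda>x. h (- x))" by simp
          have "norm (F x - F y - (x - y) *\<^sub>R h x) \<le> e * (x - y)"
            using step[OF _ r2(2), of "x - y"] 3 that * by (simp add: r_def)
          moreover have "F y - F x - (y - x) *\<^sub>R h x = - (F x - F y - (x - y) *\<^sub>R h x)"
            by (simp add: algebra_simps)
          ultimately show ?thesis using 3 by (metis norm_minus_cancel real_norm_def abs_of_neg diff_less_0_iff_less minus_diff_eq)
        qed simp
      qed
      moreover have "r > 0" using r1 r2 x by (auto simp: r_def)
      ultimately show "\<exists>r>0. \<forall>y. norm (y - x) < r \<longrightarrow> norm (F y - F x - (y - x) *\<^sub>R h x) \<le> e * norm (y - x)" by blast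
    qed
    then have "((\<lambda>x. integral {c..x} h) has_vector_derivative h x) (at x)" by simp
    then show ?thesis unfolding hx
      by (rule has_vector_derivative_transform_within_open[where S = "{c<..<d}"])
        (use x in \<open>auto intro!: integral_cong simp: h_def\<close>)
  qed
  ultimately show ?thesis using that by blast
qed

lemma sum_integral_disjoint_le:
  fixes h :: "real \<Rightarrow> real"
  assumes h: "h integrable_on {c..d}" "\<And>x. h x \<ge> 0" and D0: "small_intervals c d \<delta> D"
  shows "(\<Sum>(s, t)\<in>D. integral {s..t} h) \<le> integral {c..d} h"
proof -
  have D: "finite D" "\<And>s t. (s, t) \<in> D \<Longrightarrow> c \<le> s \<and> s < t \<and> t \<le> d"
    "disjoint_family_on (\<lambda>(s, t). {s<..<t}) D"
    using D0 by (auto simp: small_intervals_def)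
  let ?k = "\<lambda>(s, t) x. if x \<in> {s<..<t} then h x else 0"
  have k: "?k p integrable_on {c..d}" "integral {c..d} (?k p) = integral {fst p..snd p} h" if "p \<in> D" for p
  proof -
    obtain s t where st: "p = (s, t)" "c \<le> s" "s < t" "t \<le> d" using D(2) \<open>p \<in> D\<close> by (cases p) auto
    have "{s<..<t} \<inter> {c..d} = {s<..<t}" using st by auto
    moreover have "h integrable_on {s<..<t}"
      using integrable_on_subinterval[OF h(1), of s t] st by (auto simp: integrable_on_Icc_iff_Ioo)
    moreover have "integral {s<..<t} h = integral {s..t} h"
      by (rule integral_open_interval_real[symmetric])
    ultimately show "?k p integrable_on {c..d}" "integral {c..d} (?k p) = integral {fst p..snd p} h"
      using integrable_restrict_Int[of "{s<..<t}" h "{c..d}"] integral_restrict_Int[of "{c..d}" "{s<..<t}" h]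
      by (auto simp: st)
  qed
  have "(\<Sum>(s, t)\<in>D. integral {s..t} h) = (\<Sum>p\<in>D. integral {c..d} (?k p))"
    using k by (intro sum.cong) auto
  also have "\<dots> = integral {c..d} (\<lambda>x. \<Sum>p\<in>D. ?k p x)"
    using k D(1) by (subst integral_sum) auto
  also have "\<dots> \<le> integral {c..d} h"
  proof (rule integral_le)
    show "(\<lambda>x. \<Sum>p\<in>D. ?k p x) integrable_on {c..d}" using k D(1) by (intro integrable_sum) auto
    fix x assume "x \<in> {c..d}"
    show "(\<Sum>p\<in>D. ?k p x) \<le> h x"
    proof (cases "\<exists>p\<in>D. x \<in> {fst p<..<snd p}")
      case True
      then obtain p where p: "p \<in> D" "x \<in> {fst p<..<snd p}" by blast
      have "(\<Sum>q\<in>D. ?k q x) = (\<Sum>q\<in>{p}. ?k q x)"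
      proof (rule sum.mono_neutral_right[OF D(1)])
        show "{p} \<subseteq> D" using p by simp
        have "?k q x = 0" if q: "q \<in> D - {p}" for q
        proof -
          obtain s t where st: "q = (s, t)" by fastforce
          have "{fst p<..<snd p} \<inter> {s<..<t} = {}"
          using D(3) p(1) q unfolding disjoint_family_on_def st by (force simp: case_prod_unfold)
        then have "x \<notin> {s<..<t}" using p(2) by blast
          then show ?thesis by (auto simp: st)
        qed
        then show "\<forall>q\<in>D - {p}. ?k q x = 0" by blast
      qed
      then show ?thesis using p(2) by (auto simp: split_beta)
    next
      case False
      then have "(\<Sum>p\<in>D. ?k p x) = 0" by (intro sum.neutral) (auto simp: split_beta)
      then show ?thesis using h(2) by simp
    qed
  qed (use h in auto)
  finally show ?thesis .
qed

text \<open>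
  Truncating \<open>|g|\<close> at height \<open>n\<close> leaves a remainder \<open>h\<close> with small integral; the truncated part
  contributes at most \<open>n\<close> times the total length of the intervals.
\<close>
lemma abs_continuous_on_indefinite_integral:
  fixes g :: "real \<Rightarrow> complex"
  assumes g: "g absolutely_integrable_on {c..d}"
  shows "abs_continuous_on c d (\<lambda>x. integral {c..x} g)"
  unfolding abs_continuous_on_iff
proof (intro allI impI)
  fix \<epsilon> :: real assume "\<epsilon> > 0"
  define k where "k = (\<lambda>n x. min (norm (g x)) (real n))"
  have ng: "(\<lambda>x. norm (g x)) absolutely_integrable_on {c..d}" using g by (rule absolutely_integrable_norm[unfolded comp_def])
  have k: "k n integrable_on {c..d}" for n
    unfolding k_def using absolutely_integrable_min_1[OF ng, where g = "\<lambda>_. real n"]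
    by (auto intro: absolutely_integrable_imp_integrable_on)
  have "(\<lambda>n. integral {c..d} (k n)) \<longlonglongrightarrow> integral {c..d} (\<lambda>x. norm (g x))"
  proof (rule dominated_convergence(2)[where h = "\<lambda>x. norm (g x)"])
    show "(\<lambda>n. k n x) \<longlonglongrightarrow> norm (g x)" if "x \<in> {c..d}" for x
    proof (rule tendsto_eventually)
      obtain m where "norm (g x) \<le> real m" using real_arch_simple by blast
      then show "\<forall>\<^sub>F n in sequentially. k n x = norm (g x)"
        unfolding k_def eventually_sequentially by (intro exI[of _ m]) (auto simp: min_def)
    qed
  qed (use k ng in \<open>auto simp: k_def intro: absolutely_integrable_imp_integrable_on\<close>)
  then obtain n where n: "integral {c..d} (\<lambda>x. norm (g x)) - integral {c..d} (k n) < \<epsilon> / 2"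
    using \<open>\<epsilon> > 0\<close> unfolding LIMSEQ_iff by (metis half_gt_zero order_refl real_norm_def abs_minus_commute abs_less_iff)
  define h where "h = (\<lambda>x. norm (g x) - k n x)"
  have h: "h integrable_on {c..d}" "\<And>x. h x \<ge> 0" "integral {c..d} h < \<epsilon> / 2"
    using k[of n] ng n
    by (auto simp: h_def Henstock_Kurzweil_Integration.integral_diff absolutely_integrable_imp_integrable_on
        intro!: integrable_diff) (simp add: k_def)
  show "\<exists>\<delta>>0. \<forall>D. small_intervals c d \<delta> D \<longrightarrow> variation_over (\<lambda>x. integral {c..x} g) D < \<epsilon>"
  proof (intro exI[of _ "\<epsilon> / (2 * (real n + 1))"] conjI allI impI)
    show "\<epsilon> / (2 * (real n + 1)) > 0" using \<open>\<epsilon> > 0\<close> by simp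
    fix D assume D0: "small_intervals c d (\<epsilon> / (2 * (real n + 1))) D"
    then have D: "finite D" "\<forall>(s, t) \<in> D. c \<le> s \<and> s < t \<and> t \<le> d" "(\<Sum>(s, t)\<in>D. t - s) < \<epsilon> / (2 * (real n + 1))"
      by (auto simp: small_intervals_def)
    have "variation_over (\<lambda>x. integral {c..x} g) D \<le> (\<Sum>(s, t)\<in>D. real n * (t - s) + integral {s..t} h)"
      unfolding variation_over_def
    proof (rule sum_mono, clarify)
      fix s t assume "(s, t) \<in> D"
      then have st: "c \<le> s" "s < t" "t \<le> d" using D(2) by auto
      have gi: "g integrable_on {c..t}" "g absolutely_integrable_on {s..t}"
        using st g by (auto intro: absolutely_integrable_imp_integrable_on intro!: absolutely_integrable_on_subinterval[OF g])
      have sub: "{s..t} \<subseteq> {c..d}" using st by auto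
      note ii = integrable_on_subinterval[OF _ sub]
      have "integral {c..t} g - integral {c..s} g = integral {s..t} g"
        using Henstock_Kurzweil_Integration.integral_combine[OF st(1) less_imp_le[OF st(2)] gi(1)] by (simp add: algebra_simps)
      also have "cmod \<dots> \<le> integral {s..t} (\<lambda>x. norm (g x))"
        using gi(2) by (intro integral_norm_bound_integral) (auto simp: absolutely_integrable_on_def)
      also have "\<dots> = integral {s..t} (\<lambda>x. k n x + h x)" by (simp add: h_def)
      also have "\<dots> = integral {s..t} (k n) + integral {s..t} h"
        using ii[OF k] ii[OF h(1)] by (rule Henstock_Kurzweil_Integration.integral_add)
      also have "integral {s..t} (k n) \<le> integral {s..t} (\<lambda>x. real n)"
        using ii[OF k] by (intro integral_le) (auto simp: k_def)
      finally show "cmod (integral {c..t} g - integral {c..s} g) \<le> real n * (t - s) + integral {s..t} h"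
        using st by (simp add: mult.commute)
    qed
    also have "\<dots> = real n * (\<Sum>(s, t)\<in>D. t - s) + (\<Sum>(s, t)\<in>D. integral {s..t} h)"
      by (simp add: sum.distrib sum_distrib_left case_prod_unfold)
    also have "real n * (\<Sum>(s, t)\<in>D. t - s) \<le> (real n + 1) * (\<epsilon> / (2 * (real n + 1)))"
      using D by (intro mult_mono) (auto intro!: sum_nonneg)
    also have "\<dots> = \<epsilon> / 2" by (simp add: field_simps)
    also have "(\<Sum>(s, t)\<in>D. integral {s..t} h) \<le> integral {c..d} h"
      by (rule sum_integral_disjoint_le[OF h(1,2) D0])
    finally show "variation_over (\<lambda>x. integral {c..x} g) D < \<epsilon>"
      using h(3) by simp
  qed
qed

lemma ac_deriv_indefinite_integral:
  fixes g :: "real \<Rightarrow> complex"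
  assumes g: "g absolutely_integrable_on {c..d}"
  shows "ac_deriv c d (\<lambda>x. integral {c..x} g) g"
proof -
  obtain N where "negligible N"
    "\<And>x. x \<in> {c<..<d} - N \<Longrightarrow> ((\<lambda>x. integral {c..x} g) has_vector_derivative g x) (at x)"
    using has_vector_derivative_indefinite_integral_ae[OF absolutely_integrable_imp_integrable_on[OF g]] by auto
  then show ?thesis using abs_continuous_on_indefinite_integral[OF g] unfolding ac_deriv_def by blast
qed

section \<open>Square integrable functions on an interval and Hardy's inequality\<close>

abbreviation sqint :: "real \<Rightarrow> (real \<Rightarrow> complex) \<Rightarrow> bool" where
  "sqint b \<equiv> square_integrable (lebesgue_on {0<..<b})"

lemma integrable_lebesgue_on_Ioo_iff:
  fixes f :: "real \<Rightarrow> 'a::euclidean_space"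
  shows "integrable (lebesgue_on {c<..<d}) f \<longleftrightarrow> f absolutely_integrable_on {c..d}"
  unfolding absolutely_integrable_on_Icc_iff_Ioo
  by (auto simp: set_integrable_def integrable_restrict_space)

lemma sqint_imp_measurable: "sqint b f \<Longrightarrow> f \<in> borel_measurable (lebesgue_on {0<..<b})"
  by (simp add: square_integrable_def)

lemma sqint_imp_integrable_norm2:
  "sqint b f \<Longrightarrow> (\<lambda>x. (cmod (f x))\<^sup>2) absolutely_integrable_on {0..b}"
  by (simp add: square_integrable_def integrable_lebesgue_on_Ioo_iff)

lemma sqint_bound:
  assumes "f \<in> borel_measurable (lebesgue_on {0<..<b})" "h integrable_on {0..b}"
    and "\<And>x. 0 < x \<Longrightarrow> x < b \<Longrightarrow> (cmod (f x))\<^sup>2 \<le> h x"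
  shows "sqint b f"
proof -
  have "(\<lambda>x. (cmod (f x))\<^sup>2) absolutely_integrable_on {0<..<b}"
  proof (rule measurable_bounded_by_integrable_imp_absolutely_integrable[where g = h])
    show "(\<lambda>x. (cmod (f x))\<^sup>2) \<in> borel_measurable (lebesgue_on {0<..<b})"
      using assms(1) by measurable
    show "h integrable_on {0<..<b}" using assms(2) by (simp add: integrable_on_Icc_iff_Ioo)
  qed (use assms in auto)
  then show ?thesis using assms(1)
    by (simp add: square_integrable_def integrable_lebesgue_on_Ioo_iff absolutely_integrable_on_Icc_iff_Ioo)
qed

lemma sqint_cong:
  assumes "sqint b f" "\<And>x. 0 < x \<Longrightarrow> x < b \<Longrightarrow> f x = g x"
  shows "sqint b g"
proof -
  have "g \<in> borel_measurable (lebesgue_on {0<..<b})"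
    using assms by (subst measurable_cong[where g = f]) (auto simp: sqint_imp_measurable space_restrict_space)
  then show ?thesis
    by (rule sqint_bound[OF _ absolutely_integrable_imp_integrable_on[OF sqint_imp_integrable_norm2[OF assms(1)]]])
      (simp add: assms(2))
qed

lemma sqint_cnj:
  assumes "sqint b f"
  shows "sqint b (\<lambda>x. cnj (f x))"
proof -
  have "(\<lambda>x. cnj (f x)) \<in> borel_measurable (lebesgue_on {0<..<b})"
    using sqint_imp_measurable[OF assms]
    by (rule measurable_compose[OF _ borel_measurable_continuous_onI]) (simp add: continuous_on_cnj)
  then show ?thesis using assms unfolding square_integrable_def by simp
qed

lemma sqint_diff: "sqint b f \<Longrightarrow> sqint b g \<Longrightarrow> sqint b (\<lambda>x. f x - g x)"
  using square_integrable_add[OF _ square_integrable_cmult, of _ f g "-1"] by simp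

lemma sqint_mult_integrable:
  assumes "sqint b f" "sqint b g"
  shows "(\<lambda>x. f x * g x) absolutely_integrable_on {0..b}"
  using integrable_mult_cnj[OF assms(1) sqint_cnj[OF assms(2)]]
  by (simp add: integrable_lebesgue_on_Ioo_iff)

lemma continuous_on_imp_measurable_Ioo:
  "continuous_on {0<..<b} f \<Longrightarrow> f \<in> borel_measurable (lebesgue_on {0<..<b::real})"
  by (rule continuous_imp_measurable_on_sets_lebesgue) auto

lemma sqint_of_powr_bound:
  fixes f :: "real \<Rightarrow> complex"
  assumes f: "f \<in> borel_measurable (lebesgue_on {0<..<b})"
    and le: "\<And>x. 0 < x \<Longrightarrow> x < b \<Longrightarrow> cmod (f x) \<le> M * x powr p" and p: "p > -1/2" and b: "0 < b"
  shows "sqint b f"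
proof (rule sqint_bound[OF f])
  show "(\<lambda>x. M\<^sup>2 * x powr (2 * p)) integrable_on {0..b}"
    using p b by (intro integrable_on_mult_right integrable_on_powr_from_0) auto
  fix x assume x: "0 < x" "x < b"
  have "(cmod (f x))\<^sup>2 \<le> (M * x powr p)\<^sup>2" using le[OF x] by (intro power_mono) auto
  also have "\<dots> = M\<^sup>2 * x powr (2 * p)"
    by (simp add: power_mult_distrib power2_eq_square flip: powr_add)
  finally show "(cmod (f x))\<^sup>2 \<le> M\<^sup>2 * x powr (2 * p)" .
qed

lemma sqint_const: "0 < b \<Longrightarrow> sqint b (\<lambda>_. k)"
  by (rule sqint_of_powr_bound[where M = "cmod k" and p = 0]) auto

lemma sqint_integrable: "0 < b \<Longrightarrow> sqint b f \<Longrightarrow> f absolutely_integrable_on {0..b}"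
  using sqint_mult_integrable[OF _ sqint_const[of b 1]] by simp

text \<open>
  The quadratic form \<open>(s,t) \<mapsto> \<integral>(s f - t g)\<^sup>2\<close> is non-negative.
\<close>
lemma Cauchy_Schwarz_integral:
  fixes f g :: "real \<Rightarrow> real"
  assumes f: "(\<lambda>x. (f x)\<^sup>2) integrable_on S" and g: "(\<lambda>x. (g x)\<^sup>2) integrable_on S"
    and fg: "(\<lambda>x. f x * g x) integrable_on S"
  shows "(integral S (\<lambda>x. f x * g x))\<^sup>2 \<le> integral S (\<lambda>x. (f x)\<^sup>2) * integral S (\<lambda>x. (g x)\<^sup>2)"
proof -
  define A where "A = integral S (\<lambda>x. (f x)\<^sup>2)"
  define B where "B = integral S (\<lambda>x. (g x)\<^sup>2)"
  define P where "P = integral S (\<lambda>x. f x * g x)"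
  have A: "A \<ge> 0" "B \<ge> 0" unfolding A_def B_def using f g by (auto intro!: integral_nonneg)
  have q: "0 \<le> s\<^sup>2 * A - 2 * s * t * P + t\<^sup>2 * B" for s t
  proof -
    have *: "((\<lambda>x. s\<^sup>2 * (f x)\<^sup>2 - 2 * s * t * (f x * g x) + t\<^sup>2 * (g x)\<^sup>2) has_integral
        (s\<^sup>2 * A - 2 * s * t * P + t\<^sup>2 * B)) S"
      unfolding A_def B_def P_def using f g fg
      by (intro has_integral_add has_integral_diff has_integral_mult_right) auto
    show ?thesis
      by (rule has_integral_nonneg[OF *]) (use zero_le_power2[of "s * f _ - t * g _"] in
          \<open>simp add: power2_eq_square algebra_simps\<close>)
  qed
  have "P\<^sup>2 \<le> A * B"
  proof (cases "B = 0")
    case True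
    then have "P = 0" using q[of P "A + 1"] A by (simp add: power2_eq_square algebra_simps)
        (smt (verit) mult_nonneg_nonneg mult_less_0_iff zero_le_square zero_less_mult_iff)
    then show ?thesis using True by simp
  next
    case False
    have "0 \<le> B * (A * B - P\<^sup>2)" using q[of B P] by (simp add: power2_eq_square algebra_simps)
    then show ?thesis using False A by (simp add: zero_le_mult_iff)
  qed
  then show ?thesis by (simp add: A_def B_def P_def)
qed

text \<open>
  All kernels below are bounded by a multiple of \<open>x\<^sup>p t\<^bsup>1/2-\<mu>\<^esup>\<close> with \<open>0 < \<mu> < 1\<close>, so every estimate
  passes through the weighted integral of \<open>|g|\<close> over \<open>(0,x)\<close>.
\<close>
definition wint :: "real \<Rightarrow> (real \<Rightarrow> complex) \<Rightarrow> real \<Rightarrow> real" where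
  "wint \<mu> g x = integral {0..x} (\<lambda>t. t powr (1/2 - \<mu>) * cmod (g t))"

definition l2sq :: "real \<Rightarrow> (real \<Rightarrow> complex) \<Rightarrow> real" where
  "l2sq b g = integral {0..b} (\<lambda>t. (cmod (g t))\<^sup>2)"

lemma sqint_powr:
  assumes "p > -1/2" "0 < b"
  shows "sqint b (\<lambda>x. complex_of_real (x powr p))"
  by (rule sqint_of_powr_bound[where M = 1 and p = p])
    (use assms in \<open>auto intro!: continuous_on_imp_measurable_Ioo continuous_intros\<close>)

lemma wint_integrable:
  assumes g: "sqint b g" and "\<mu> < 1" "x \<le> b" "0 < b"
  shows "(\<lambda>t. t powr (1/2 - \<mu>) * cmod (g t)) integrable_on {0..x}"
proof -
  have "(\<lambda>x. complex_of_real (x powr (1/2 - \<mu>)) * g x) absolutely_integrable_on {0..b}"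
    using assms by (intro sqint_mult_integrable sqint_powr) auto
  then have "(\<lambda>x. cmod (complex_of_real (x powr (1/2 - \<mu>)) * g x)) integrable_on {0..b}"
    by (simp add: absolutely_integrable_on_def)
  then have "(\<lambda>x. x powr (1/2 - \<mu>) * cmod (g x)) integrable_on {0..b}"
    by (simp add: norm_mult)
  then show ?thesis by (rule integrable_on_subinterval) (use assms in auto)
qed

lemma sqint_norm2_integrable:
  "sqint b g \<Longrightarrow> x \<le> b \<Longrightarrow> (\<lambda>t. (cmod (g t))\<^sup>2) integrable_on {0..x}"
  by (rule integrable_on_subinterval[OF absolutely_integrable_imp_integrable_on[OF sqint_imp_integrable_norm2]]) auto

lemma l2sq_mono:
  assumes "sqint b g" "x \<le> b"
  shows "l2sq x g \<le> l2sq b g"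
  unfolding l2sq_def
  using assms by (intro integral_subset_le sqint_norm2_integrable[OF assms(1)]) auto

lemma l2sq_nonneg: "l2sq x g \<ge> 0"
  unfolding l2sq_def by (cases "(\<lambda>t. (cmod (g t))\<^sup>2) integrable_on {0..x}")
   (auto intro: integral_nonneg simp: not_integrable_integral)

lemma wint_nonneg: "wint \<mu> g x \<ge> 0"
  unfolding wint_def by (cases "(\<lambda>t. t powr (1/2 - \<mu>) * cmod (g t)) integrable_on {0..x}")
   (auto intro: integral_nonneg simp: not_integrable_integral)

lemma wint_le:
  assumes g: "sqint b g" and mu: "\<mu> < 1" and x: "0 < x" "x \<le> b"
  shows "wint \<mu> g x \<le> x powr (1 - \<mu>) / sqrt (2 - 2 * \<mu>) * sqrt (l2sq b g)"
proof -
  have b: "0 < b" using x by simp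
  have hi: "((\<lambda>t. (t powr (1/2 - \<mu>))\<^sup>2) has_integral (x powr (2 - 2 * \<mu>) / (2 - 2 * \<mu>))) {0..x}"
    using has_integral_powr_from_0[of "1 - 2 * \<mu>" x] mu x
    by (simp add: power2_eq_square flip: powr_add)
  have "(wint \<mu> g x)\<^sup>2 \<le> integral {0..x} (\<lambda>t. (t powr (1/2 - \<mu>))\<^sup>2) * integral {0..x} (\<lambda>t. (cmod (g t))\<^sup>2)"
    unfolding wint_def
    by (rule Cauchy_Schwarz_integral) (use hi in \<open>auto intro!: sqint_norm2_integrable[OF g] wint_integrable[OF g] mu x b\<close>)
  also have "\<dots> = x powr (2 - 2 * \<mu>) / (2 - 2 * \<mu>) * l2sq x g"
    using hi by (simp add: l2sq_def integral_unique)
  also have "\<dots> \<le> x powr (2 - 2 * \<mu>) / (2 - 2 * \<mu>) * l2sq b g"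
    using mu by (intro mult_left_mono l2sq_mono g x) auto
  finally have "sqrt ((wint \<mu> g x)\<^sup>2) \<le> sqrt (x powr (2 - 2 * \<mu>) / (2 - 2 * \<mu>) * l2sq b g)"
    by (rule real_sqrt_le_mono)
  moreover have "sqrt (x powr (2 - 2 * \<mu>)) = x powr (1 - \<mu>)"
    using x by (simp add: powr_half_sqrt[symmetric] powr_powr diff_divide_distrib)
  ultimately show ?thesis using wint_nonneg[of \<mu> g x] by (simp add: real_sqrt_mult real_sqrt_divide)
qed

lemma wint_measurable:
  assumes g: "sqint b g" and "\<mu> < 1" "0 < b"
  shows "continuous_on {0..b} (wint \<mu> g)"
  unfolding wint_def[abs_def]
  by (rule indefinite_integral_continuous_1) (use assms wint_integrable in auto)

text \<open>
  Split \<open>t\<^bsup>1/2-\<mu>\<^esup> = t\<^bsup>-\<mu>/2\<^esup> t\<^bsup>(1-\<mu>)/2\<^esup>\<close>. By Cauchy-Schwarz the square of the function is at most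
  \<open>x\<^bsup>\<mu>-2\<^esup> J(x) / (1-\<mu>)\<close> where \<open>J(x) = \<integral>\<^sub>0\<^sup>x t\<^bsup>1-\<mu>\<^esup> |g|\<^sup>2\<close>. The derivative of \<open>x\<^bsup>\<mu>-1\<^esup> J(x)\<close> is
  \<open>|g|\<^sup>2 - (1-\<mu>) x\<^bsup>\<mu>-2\<^esup> J(x)\<close>; integrating it over \<open>[e,b]\<close> bounds the integral of the majorant
  independently of \<open>e\<close>. The boundary term at \<open>e\<close> is harmless because \<open>J(e) \<le> e\<^bsup>1-\<mu>\<^esup> \<parallel>g\<parallel>\<^sup>2\<close>.
\<close>
theorem Hardy:
  assumes g: "sqint b g" and mu: "0 < \<mu>" "\<mu> < 1" and b: "0 < b"
  shows "(\<lambda>x. (x powr (\<mu> - 3/2) * wint \<mu> g x)\<^sup>2) integrable_on {0..b}"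
proof -
  define J where "J = (\<lambda>x. integral {0..x} (\<lambda>t. t powr (1 - \<mu>) * (cmod (g t))\<^sup>2))"
  let ?k = "\<lambda>t. complex_of_real (t powr (1 - \<mu>) * (cmod (g t))\<^sup>2)"
  have sq1: "sqint b (\<lambda>x. complex_of_real (x powr ((1 - \<mu>) / 2)) * g x)"
  proof (rule sqint_bound[where h = "\<lambda>x. (b powr ((1 - \<mu>) / 2))\<^sup>2 * (cmod (g x))\<^sup>2"])
    have "(\<lambda>x. complex_of_real (x powr ((1 - \<mu>) / 2))) \<in> borel_measurable (lebesgue_on {0<..<b})"
      by (intro continuous_on_imp_measurable_Ioo continuous_intros) auto
    then show "(\<lambda>x. complex_of_real (x powr ((1 - \<mu>) / 2)) * g x) \<in> borel_measurable (lebesgue_on {0<..<b})"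
      using sqint_imp_measurable[OF g] by measurable
    show "(\<lambda>x. (b powr ((1 - \<mu>) / 2))\<^sup>2 * (cmod (g x))\<^sup>2) integrable_on {0..b}"
      by (intro integrable_on_mult_right sqint_norm2_integrable[OF g]) auto
    fix x assume x: "0 < x" "x < b"
    have "(x powr ((1 - \<mu>) / 2))\<^sup>2 \<le> (b powr ((1 - \<mu>) / 2))\<^sup>2"
      using x mu by (intro power_mono powr_mono2) auto
    then show "(cmod (complex_of_real (x powr ((1 - \<mu>) / 2)) * g x))\<^sup>2 \<le> (b powr ((1 - \<mu>) / 2))\<^sup>2 * (cmod (g x))\<^sup>2"
      by (simp add: norm_mult power_mult_distrib mult_right_mono)
  qed
  have eq1: "(cmod (complex_of_real (x powr ((1 - \<mu>) / 2)) * g x))\<^sup>2 = x powr (1 - \<mu>) * (cmod (g x))\<^sup>2" for x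
    by (simp add: norm_mult power_mult_distrib power2_eq_square flip: powr_add)
  have Ji: "(\<lambda>t. t powr (1 - \<mu>) * (cmod (g t))\<^sup>2) integrable_on {0..x}" if "x \<le> b" for x
    using sqint_norm2_integrable[OF sq1 that] by (simp only: eq1)
  have Jpos: "J x \<ge> 0" if "x \<le> b" for x
    unfolding J_def by (intro integral_nonneg Ji that) auto
  have Jle: "J x \<le> x powr (1 - \<mu>) * l2sq b g" if "0 < x" "x \<le> b" for x
  proof -
    have "J x \<le> integral {0..x} (\<lambda>t. x powr (1 - \<mu>) * (cmod (g t))\<^sup>2)"
      unfolding J_def using that mu
      by (intro integral_le Ji integrable_on_mult_right sqint_norm2_integrable[OF g] mult_right_mono powr_mono2) auto
    also have "\<dots> = x powr (1 - \<mu>) * l2sq x g" by (simp add: l2sq_def)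
    also have "\<dots> \<le> x powr (1 - \<mu>) * l2sq b g" using that by (intro mult_left_mono l2sq_mono g) auto
    finally show ?thesis .
  qed
  have ka: "?k absolutely_integrable_on {0..b}"
    using absolutely_integrable_imp_integrable_on[OF sqint_imp_integrable_norm2[OF sq1]]
    unfolding eq1 absolutely_integrable_on_def integrable_on_def norm_of_real
    by (auto intro: has_integral_of_real simp del: of_real_mult)
  have Jk: "integral {0..x} ?k = complex_of_real (J x)" if "x \<le> b" for x
    unfolding J_def by (intro integral_unique has_integral_of_real integrable_integral Ji that)
  have J2: "x powr (\<mu> - 2) * J x \<ge> 0" if "x \<le> b" for x using Jpos[OF that] by simp
  have contJ: "continuous_on {0..b} J"
    unfolding J_def[abs_def] by (rule indefinite_integral_continuous_1) (use Ji in auto)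
  have hi: "((\<lambda>x. x powr (\<mu> - 2) * J x) integrable_on {e..b}) \<and>
      integral {e..b} (\<lambda>x. x powr (\<mu> - 2) * J x) \<le> 2 * l2sq b g / (1 - \<mu>)" if e: "0 < e" "e < b" for e
  proof -
    have cont: "continuous_on {e..b} (\<lambda>x. x powr (\<mu> - 2) * J x)"
      using e by (intro continuous_intros continuous_on_subset[OF contJ]) auto
    then have i1: "(\<lambda>x. x powr (\<mu> - 2) * J x) integrable_on {e..b}" by (rule integrable_continuous_real)
    have p1: "ac_deriv e b (\<lambda>x. complex_of_real (x powr (\<mu> - 1))) (\<lambda>x. complex_of_real ((\<mu> - 1) * x powr (\<mu> - 2)))"
    proof (rule ac_deriv_C1)
      fix x assume x: "x \<in> {e..b}"
      have "((\<lambda>x. x powr (\<mu> - 1)) has_real_derivative (\<mu> - 1) * x powr (\<mu> - 2)) (at x within {e..b})"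
        using has_real_derivative_powr[of x "\<mu> - 1"] x e by (auto intro: DERIV_subset)
      then show "((\<lambda>x. complex_of_real (x powr (\<mu> - 1))) has_vector_derivative complex_of_real ((\<mu> - 1) * x powr (\<mu> - 2))) (at x within {e..b})"
        by (simp only: has_real_derivative_iff_has_vector_derivative has_vector_derivative_of_real)
    qed (use e in \<open>auto intro!: continuous_intros\<close>)
    have "ac_deriv 0 b (\<lambda>x. integral {0..x} ?k) ?k" by (rule ac_deriv_indefinite_integral[OF ka])
    then have p2: "ac_deriv e b (\<lambda>x. integral {0..x} ?k) ?k" by (rule ac_deriv_subset) (use e in auto)
    have "((\<lambda>x. complex_of_real (x powr (\<mu> - 1)) * ?k x +
          complex_of_real ((\<mu> - 1) * x powr (\<mu> - 2)) * integral {0..x} ?k) has_integral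
        complex_of_real (b powr (\<mu> - 1)) * integral {0..b} ?k - complex_of_real (e powr (\<mu> - 1)) * integral {0..e} ?k) {e..b}"
      using ac_deriv_has_integral[OF ac_deriv_mult[OF p1 p2]] e by simp
    then have "((\<lambda>x. complex_of_real ((cmod (g x))\<^sup>2 - (1 - \<mu>) * (x powr (\<mu> - 2) * J x))) has_integral
        complex_of_real (b powr (\<mu> - 1) * J b - e powr (\<mu> - 1) * J e)) {e..b}"
      using e by (elim has_integral_eq_rhs[OF has_integral_eq, rotated]) 
        (auto simp: Jk algebra_simps simp flip: powr_add of_real_add of_real_mult of_real_diff)
    then have h1: "((\<lambda>x. (cmod (g x))\<^sup>2 - (1 - \<mu>) * (x powr (\<mu> - 2) * J x)) has_integral
        (b powr (\<mu> - 1) * J b - e powr (\<mu> - 1) * J e)) {e..b}"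
      by (auto dest!: has_integral_Re)
    have gi: "(\<lambda>x. (cmod (g x))\<^sup>2) integrable_on {e..b}"
      using sqint_norm2_integrable[OF g order_refl] by (rule integrable_on_subinterval) (use e in auto)
    have "integral {e..b} (\<lambda>x. (cmod (g x))\<^sup>2) - (1 - \<mu>) * integral {e..b} (\<lambda>x. x powr (\<mu> - 2) * J x)
        = b powr (\<mu> - 1) * J b - e powr (\<mu> - 1) * J e"
      using h1 gi i1 by (subst integral_unique[OF h1, symmetric])
        (simp add: Henstock_Kurzweil_Integration.integral_diff integrable_on_mult_right)
    moreover have "integral {e..b} (\<lambda>x. (cmod (g x))\<^sup>2) \<le> l2sq b g"
      unfolding l2sq_def using e by (intro integral_subset_le gi sqint_norm2_integrable[OF g]) auto
    moreover have "b powr (\<mu> - 1) * J b \<ge> 0" using Jpos[of b] by simp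
    moreover have "e powr (\<mu> - 1) * J e \<le> l2sq b g"
    proof -
      have "e powr (\<mu> - 1) * J e \<le> e powr (\<mu> - 1) * (e powr (1 - \<mu>) * l2sq b g)"
        using Jle[of e] e by (intro mult_left_mono) auto
      also have "\<dots> = l2sq b g" using e by (simp flip: mult.assoc powr_add)
      finally show ?thesis .
    qed
    ultimately have "(1 - \<mu>) * integral {e..b} (\<lambda>x. x powr (\<mu> - 2) * J x) \<le> 2 * l2sq b g" by linarith
    then show ?thesis using mu i1 by (simp add: field_simps)
  qed
  \<comment> \<open>monotone convergence along the left endpoints \<open>b / (n + 2)\<close>\<close>
  have main: "(\<lambda>x. x powr (\<mu> - 2) * J x) integrable_on {0..b}"
  proof -
    let ?f = "\<lambda>n x. if x \<in> {b / real (n + 2)..b} then x powr (\<mu> - 2) * J x else 0"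
    have e: "0 < b / real (n + 2)" "b / real (n + 2) < b" for n
      using b by (auto simp: field_simps intro: add_pos_nonneg)
    have sub: "{b / real (n + 2)..b} \<inter> {0..b} = {b / real (n + 2)..b}" for n using e[of n] by auto
    have "(\<lambda>x. x powr (\<mu> - 2) * J x) integrable_on {0..b} \<and>
       (\<lambda>n. integral {0..b} (?f n)) \<longlonglongrightarrow> integral {0..b} (\<lambda>x. x powr (\<mu> - 2) * J x)"
    proof (rule monotone_convergence_increasing)
      show "?f n integrable_on {0..b}" for n
        using hi[OF e, of n] unfolding integrable_restrict_Int sub by blast
      show "?f n x \<le> ?f (Suc n) x" if "x \<in> {0..b}" for n x
      proof -
        have "b / real (Suc n + 2) \<le> b / real (n + 2)" using b by (intro divide_left_mono) auto
        then show ?thesis using J2[of x] that by auto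
      qed
      show "(\<lambda>n. ?f n x) \<longlonglongrightarrow> x powr (\<mu> - 2) * J x" if x: "x \<in> {0..b}" for x
      proof (cases "x = 0")
        case False
        then have "x > 0" using x by simp
        obtain m where m: "b / x \<le> real m" using real_arch_simple by blast
        show ?thesis
        proof (rule tendsto_eventually, unfold eventually_sequentially, intro exI[of _ m] allI impI)
          fix n assume "m \<le> n"
          then have "b / x \<le> real (n + 2)" using m by linarith
          then have "b / real (n + 2) \<le> x" using \<open>x > 0\<close> b by (simp add: field_simps)
          then show "?f n x = x powr (\<mu> - 2) * J x" using x by simp
        qed
      qed (simp add: if_distrib cong: if_cong)
      show "bounded (range (\<lambda>n. integral {0..b} (?f n)))"
        unfolding bounded_iff
      proof (intro exI ballI, clarify)
        fix n
        have "integral {0..b} (?f n) = integral {b / real (n + 2)..b} (\<lambda>x. x powr (\<mu> - 2) * J x)"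
          unfolding integral_restrict_Int sub ..
        moreover have "\<dots> \<ge> 0" using hi[OF e] J2 by (intro integral_nonneg) auto
        ultimately show "norm (integral {0..b} (?f n)) \<le> 2 * l2sq b g / (1 - \<mu>)"
          using hi[OF e, of n] by simp
      qed
    qed
    then show ?thesis by blast
  qed
  have bound: "(x powr (\<mu> - 3/2) * wint \<mu> g x)\<^sup>2 \<le> x powr (\<mu> - 2) * J x / (1 - \<mu>)" if x: "0 < x" "x < b" for x
  proof -
    have h2: "((\<lambda>t. (t powr (- \<mu> / 2))\<^sup>2) has_integral (x powr (1 - \<mu>) / (1 - \<mu>))) {0..x}"
      using has_integral_powr_from_0[of "- \<mu>" x] mu x by (simp add: power2_eq_square flip: powr_add)
    have eq2: "(t powr ((1 - \<mu>) / 2) * cmod (g t))\<^sup>2 = t powr (1 - \<mu>) * (cmod (g t))\<^sup>2" for t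
      by (simp add: power_mult_distrib power2_eq_square flip: powr_add)
    have eq3: "t powr (- \<mu> / 2) * (t powr ((1 - \<mu>) / 2) * cmod (g t)) = t powr (1/2 - \<mu>) * cmod (g t)" for t
    proof -
      have "- \<mu> / 2 + (1 - \<mu>) / 2 = 1/2 - \<mu>" by (simp add: field_simps)
      then show ?thesis by (simp only: powr_add[symmetric] mult.assoc[symmetric])
    qed
    have "(wint \<mu> g x)\<^sup>2 \<le> integral {0..x} (\<lambda>t. (t powr (- \<mu> / 2))\<^sup>2) * integral {0..x} (\<lambda>t. (t powr ((1 - \<mu>) / 2) * cmod (g t))\<^sup>2)"
      unfolding wint_def eq3[symmetric]
      by (rule Cauchy_Schwarz_integral, unfold eq2 eq3) (use h2 x b mu in \<open>auto intro!: Ji wint_integrable[OF g]\<close>)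
    also have "\<dots> = x powr (1 - \<mu>) / (1 - \<mu>) * J x"
      unfolding eq2 J_def using h2 by (simp add: integral_unique)
    finally have *: "(wint \<mu> g x)\<^sup>2 \<le> x powr (1 - \<mu>) / (1 - \<mu>) * J x" .
    have "(x powr (\<mu> - 3/2) * wint \<mu> g x)\<^sup>2 = x powr (2 * \<mu> - 3) * (wint \<mu> g x)\<^sup>2"
      by (simp add: power_mult_distrib power2_eq_square flip: powr_add)
    also have "\<dots> \<le> x powr (2 * \<mu> - 3) * (x powr (1 - \<mu>) / (1 - \<mu>) * J x)"
      using * by (intro mult_left_mono) auto
    also have "\<dots> = x powr (\<mu> - 2) * J x / (1 - \<mu>)"
      using x by (simp flip: powr_add mult.assoc)
    finally show ?thesis .
  qed
  have meas: "(\<lambda>x. (x powr (\<mu> - 3/2) * wint \<mu> g x)\<^sup>2) \<in> borel_measurable (lebesgue_on {0<..<b})"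
    using mu b by (intro continuous_on_imp_measurable_Ioo continuous_intros continuous_on_subset[OF wint_measurable[OF g]]) auto
  have "(\<lambda>x. (x powr (\<mu> - 3/2) * wint \<mu> g x)\<^sup>2) absolutely_integrable_on {0<..<b}"
    by (rule measurable_bounded_by_integrable_imp_absolutely_integrable[where g = "\<lambda>x. x powr (\<mu> - 2) * J x / (1 - \<mu>)", OF meas])
      (use main bound in \<open>auto simp: integrable_on_Icc_iff_Ioo[symmetric] integrable_on_divide\<close>)
  then show ?thesis by (simp add: absolutely_integrable_on_def integrable_on_Icc_iff_Ioo)
qed

section \<open>Bessel pairs\<close>

lemma AE_lebesgue_on_Ioo_iff:
  "(AE x in lebesgue_on {0<..<b::real}. P x) \<longleftrightarrow> (\<exists>N. negligible N \<and> (\<forall>x\<in>{0<..<b} - N. P x))"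
proof -
  have "(AE x in lebesgue_on {0<..<b}. P x) \<longleftrightarrow> (AE x in lebesgue. x \<in> {0<..<b} \<longrightarrow> P x)"
    by (rule AE_restrict_space_iff) simp
  also have "\<dots> \<longleftrightarrow> (\<exists>N. negligible N \<and> {x. \<not> (x \<in> {0<..<b} \<longrightarrow> P x)} \<subseteq> N)"
    by (rule eventually_ae_filter_negligible)
  also have "\<dots> \<longleftrightarrow> (\<exists>N. negligible N \<and> (\<forall>x\<in>{0<..<b} - N. P x))" by blast
  finally show ?thesis .
qed

text \<open>
  The interval \<open>(0,b)\<close> is a countable union of compact intervals, and so is the exceptional set of
  the exceptional sets on them.
\<close>
lemma ac_deriv_imp_AE:
  assumes ac: "\<And>c d. 0 < c \<Longrightarrow> c < d \<Longrightarrow> d < b \<Longrightarrow> ac_deriv c d F f"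
  shows "AE x in lebesgue_on {0<..<b}. (F has_vector_derivative f x) (at x)"
proof (cases "b > 0")
  case b: True
  define c where "c = (\<lambda>n::nat. b / (real n + 3))"
  have c: "0 < c n" "c n < b - c n" "b - c n < b" for n
    using b by (auto simp: c_def field_simps intro: add_pos_nonneg)
  have "\<exists>N. negligible N \<and> (\<forall>x\<in>{c n<..<b - c n} - N. (F has_vector_derivative f x) (at x))" for n
    using ac[OF c] unfolding ac_deriv_def by blast
  then obtain N where N: "\<And>n. negligible (N n)"
      "\<And>n x. x\<in>{c n<..<b - c n} - N n \<Longrightarrow> (F has_vector_derivative f x) (at x)" by metis
  have "(F has_vector_derivative f x) (at x)" if x: "x \<in> {0<..<b} - (\<Union>n. N n)" for x
  proof -
    define e where "e = min x (b - x)"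
    have e: "e > 0" using x by (simp add: e_def)
    obtain n where "b / e < real n" using reals_Archimedean2 by blast
    then have "b < real n * e" using e by (simp add: field_simps)
    also have "\<dots> \<le> (real n + 3) * e" using e by simp
    finally have "c n < e" by (simp add: c_def field_simps)
    then show ?thesis using N(2)[of x n] x by (auto simp: e_def)
  qed
  moreover have "negligible (\<Union>n. N n)" using N(1) by (auto intro!: negligible_countable_Union)
  ultimately show ?thesis unfolding AE_lebesgue_on_Ioo_iff by blast
next
  case False
  then show ?thesis unfolding AE_lebesgue_on_Ioo_iff by (intro exI[of _ "{}"]) auto
qed

lemma ac_deriv_continuous_imp_has_vector_derivative:
  assumes F: "ac_deriv c d F f" and f: "continuous_on {c..d} f" and x: "x \<in> {c..d}"
  shows "(F has_vector_derivative f x) (at x within {c..d})"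
proof -
  have "((\<lambda>x. F c + integral {c..x} f) has_vector_derivative f x) (at x within {c..d})"
    using integral_has_vector_derivative[OF f x] by (auto intro!: derivative_eq_intros)
  then show ?thesis
  proof (rule has_vector_derivative_transform[OF x, rotated])
    fix y assume "y \<in> {c..d}"
    then have "(f has_integral F y - F c) {c..y}"
      by (intro ac_deriv_has_integral ac_deriv_subset[OF F]) auto
    then show "F y = F c + integral {c..y} f" by (simp add: integral_unique)
  qed
qed

text \<open>
  Functions in the domain are controlled at the singular endpoint only through power bounds. This
  lemma and the next one turn such bounds into regularity on the closed interval \<open>[0,b]\<close>.
\<close>
lemma continuous_on_0_of_powr_bound:
  fixes F :: "real \<Rightarrow> complex"
  assumes cont: "\<And>c. 0 < c \<Longrightarrow> c < b \<Longrightarrow> continuous_on {c..b} F" and "F 0 = 0"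
    and bd: "\<And>x. 0 < x \<Longrightarrow> x \<le> b \<Longrightarrow> cmod (F x) \<le> K * x powr p" and p: "p > 0"
  shows "continuous_on {0..b} F"
  unfolding continuous_on_eq_continuous_within
proof
  fix x assume x: "x \<in> {0..b}"
  show "continuous (at x within {0..b}) F"
  proof (cases "x = 0")
    case True
    have "((\<lambda>x. x powr p) \<longlongrightarrow> 0 powr p) (at 0 within {0..b})"
      using p by (intro tendsto_powr' tendsto_const tendsto_ident_at) (auto simp: eventually_at_filter)
    then have "((\<lambda>x. K * x powr p) \<longlongrightarrow> K * 0) (at 0 within {0..b})"
      using p by (intro tendsto_mult tendsto_const) auto
    moreover have "\<forall>\<^sub>F x in at 0 within {0..b}. norm (F x) \<le> K * x powr p"
      unfolding eventually_at_filter by (rule always_eventually) (auto intro: bd)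
    ultimately have "(F \<longlongrightarrow> 0) (at 0 within {0..b})"
      using Lim_null_comparison[where f = F and g = "\<lambda>x. K * x powr p" and net = "at 0 within {0..b}"] by simp
    then show ?thesis using True \<open>F 0 = 0\<close> by (simp add: continuous_within)
  next
    case False
    then have x0: "0 < x / 2" "x / 2 < b" using x by auto
    have "continuous_on {x/2<..b} F" using cont[OF x0] by (rule continuous_on_subset) auto
    then have "continuous (at x within {x/2<..b}) F"
      using x x0 by (auto simp: continuous_on_eq_continuous_within)
    moreover have "at x within {x/2<..b} = at x within {0..b}"
      using x x0 by (intro at_within_nhd[of x "{x/2<..}"]) auto
    ultimately show ?thesis by simp
  qed
qed

lemma ac_deriv_extend_0:
  assumes b: "0 < b" and F: "\<And>c. 0 < c \<Longrightarrow> c < b \<Longrightarrow> ac_deriv c b F f"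
    and f: "f absolutely_integrable_on {0..b}" and cont: "continuous_on {0..b} F" and "F 0 = 0"
  shows "ac_deriv 0 b F f"
proof -
  define I where "I = (\<lambda>x. integral {0..x} f)"
  have fi: "f integrable_on {0..x}" if "x \<le> b" for x
    using integrable_on_subinterval[OF absolutely_integrable_imp_integrable_on[OF f]] that by simp
  have I: "ac_deriv 0 b I f" unfolding I_def[abs_def] by (rule ac_deriv_indefinite_integral[OF f])
  have const: "F x - I x = F b - I b" if "x \<in> {0<..b}" for x
  proof (cases "x = b")
    case False
    then have x: "0 < x" "x < b" using that by auto
    have "(f has_integral F b - F x) {x..b}" using x by (intro ac_deriv_has_integral F) auto
    moreover have "(f has_integral I b - I x) {x..b}"
      using x by (intro ac_deriv_has_integral ac_deriv_subset[OF I]) auto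
    ultimately have "F b - F x = I b - I x" by (rule has_integral_unique)
    then show ?thesis by (simp add: algebra_simps)
  qed simp
  have "F x - I x = F b - I b" if "x \<in> {0..b}" for x
  proof (rule continuous_constant_on_closure[of "{0<..b}" "\<lambda>x. F x - I x"])
    have cl: "closure {0<..b} = {0..b}" using b by (simp add: closure_greaterThanAtMost)
    show "continuous_on (closure {0<..b}) (\<lambda>x. F x - I x)"
      unfolding cl by (intro continuous_on_diff cont ac_derivD[OF I])
    show "x \<in> closure {0<..b}" using that cl by simp
  qed (rule const)
  from this[of 0] this have "I x = F x" if "x \<in> {0..b}" for x
    using that b \<open>F 0 = 0\<close> by (simp add: I_def)
  then show ?thesis by (intro ac_deriv_cong[OF I]) auto
qed

definition pot :: "real \<Rightarrow> real \<Rightarrow> real" where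
  "pot \<nu> x = (\<nu>\<^sup>2 - 1/4) / x\<^sup>2"

lemma ac_deriv_imp_continuous_on_Ioo:
  assumes "\<And>c d. 0 < c \<Longrightarrow> c < d \<Longrightarrow> d < b \<Longrightarrow> ac_deriv c d F f"
  shows "continuous_on {0<..<b::real} F"
proof (rule continuous_at_imp_continuous_on, clarify)
  fix x assume x: "x \<in> {0<..<b}"
  have "continuous_on {x/2..(x+b)/2} F" using x by (intro ac_derivD[OF assms]) auto
  then show "isCont F x" using x by (intro continuous_on_interior[of "{x/2..(x+b)/2}"]) (auto simp: interior_atLeastAtMost_real)
qed

lemma ac_deriv_of_has_vector_derivative:
  assumes f: "\<And>x. x \<in> {0<..<b} \<Longrightarrow> (f has_vector_derivative f' x) (at x)" and f': "continuous_on {0<..<b} f'"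
    and "0 < c" "d < b"
  shows "ac_deriv c d f f'"
proof (rule ac_deriv_C1)
  show "(f has_vector_derivative f' x) (at x within {c..d})" if "x \<in> {c..d}" for x
    using f[of x] that assms(3,4) by (auto intro: has_vector_derivative_at_within)
  show "continuous_on {c..d} f'" using assms(3,4) by (intro continuous_on_subset[OF f']) auto
qed

text \<open>
  Since \<open>f''\<close> is determined by \<open>f\<close> and \<open>g\<close>, the second derivative disappears from the description,
  and local absolute continuity of \<open>f\<close> follows from continuity of \<open>f'\<close>.
\<close>
lemma bessel_pair_iff:
  "bessel_pair \<nu> b f g \<longleftrightarrow> sqint b f \<and> sqint b g \<and>
     (\<exists>f'. (\<forall>x\<in>{0<..<b}. (f has_vector_derivative f' x) (at x)) \<and>
       (\<forall>c d. 0 < c \<longrightarrow> c < d \<longrightarrow> d < b \<longrightarrow> ac_deriv c d f' (\<lambda>x. complex_of_real (pot \<nu> x) * f x - g x)))"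
  (is "?L \<longleftrightarrow> ?R")
proof
  assume ?L
  then obtain f' f'' where sq: "sqint b f" "sqint b g"
    and f: "\<And>x. x\<in>{0<..<b} \<Longrightarrow> (f has_vector_derivative f' x) (at x)"
    and ac: "loc_abs_continuous b f'"
    and ae: "AE x in lebesgue_on {0<..<b}. (f' has_vector_derivative f'' x) (at x) \<and>
           g x = - f'' x + complex_of_real ((\<nu>\<^sup>2 - 1/4) / x\<^sup>2) * f x"
    unfolding bessel_pair_def by blast
  obtain N where N: "negligible N" "\<And>x. x \<in> {0<..<b} - N \<Longrightarrow> (f' has_vector_derivative f'' x) (at x)"
     "\<And>x. x \<in> {0<..<b} - N \<Longrightarrow> g x = - f'' x + complex_of_real ((\<nu>\<^sup>2 - 1/4) / x\<^sup>2) * f x"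
    using ae unfolding AE_lebesgue_on_Ioo_iff by blast
  have "ac_deriv c d f' (\<lambda>x. complex_of_real (pot \<nu> x) * f x - g x)" if cd: "0 < c" "c < d" "d < b" for c d
    unfolding ac_deriv_def
  proof (intro conjI exI[of _ N] N(1) ballI)
    show "abs_continuous_on c d f'" using ac cd by (simp add: loc_abs_continuous_def)
    fix x assume x: "x \<in> {c<..<d} - N"
    then have "x \<in> {0<..<b} - N" using cd by auto
    from N(2,3)[OF this] show "(f' has_vector_derivative complex_of_real (pot \<nu> x) * f x - g x) (at x)"
      by (simp add: pot_def)
  qed
  then show ?R using sq f by blast
next
  assume ?R
  then obtain f' where sq: "sqint b f" "sqint b g"
    and f: "\<And>x. x\<in>{0<..<b} \<Longrightarrow> (f has_vector_derivative f' x) (at x)"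
    and ac: "\<And>c d. 0 < c \<Longrightarrow> c < d \<Longrightarrow> d < b \<Longrightarrow> ac_deriv c d f' (\<lambda>x. complex_of_real (pot \<nu> x) * f x - g x)"
    by blast
  have "loc_abs_continuous b f'" using ac by (auto simp: loc_abs_continuous_def ac_deriv_def)
  moreover have "loc_abs_continuous b f"
    using ac_deriv_of_has_vector_derivative[OF f ac_deriv_imp_continuous_on_Ioo[OF ac]]
    by (auto simp: loc_abs_continuous_def ac_deriv_def)
  moreover have "AE x in lebesgue_on {0<..<b}. (f' has_vector_derivative (complex_of_real (pot \<nu> x) * f x - g x)) (at x)"
    by (rule ac_deriv_imp_AE[OF ac])
  then have "AE x in lebesgue_on {0<..<b}. (f' has_vector_derivative (complex_of_real (pot \<nu> x) * f x - g x)) (at x) \<and>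
      g x = - (complex_of_real (pot \<nu> x) * f x - g x) + complex_of_real ((\<nu>\<^sup>2 - 1/4) / x\<^sup>2) * f x"
    by eventually_elim (simp add: pot_def)
  ultimately show ?L using sq f unfolding bessel_pair_def
    by (intro conjI exI[of _ f'] exI[of _ "\<lambda>x. complex_of_real (pot \<nu> x) * f x - g x"]) auto
qed

text \<open>
  A Bessel pair together with the derivative of its first component, which enters all Wronskians.
\<close>
definition bessel_jet :: "real \<Rightarrow> real \<Rightarrow> (real \<Rightarrow> complex) \<Rightarrow> (real \<Rightarrow> complex) \<Rightarrow> (real \<Rightarrow> complex) \<Rightarrow> bool" where
  "bessel_jet \<nu> b f f' g \<longleftrightarrow> sqint b f \<and> sqint b g \<and>
     (\<forall>x\<in>{0<..<b}. (f has_vector_derivative f' x) (at x)) \<and>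
     (\<forall>c d. 0 < c \<longrightarrow> c < d \<longrightarrow> d < b \<longrightarrow> ac_deriv c d f' (\<lambda>x. complex_of_real (pot \<nu> x) * f x - g x))"

lemma bessel_pair_iff_jet: "bessel_pair \<nu> b f g \<longleftrightarrow> (\<exists>f'. bessel_jet \<nu> b f f' g)"
  unfolding bessel_pair_iff bessel_jet_def by blast

lemma bessel_jetD:
  assumes "bessel_jet \<nu> b f f' g"
  shows "sqint b f" "sqint b g" "\<And>x. 0 < x \<Longrightarrow> x < b \<Longrightarrow> (f has_vector_derivative f' x) (at x)"
    "\<And>c d. 0 < c \<Longrightarrow> c < d \<Longrightarrow> d < b \<Longrightarrow> ac_deriv c d f' (\<lambda>x. complex_of_real (pot \<nu> x) * f x - g x)"
    "\<And>c d. 0 < c \<Longrightarrow> c < d \<Longrightarrow> d < b \<Longrightarrow> ac_deriv c d f f'"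
    "continuous_on {0<..<b} f" "continuous_on {0<..<b} f'"
proof -
  show f: "\<And>x. 0 < x \<Longrightarrow> x < b \<Longrightarrow> (f has_vector_derivative f' x) (at x)"
    and f': "\<And>c d. 0 < c \<Longrightarrow> c < d \<Longrightarrow> d < b \<Longrightarrow> ac_deriv c d f' (\<lambda>x. complex_of_real (pot \<nu> x) * f x - g x)"
    and "sqint b f" "sqint b g"
    using assms by (auto simp: bessel_jet_def)
  show c: "continuous_on {0<..<b} f'" by (rule ac_deriv_imp_continuous_on_Ioo[OF f'])
  show 1: "\<And>c d. 0 < c \<Longrightarrow> c < d \<Longrightarrow> d < b \<Longrightarrow> ac_deriv c d f f'"
    by (rule ac_deriv_of_has_vector_derivative[OF _ c]) (use f in auto)
  show "continuous_on {0<..<b} f" by (rule ac_deriv_imp_continuous_on_Ioo[OF 1])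
qed

section \<open>Variation of constants\<close>

text \<open>
  The indefinite integrals of variation of constants. Their values at \<open>b\<close> decide whether an element
  of the maximal operator belongs to the minimal one.
\<close>
definition moment :: "(real \<Rightarrow> real) \<Rightarrow> (real \<Rightarrow> complex) \<Rightarrow> real \<Rightarrow> complex" where
  "moment u g x = integral {0..x} (\<lambda>t. complex_of_real (u t) * g t)"

lemma has_vector_derivative_complex_of_real:
  "(f has_real_derivative f') F \<Longrightarrow> ((\<lambda>x. complex_of_real (f x)) has_vector_derivative complex_of_real f') F"
  by (simp only: has_real_derivative_iff_has_vector_derivative has_vector_derivative_of_real)

text \<open>
  What is needed of a fundamental system \<open>u1, u2\<close> of \<open>\<tau> u = 0\<close> with derivatives \<open>v1, v2\<close>. The bounds on
  \<open>u1, u2\<close> give square integrability at \<open>0\<close>. The kernel of variation of constants is bounded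
  separately: for \<open>\<nu> = 0\<close> its size comes from the difference \<open>ln t - ln x\<close>, and bounding its two
  terms one by one would lose the order of vanishing at \<open>0\<close>. The number \<open>\<mu>\<close> is \<open>\<nu>\<close> if \<open>\<nu> > 0\<close> and
  \<open>1/2\<close> if \<open>\<nu> = 0\<close>.
\<close>
locale bessel_system =
  fixes \<nu> b \<mu> C w :: real and u1 v1 u2 v2 :: "real \<Rightarrow> real"
  assumes b: "0 < b" and mu: "0 < \<mu>" "\<mu> < 1" and w: "w \<noteq> 0"
    and u1_deriv: "\<And>x. 0 < x \<Longrightarrow> (u1 has_real_derivative v1 x) (at x)"
    and v1_deriv: "\<And>x. 0 < x \<Longrightarrow> (v1 has_real_derivative pot \<nu> x * u1 x) (at x)"
    and u2_deriv: "\<And>x. 0 < x \<Longrightarrow> (u2 has_real_derivative v2 x) (at x)"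
    and v2_deriv: "\<And>x. 0 < x \<Longrightarrow> (v2 has_real_derivative pot \<nu> x * u2 x) (at x)"
    and wronskian: "\<And>x. 0 < x \<Longrightarrow> u1 x * v2 x - v1 x * u2 x = w"
    and u_bound: "\<And>x. 0 < x \<Longrightarrow> x \<le> b \<Longrightarrow> \<bar>u1 x\<bar> \<le> C * x powr (1/2 - \<mu>)"
      "\<And>x. 0 < x \<Longrightarrow> x \<le> b \<Longrightarrow> \<bar>u2 x\<bar> \<le> C * x powr (1/2 - \<mu>)"
    and v_bound: "\<And>x. 0 < x \<Longrightarrow> x \<le> b \<Longrightarrow> \<bar>v1 x\<bar> \<le> C * x powr (- 1/2 - \<mu>)"
      "\<And>x. 0 < x \<Longrightarrow> x \<le> b \<Longrightarrow> \<bar>v2 x\<bar> \<le> C * x powr (- 1/2 - \<mu>)"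
    and kernel_bound: "\<And>t x. 0 < t \<Longrightarrow> t \<le> x \<Longrightarrow> x \<le> b \<Longrightarrow>
          \<bar>u1 x * u2 t - u2 x * u1 t\<bar> \<le> C * x powr (1/2 + \<mu>) * t powr (1/2 - \<mu>)"
    and kernel_deriv_bound: "\<And>t x. 0 < t \<Longrightarrow> t \<le> x \<Longrightarrow> x \<le> b \<Longrightarrow>
          \<bar>v1 x * u2 t - v2 x * u1 t\<bar> \<le> C * x powr (\<mu> - 1/2) * t powr (1/2 - \<mu>)"
begin

text \<open>
  Lets statements that hold for \<open>u1\<close> and \<open>u2\<close> alike be proved once.
\<close>
definition basis_sol :: "(real \<Rightarrow> real) \<Rightarrow> (real \<Rightarrow> real) \<Rightarrow> bool" where
  "basis_sol u v \<longleftrightarrow> u = u1 \<and> v = v1 \<or> u = u2 \<and> v = v2"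

lemma basis_sol12: "basis_sol u1 v1" "basis_sol u2 v2"
  by (simp_all add: basis_sol_def)

lemma basis_solD:
  assumes "basis_sol u v" "0 < x"
  shows "(u has_real_derivative v x) (at x)" "(v has_real_derivative pot \<nu> x * u x) (at x)"
    "x \<le> b \<Longrightarrow> \<bar>u x\<bar> \<le> C * x powr (1/2 - \<mu>)" "x \<le> b \<Longrightarrow> \<bar>v x\<bar> \<le> C * x powr (- 1/2 - \<mu>)"
  using assms u1_deriv v1_deriv u2_deriv v2_deriv u_bound v_bound unfolding basis_sol_def by auto

lemma C_nonneg: "C \<ge> 0"
proof -
  have "0 \<le> C * b powr (1/2 - \<mu>)" using u_bound(1)[of b] b by linarith
  then show ?thesis using b by (simp add: zero_le_mult_iff)
qed

lemma basis_sol_continuous: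
  assumes "basis_sol u v" "S \<subseteq> {0<..}"
  shows "continuous_on S u" "continuous_on S v"
  using basis_solD(1,2)[OF assms(1)] assms(2)
  by (auto intro!: continuous_at_imp_continuous_on DERIV_isCont)

abbreviation comb :: "complex \<Rightarrow> complex \<Rightarrow> real \<Rightarrow> complex" where
  "comb \<alpha> \<beta> x \<equiv> \<alpha> * complex_of_real (u1 x) + \<beta> * complex_of_real (u2 x)"

abbreviation dcomb :: "complex \<Rightarrow> complex \<Rightarrow> real \<Rightarrow> complex" where
  "dcomb \<alpha> \<beta> x \<equiv> \<alpha> * complex_of_real (v1 x) + \<beta> * complex_of_real (v2 x)"

lemma wronskian_complex:
  assumes "0 < x"
  shows "complex_of_real (u1 x) * complex_of_real (v2 x) - complex_of_real (v1 x) * complex_of_real (u2 x)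
    = complex_of_real w"
  using wronskian[OF assms] by (simp flip: of_real_mult of_real_diff)

lemma basis_sol_sqint:
  assumes "basis_sol u v"
  shows "sqint b (\<lambda>x. complex_of_real (u x))"
proof (rule sqint_of_powr_bound[where M = C and p = "1/2 - \<mu>"])
  show "(\<lambda>x. complex_of_real (u x)) \<in> borel_measurable (lebesgue_on {0<..<b})"
    by (intro continuous_on_imp_measurable_Ioo continuous_intros basis_sol_continuous[OF assms]) auto
qed (use basis_solD(3)[OF assms] mu b in auto)

lemma basis_sol_ac_deriv:
  assumes s: "basis_sol u v" and c: "0 < c"
  shows "ac_deriv c d (\<lambda>x. complex_of_real (u x)) (\<lambda>x. complex_of_real (v x))"
    "ac_deriv c d (\<lambda>x. complex_of_real (v x)) (\<lambda>x. complex_of_real (pot \<nu> x * u x))"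
proof -
  have sub: "{c..d} \<subseteq> {0<..}" using c by auto
  show "ac_deriv c d (\<lambda>x. complex_of_real (u x)) (\<lambda>x. complex_of_real (v x))"
    by (rule ac_deriv_C1)
      (use c in \<open>auto intro!: continuous_intros basis_sol_continuous[OF s sub]
         has_vector_derivative_complex_of_real DERIV_subset[OF basis_solD(1)[OF s]]\<close>)
  show "ac_deriv c d (\<lambda>x. complex_of_real (v x)) (\<lambda>x. complex_of_real (pot \<nu> x * u x))"
  proof (rule ac_deriv_C1)
    show "((\<lambda>x. complex_of_real (v x)) has_vector_derivative complex_of_real (pot \<nu> x * u x)) (at x within {c..d})"
      if "x \<in> {c..d}" for x
      using that c by (intro has_vector_derivative_complex_of_real DERIV_subset[OF basis_solD(2)[OF s]]) auto
    show "continuous_on {c..d} (\<lambda>x. complex_of_real (pot \<nu> x * u x))"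
      unfolding pot_def using c by (intro continuous_intros basis_sol_continuous[OF s sub]) auto
  qed
qed

lemma moment_ac_deriv:
  assumes "basis_sol u v" "sqint b g"
  shows "ac_deriv 0 b (moment u g) (\<lambda>t. complex_of_real (u t) * g t)"
  unfolding moment_def[abs_def]
  by (intro ac_deriv_indefinite_integral sqint_mult_integrable basis_sol_sqint[OF assms(1)] assms(2))

lemma moment_integrable:
  assumes "basis_sol u v" "sqint b g" "x \<le> b"
  shows "(\<lambda>t. complex_of_real (u t) * g t) integrable_on {0..x}"
  using absolutely_integrable_imp_integrable_on[OF sqint_mult_integrable[OF basis_sol_sqint[OF assms(1)] assms(2)]]
  by (rule integrable_on_subinterval) (use assms in auto)

lemma moment_0 [simp]: "moment u g 0 = 0"
  by (simp add: moment_def)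

lemma moment_tendsto_0:
  assumes "basis_sol u v" "sqint b g"
  shows "(moment u g \<longlongrightarrow> 0) (at_right 0)"
proof -
  have "continuous_on {0..b} (moment u g)" by (rule ac_derivD[OF moment_ac_deriv[OF assms]])
  then have "(moment u g \<longlongrightarrow> moment u g 0) (at 0 within {0..b})"
    using b unfolding continuous_on_def by (metis atLeastAtMost_iff less_imp_le order_refl)
  then have "(moment u g \<longlongrightarrow> 0) (at 0 within {0..b})" by simp
  then show ?thesis using b by (simp add: at_within_Icc_at_right)
qed

text \<open>
  The solution of \<open>\<tau> f = g\<close> by variation of constants that vanishes at \<open>0\<close> faster than every
  non-trivial combination of \<open>u1\<close> and \<open>u2\<close>. The function \<open>dres g\<close> is its derivative: the terms
  containing \<open>g\<close> itself cancel.
\<close>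
definition res :: "(real \<Rightarrow> complex) \<Rightarrow> real \<Rightarrow> complex" where
  "res g x = (complex_of_real (u1 x) * moment u2 g x - complex_of_real (u2 x) * moment u1 g x) / complex_of_real w"

definition dres :: "(real \<Rightarrow> complex) \<Rightarrow> real \<Rightarrow> complex" where
  "dres g x = (complex_of_real (v1 x) * moment u2 g x - complex_of_real (v2 x) * moment u1 g x) / complex_of_real w"

lemma res_0 [simp]: "res g 0 = 0" "dres g 0 = 0"
  by (simp_all add: res_def dres_def)

text \<open>
  Both bounds of \<open>res_bound\<close> are this statement with different values \<open>p, q\<close> at the upper limit.
\<close>
lemma kernel_integral_bound:
  assumes g: "sqint b g" and x: "0 < x" "x \<le> b"
    and k: "\<And>t. 0 < t \<Longrightarrow> t \<le> x \<Longrightarrow> \<bar>p * u2 t - q * u1 t\<bar> \<le> B * t powr (1/2 - \<mu>)"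
  shows "cmod ((complex_of_real p * moment u2 g x - complex_of_real q * moment u1 g x) / complex_of_real w)
      \<le> B / \<bar>w\<bar> * wint \<mu> g x"
proof -
  have i: "(\<lambda>t. complex_of_real (u1 t) * g t) integrable_on {0..x}" "(\<lambda>t. complex_of_real (u2 t) * g t) integrable_on {0..x}"
    using moment_integrable[OF basis_sol12(1) g] moment_integrable[OF basis_sol12(2) g] x by auto
  let ?k = "\<lambda>t. complex_of_real p * (complex_of_real (u2 t) * g t) - complex_of_real q * (complex_of_real (u1 t) * g t)"
  have hi: "(?k has_integral complex_of_real p * moment u2 g x - complex_of_real q * moment u1 g x) {0..x}"
    unfolding moment_def using i by (intro has_integral_diff has_integral_mult_right integrable_integral)
  have "cmod (complex_of_real p * moment u2 g x - complex_of_real q * moment u1 g x)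
      \<le> integral {0..x} (\<lambda>t. B * (t powr (1/2 - \<mu>) * cmod (g t)))"
  proof -
    have "(?k has_integral complex_of_real p * moment u2 g x - complex_of_real q * moment u1 g x) {0<..<x}"
      using hi by (simp add: has_integral_Icc_iff_Ioo)
    moreover have "cmod (integral {0<..<x} ?k) \<le> integral {0<..<x} (\<lambda>t. B * (t powr (1/2 - \<mu>) * cmod (g t)))"
    proof (rule integral_norm_bound_integral)
      show "?k integrable_on {0<..<x}" using calculation by blast
      show "(\<lambda>t. B * (t powr (1/2 - \<mu>) * cmod (g t))) integrable_on {0<..<x}"
        using wint_integrable[OF g mu(2) x(2) b] by (intro integrable_on_mult_right) (simp add: integrable_on_Icc_iff_Ioo)
      fix t assume t: "t \<in> {0<..<x}"
      have "?k t = complex_of_real (p * u2 t - q * u1 t) * g t" by (simp add: algebra_simps)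
      then have "cmod (?k t) = \<bar>p * u2 t - q * u1 t\<bar> * cmod (g t)" by (simp only: norm_mult norm_of_real)
      also have "\<dots> \<le> (B * t powr (1/2 - \<mu>)) * cmod (g t)"
        using t by (intro mult_right_mono k) auto
      finally show "cmod (?k t) \<le> B * (t powr (1/2 - \<mu>) * cmod (g t))" by (simp only: mult.assoc)
    qed
    ultimately show ?thesis by (simp add: integral_unique integral_open_interval_real)
  qed
  also have "\<dots> = B * wint \<mu> g x" by (simp add: wint_def)
  finally show ?thesis using w by (simp add: norm_divide divide_right_mono)
qed

lemma res_bound:
  assumes g: "sqint b g" and x: "0 < x" "x \<le> b"
  shows "cmod (res g x) \<le> C / \<bar>w\<bar> * x powr (1/2 + \<mu>) * wint \<mu> g x"
    "cmod (dres g x) \<le> C / \<bar>w\<bar> * x powr (\<mu> - 1/2) * wint \<mu> g x"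
  using kernel_integral_bound[OF g x, of "u1 x" "u2 x" "C * x powr (1/2 + \<mu>)"]
    kernel_integral_bound[OF g x, of "v1 x" "v2 x" "C * x powr (\<mu> - 1/2)"]
    kernel_bound[OF _ _ x(2)] kernel_deriv_bound[OF _ _ x(2)]
  by (simp_all add: res_def dres_def)

text \<open>
  The constant of \<open>res_bound_powr\<close>. The square root comes from \<open>\<integral>\<^sub>0\<^sup>x t\<^bsup>1-2\<mu>\<^esup> = x\<^bsup>2-2\<mu>\<^esup> / (2 - 2 \<mu>)\<close>.
\<close>
definition res_bd :: real where "res_bd = C / \<bar>w\<bar> / sqrt (2 - 2 * \<mu>)"

lemma res_bd_nonneg: "res_bd \<ge> 0" using C_nonneg mu by (simp add: res_bd_def)

lemma res_bound_powr:
  assumes g: "sqint b g" and x: "0 < x" "x \<le> b"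
  shows "cmod (res g x) \<le> res_bd * sqrt (l2sq b g) * x powr (3/2)"
    "cmod (dres g x) \<le> res_bd * sqrt (l2sq b g) * x powr (1/2)"
proof -
  have *: "C / \<bar>w\<bar> * x powr p * wint \<mu> g x \<le> res_bd * sqrt (l2sq b g) * x powr (p + 1 - \<mu>)" for p
  proof -
    have "C / \<bar>w\<bar> * x powr p * wint \<mu> g x \<le> C / \<bar>w\<bar> * x powr p * (x powr (1 - \<mu>) / sqrt (2 - 2 * \<mu>) * sqrt (l2sq b g))"
      using C_nonneg by (intro mult_left_mono wint_le[OF g mu(2) x]) auto
    also have "\<dots> = res_bd * sqrt (l2sq b g) * (x powr p * x powr (1 - \<mu>))"
      by (simp add: res_bd_def field_simps)
    also have "x powr p * x powr (1 - \<mu>) = x powr (p + 1 - \<mu>)" by (simp add: powr_add[symmetric] algebra_simps)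
    finally show ?thesis .
  qed
  show "cmod (res g x) \<le> res_bd * sqrt (l2sq b g) * x powr (3/2)"
    using res_bound(1)[OF assms] *[of "1/2 + \<mu>"] by simp
  show "cmod (dres g x) \<le> res_bd * sqrt (l2sq b g) * x powr (1/2)"
    using res_bound(2)[OF assms] *[of "\<mu> - 1/2"] by simp
qed

text \<open>
  The product rule; in the second equation the terms with \<open>g\<close> combine to the Wronskian.
\<close>
lemma res_ac_deriv:
  assumes g: "sqint b g" and c: "0 < c"
  shows "ac_deriv c b (res g) (dres g)"
    "ac_deriv c b (dres g) (\<lambda>x. complex_of_real (pot \<nu> x) * res g x - g x)"
proof -
  have m: "ac_deriv c b (moment u1 g) (\<lambda>t. complex_of_real (u1 t) * g t)" "ac_deriv c b (moment u2 g) (\<lambda>t. complex_of_real (u2 t) * g t)"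
    using c by (auto intro: ac_deriv_subset[OF moment_ac_deriv[OF basis_sol12(1) g]] ac_deriv_subset[OF moment_ac_deriv[OF basis_sol12(2) g]])
  note s1 = basis_sol_ac_deriv[OF basis_sol12(1) c, where d = b]
  note s2 = basis_sol_ac_deriv[OF basis_sol12(2) c, where d = b]
  show "ac_deriv c b (res g) (dres g)"
  proof (rule ac_deriv_cong[OF ac_deriv_cmult[of c b _ _ "1 / complex_of_real w", OF ac_deriv_diff[OF ac_deriv_mult[OF s1(1) m(2)] ac_deriv_mult[OF s2(1) m(1)]]]])
  qed (auto simp: res_def dres_def algebra_simps diff_divide_distrib add_divide_distrib)
  show "ac_deriv c b (dres g) (\<lambda>x. complex_of_real (pot \<nu> x) * res g x - g x)"
  proof (rule ac_deriv_cong[OF ac_deriv_cmult[of c b _ _ "1 / complex_of_real w", OF ac_deriv_diff[OF ac_deriv_mult[OF s1(2) m(2)] ac_deriv_mult[OF s2(2) m(1)]]]])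
    fix x assume "x \<in> {c<..<b}"
    then have "c < x" by simp
    have "1 / complex_of_real w *
         (complex_of_real (v1 x) * (complex_of_real (u2 x) * g x) + complex_of_real (pot \<nu> x * u1 x) * moment u2 g x -
          (complex_of_real (v2 x) * (complex_of_real (u1 x) * g x) + complex_of_real (pot \<nu> x * u2 x) * moment u1 g x))
      = complex_of_real (pot \<nu> x) * res g x - (complex_of_real (u1 x) * complex_of_real (v2 x) - complex_of_real (v1 x) * complex_of_real (u2 x)) * g x / complex_of_real w"
      by (simp add: res_def algebra_simps diff_divide_distrib add_divide_distrib)
    also have "\<dots> = complex_of_real (pot \<nu> x) * res g x - g x"
      unfolding wronskian_complex[OF less_trans[OF c \<open>c < x\<close>]] using w by simp
    finally show "1 / complex_of_real w *
         (complex_of_real (v1 x) * (complex_of_real (u2 x) * g x) + complex_of_real (pot \<nu> x * u1 x) * moment u2 g x -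
          (complex_of_real (v2 x) * (complex_of_real (u1 x) * g x) + complex_of_real (pot \<nu> x * u2 x) * moment u1 g x))
      = complex_of_real (pot \<nu> x) * res g x - g x" .
  qed (auto simp: dres_def)
qed

lemma res_continuous:
  assumes "sqint b g"
  shows "continuous_on {0..b} (res g)" "continuous_on {0..b} (dres g)"
proof -
  show "continuous_on {0..b} (res g)"
    by (rule continuous_on_0_of_powr_bound[where p = "3/2"])
      (use res_bound_powr[OF assms] ac_derivD[OF res_ac_deriv(1)[OF assms]] in auto)
  show "continuous_on {0..b} (dres g)"
    by (rule continuous_on_0_of_powr_bound[where p = "1/2"])
      (use res_bound_powr[OF assms] ac_derivD[OF res_ac_deriv(2)[OF assms]] in auto)
qed

lemma res_sqint:
  assumes "sqint b g"
  shows "sqint b (res g)"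
proof (rule sqint_of_powr_bound[where M = "res_bd * sqrt (l2sq b g)" and p = "3/2"])
  show "res g \<in> borel_measurable (lebesgue_on {0<..<b})"
    by (intro continuous_on_imp_measurable_Ioo continuous_on_subset[OF res_continuous(1)[OF assms]]) auto
qed (use res_bound_powr[OF assms] b in auto)

text \<open>
  The pointwise bound \<open>O(x\<^bsup>3/2\<^esup>)\<close> on \<open>res g\<close> gives only \<open>O(x\<^bsup>-1/2\<^esup>)\<close> here, which just fails to be
  square integrable; Hardy's inequality, applied to \<open>res_bound\<close>, closes the gap.
\<close>
lemma pot_res_sqint:
  assumes g: "sqint b g"
  shows "sqint b (\<lambda>x. complex_of_real (pot \<nu> x) * res g x)"
proof (rule sqint_bound)
  let ?M = "\<bar>\<nu>\<^sup>2 - 1/4\<bar> * (C / \<bar>w\<bar>)"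
  show "(\<lambda>x. complex_of_real (pot \<nu> x) * res g x) \<in> borel_measurable (lebesgue_on {0<..<b})"
    unfolding pot_def
    by (intro continuous_on_imp_measurable_Ioo continuous_intros continuous_on_subset[OF res_continuous(1)[OF g]]) auto
  show "(\<lambda>x. ?M\<^sup>2 * (x powr (\<mu> - 3/2) * wint \<mu> g x)\<^sup>2) integrable_on {0..b}"
    by (intro integrable_on_mult_right Hardy g mu b)
  fix x assume x: "0 < x" "x < b"
  have "cmod (complex_of_real (pot \<nu> x) * res g x) = \<bar>\<nu>\<^sup>2 - 1/4\<bar> * x powr (-2) * cmod (res g x)"
  proof -
    have "x powr (-2) = 1 / x\<^sup>2" using x by (simp add: powr_minus_divide)
    then have "\<bar>pot \<nu> x\<bar> = \<bar>\<nu>\<^sup>2 - 1/4\<bar> * x powr (-2)" unfolding pot_def abs_divide by simp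
    then show ?thesis by (simp only: norm_mult norm_of_real)
  qed
  also have "\<dots> \<le> \<bar>\<nu>\<^sup>2 - 1/4\<bar> * x powr (-2) * (C / \<bar>w\<bar> * x powr (1/2 + \<mu>) * wint \<mu> g x)"
    using x by (intro mult_left_mono res_bound g) auto
  also have "\<dots> = ?M * ((x powr (-2) * x powr (1/2 + \<mu>)) * wint \<mu> g x)" by (simp add: algebra_simps)
  also have "x powr (-2) * x powr (1/2 + \<mu>) = x powr (\<mu> - 3/2)"
    by (simp add: powr_add[symmetric])
  finally have "cmod (complex_of_real (pot \<nu> x) * res g x) \<le> ?M * (x powr (\<mu> - 3/2) * wint \<mu> g x)" .
  then have "(cmod (complex_of_real (pot \<nu> x) * res g x))\<^sup>2 \<le> (?M * (x powr (\<mu> - 3/2) * wint \<mu> g x))\<^sup>2"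
    by (intro power_mono) auto
  then show "(cmod (complex_of_real (pot \<nu> x) * res g x))\<^sup>2 \<le> ?M\<^sup>2 * (x powr (\<mu> - 3/2) * wint \<mu> g x)\<^sup>2"
    by (simp only: power_mult_distrib)
qed

lemma res_ac_deriv_0:
  assumes g: "sqint b g"
  shows "ac_deriv 0 b (res g) (dres g)"
    "ac_deriv 0 b (dres g) (\<lambda>x. complex_of_real (pot \<nu> x) * res g x - g x)"
proof -
  show "ac_deriv 0 b (res g) (dres g)"
    by (intro ac_deriv_extend_0 b res_ac_deriv[OF g] res_continuous[OF g] absolutely_integrable_continuous_real res_0)
  show "ac_deriv 0 b (dres g) (\<lambda>x. complex_of_real (pot \<nu> x) * res g x - g x)"
    by (intro ac_deriv_extend_0 b res_ac_deriv[OF g] res_continuous[OF g] res_0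
      sqint_integrable sqint_diff pot_res_sqint g)
qed

lemma res_has_vector_derivative:
  assumes g: "sqint b g" and "x \<in> {0..b}"
  shows "(res g has_vector_derivative dres g x) (at x within {0..b})"
  using ac_deriv_continuous_imp_has_vector_derivative[OF res_ac_deriv_0(1)[OF g] res_continuous(2)[OF g]] assms by auto

lemma res_bessel_pair:
  assumes g: "sqint b g"
  shows "bessel_pair \<nu> b (res g) g"
  unfolding bessel_pair_iff
proof (intro conjI exI[of _ "dres g"] ballI allI impI res_sqint g)
  show "(res g has_vector_derivative dres g x) (at x)" if "x \<in> {0<..<b}" for x
    using res_has_vector_derivative[OF g, of x] that at_within_Icc_at[of 0 x b] by simp
  show "ac_deriv c d (dres g) (\<lambda>x. complex_of_real (pot \<nu> x) * res g x - g x)" if "0 < c" "d < b" for c d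
    using res_ac_deriv(2)[OF g that(1)] by (rule ac_deriv_subset) (use that in auto)
qed

lemma res_in_H2_tilde_0:
  assumes g: "sqint b g"
  shows "res g \<in> H2_tilde_0 b"
proof -
  let ?h = "\<lambda>x. complex_of_real (pot \<nu> x) * res g x - g x"
  note ac = res_ac_deriv_0[OF g]
  have "AE x in lebesgue_on {0<..<b}. (dres g has_vector_derivative ?h x) (at x)"
    using ac(2) unfolding AE_lebesgue_on_Ioo_iff ac_deriv_def by blast
  moreover have "abs_continuous_on 0 b (res g)" "abs_continuous_on 0 b (dres g)"
    using ac by (auto simp: ac_deriv_def)
  ultimately have "res g \<in> H2 b"
    unfolding H2_def mem_Collect_eq
    by (intro exI[of _ "dres g"] exI[of _ ?h] conjI ballI res_has_vector_derivative[OF g]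
        sqint_diff[OF pot_res_sqint[OF g] g])
  moreover have "vector_derivative (res g) (at 0 within {0..b}) = 0"
    using vector_derivative_within_cbox[of 0 b 0 "res g" "dres g 0"] res_has_vector_derivative[OF g, of 0] b
    by (auto simp: box_real)
  ultimately show ?thesis by (simp add: H2_tilde_0_def)
qed

end

section \<open>The form of the functions in the maximal domain\<close>

text \<open>
  As \<open>f\<close> and \<open>f'\<close> vanish at \<open>0\<close>, they are bounded by \<open>x \<integral>\<^sub>0\<^sup>x |f''|\<close> and \<open>\<integral>\<^sub>0\<^sup>x |f''|\<close>. Hardy's inequality
  with \<open>\<mu> = 1/2\<close> then shows \<open>f / x\<^sup>2 \<in> L\<^sup>2\<close>, so that \<open>f\<close> belongs to the maximal domain.
\<close>
lemma H2_tilde_0_jet: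
  assumes f: "f \<in> H2_tilde_0 b" and b: "0 < b"
  obtains f' g M where "bessel_jet \<nu> b f f' g"
    "\<And>x. x \<in> {0..b} \<Longrightarrow> (f has_vector_derivative f' x) (at x within {0..b})" "continuous_on {0..b} f'"
    "\<And>x. 0 < x \<Longrightarrow> x \<le> b \<Longrightarrow> cmod (f x) \<le> M * x powr (3/2)"
    "\<And>x. 0 < x \<Longrightarrow> x \<le> b \<Longrightarrow> cmod (f' x) \<le> M * x powr (1/2)"
proof -
  from f obtain f' f'' where f': "\<And>x. x \<in> {0..b} \<Longrightarrow> (f has_vector_derivative f' x) (at x within {0..b})"
    and ac: "abs_continuous_on 0 b f'" and ae: "AE x in lebesgue_on {0<..<b}. (f' has_vector_derivative f'' x) (at x)"
    and f'': "sqint b f''" and f0: "f 0 = 0" "vector_derivative f (at 0 within {0..b}) = 0"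
    unfolding H2_tilde_0_def H2_def by blast
  have f'0: "f' 0 = 0"
    using f0(2) f'[of 0] b vector_derivative_within_cbox[of 0 b 0 f "f' 0"] by (auto simp: box_real)
  have acd': "ac_deriv 0 b f' f''" using ac ae unfolding ac_deriv_def AE_lebesgue_on_Ioo_iff by blast
  note cont' = ac_derivD[OF acd']
  have acd: "ac_deriv 0 b f f'" by (rule ac_deriv_C1[OF f' cont'])
  let ?A = "\<lambda>x. wint (1/2) f'' x"
  define M where "M = sqrt (l2sq b f'')"
  have A: "?A x \<le> M * x powr (1/2)" if "0 < x" "x \<le> b" for x
    using wint_le[OF f'' _ that, of "1/2"] by (simp add: M_def mult.commute)
  have A_mono: "?A x \<le> ?A y" if "0 \<le> x" "x \<le> y" "y \<le> b" for x y
    unfolding wint_def using that b by (intro integral_subset_le wint_integrable[OF f'']) auto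
  have b1: "cmod (f' x) \<le> ?A x" if x: "0 < x" "x \<le> b" for x
  proof -
    have hi: "(f'' has_integral f' x) {0<..<x}"
      using ac_deriv_has_integral[OF ac_deriv_subset[OF acd', of 0 x]] x f'0 by (simp add: has_integral_Icc_iff_Ioo)
    have "cmod (integral {0<..<x} f'') \<le> integral {0<..<x} (\<lambda>t. t powr (1/2 - 1/2) * cmod (f'' t))"
      using hi wint_integrable[OF f'' _ x(2) b, of "1/2"]
      by (intro integral_norm_bound_integral) (auto simp: integrable_on_Icc_iff_Ioo)
    then show ?thesis using hi by (simp add: integral_unique wint_def integral_open_interval_real)
  qed
  have b2: "cmod (f x) \<le> x * ?A x" if x: "0 < x" "x \<le> b" for x
  proof -
    have hi: "(f' has_integral f x) {0..x}"
      using ac_deriv_has_integral[OF ac_deriv_subset[OF acd, of 0 x]] x f0 by simp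
    have "cmod (f x) \<le> ?A x * (x - 0)"
    proof (rule order_trans[OF has_integral_bound_real[where S = "{}", OF wint_nonneg[of "1/2" f'' x] _ hi]])
      fix t assume t: "t \<in> {0..x} - {}"
      show "cmod (f' t) \<le> ?A x"
      proof (cases "t = 0")
        case False
        then have "cmod (f' t) \<le> ?A t" using t x by (intro b1) auto
        also have "\<dots> \<le> ?A x" using t x by (intro A_mono) auto
        finally show ?thesis .
      qed (simp add: f'0 wint_nonneg)
    qed (use x in auto)
    then show ?thesis by (simp add: mult.commute)
  qed
  have bf: "cmod (f x) \<le> M * x powr (3/2)" if x: "0 < x" "x \<le> b" for x
  proof -
    have "cmod (f x) \<le> x * (M * x powr (1/2))" using b2[of x] A[of x] x
      by (meson less_imp_le mult_left_mono order_trans)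
    also have "\<dots> = M * (x powr 1 * x powr (1/2))" using x by simp
    also have "\<dots> = M * x powr (3/2)" by (simp only: powr_add[symmetric]) simp
    finally show ?thesis .
  qed
  let ?g = "\<lambda>x. complex_of_real (pot \<nu> x) * f x - f'' x"
  have contf: "continuous_on {0..b} f" by (rule ac_derivD[OF acd])
  have sqf: "sqint b f"
  proof (rule sqint_of_powr_bound[where M = M and p = "3/2"])
    show "f \<in> borel_measurable (lebesgue_on {0<..<b})"
      by (intro continuous_on_imp_measurable_Ioo continuous_on_subset[OF contf]) auto
  qed (use b bf in auto)
  have sqV: "sqint b (\<lambda>x. complex_of_real (pot \<nu> x) * f x)"
  proof (rule sqint_bound)
    show "(\<lambda>x. complex_of_real (pot \<nu> x) * f x) \<in> borel_measurable (lebesgue_on {0<..<b})"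
      unfolding pot_def
      by (intro continuous_on_imp_measurable_Ioo continuous_intros continuous_on_subset[OF contf]) auto
    show "(\<lambda>x. (\<nu>\<^sup>2 - 1/4)\<^sup>2 * (x powr (1/2 - 3/2) * ?A x)\<^sup>2) integrable_on {0..b}"
      by (intro integrable_on_mult_right Hardy f'' b) auto
    fix x assume x: "0 < x" "x < b"
    have "\<bar>pot \<nu> x\<bar> * cmod (f x) \<le> \<bar>pot \<nu> x\<bar> * (x * ?A x)"
      using b2[of x] x by (intro mult_left_mono) auto
    also have "\<dots> = \<bar>\<nu>\<^sup>2 - 1/4\<bar> * (x powr (1/2 - 3/2) * ?A x)"
      using x by (simp add: pot_def powr_minus_divide power2_eq_square abs_mult)
    finally have "(cmod (complex_of_real (pot \<nu> x) * f x))\<^sup>2 \<le> (\<bar>\<nu>\<^sup>2 - 1/4\<bar> * (x powr (1/2 - 3/2) * ?A x))\<^sup>2"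
      by (intro power_mono) (auto simp: norm_mult)
    then show "(cmod (complex_of_real (pot \<nu> x) * f x))\<^sup>2 \<le> (\<nu>\<^sup>2 - 1/4)\<^sup>2 * (x powr (1/2 - 3/2) * ?A x)\<^sup>2"
      by (simp only: power_mult_distrib power2_abs)
  qed
  have "bessel_jet \<nu> b f f' ?g"
    unfolding bessel_jet_def
  proof (intro conjI ballI allI impI sqf sqint_diff sqV f'')
    show "(f has_vector_derivative f' x) (at x)" if "x \<in> {0<..<b}" for x
      using f'[of x] that at_within_Icc_at[of 0 x b] by simp
    show "ac_deriv c d f' (\<lambda>x. complex_of_real (pot \<nu> x) * f x - ?g x)" if "0 < c" "d < b" for c d
      using ac_deriv_subset[OF acd', of c d] that by simp
  qed
  moreover have "cmod (f' x) \<le> M * x powr (1/2)" if x: "0 < x" "x \<le> b" for x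
    using b1[OF x] A[OF x] by linarith
  ultimately show ?thesis using that f' cont' bf by blast
qed

context bessel_system
begin

lemma moment_cong:
  assumes "negligible N" "\<And>t. t \<in> {0<..<b} - N \<Longrightarrow> f t = g t" "x \<le> b"
  shows "moment u f x = moment u g x"
proof -
  have "integral {0<..<x} (\<lambda>t. complex_of_real (u t) * f t) = integral {0<..<x} (\<lambda>t. complex_of_real (u t) * g t)"
    by (rule integral_spike[OF assms(1)]) (use assms in auto)
  then show ?thesis by (simp add: moment_def integral_open_interval_real)
qed

lemma res_cong:
  assumes "negligible N" "\<And>t. t \<in> {0<..<b} - N \<Longrightarrow> f t = g t" "x \<le> b"
  shows "res f x = res g x" "dres f x = dres g x"
  using moment_cong[OF assms] by (simp_all add: res_def dres_def)

lemma moment_linear: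
  assumes "basis_sol u v" "sqint b f" "sqint b g" "x \<le> b"
  shows "moment u (\<lambda>t. p * f t + q * g t) x = p * moment u f x + q * moment u g x"
proof -
  have "((\<lambda>t. p * (complex_of_real (u t) * f t) + q * (complex_of_real (u t) * g t)) has_integral
      p * moment u f x + q * moment u g x) {0..x}"
    unfolding moment_def using assms
    by (intro has_integral_add has_integral_mult_right integrable_integral moment_integrable[OF assms(1)])
  then show ?thesis unfolding moment_def by (intro integral_unique) (simp add: algebra_simps)
qed

lemma res_linear:
  assumes "sqint b f" "sqint b g" "x \<le> b"
  shows "res (\<lambda>t. p * f t + q * g t) x = p * res f x + q * res g x"
  unfolding res_def moment_linear[OF basis_sol12(1) assms] moment_linear[OF basis_sol12(2) assms]
  using w by (simp add: field_simps)

text \<open>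
  The Wronskian of \<open>f\<close> with a solution of the homogeneous equation has derivative \<open>u g\<close>, because the
  terms with the potential cancel.
\<close>
lemma jet_wronskian:
  assumes J: "bessel_jet \<nu> b f f' g" and s: "basis_sol u v"
  obtains a where "\<And>x. 0 < x \<Longrightarrow> x < b \<Longrightarrow>
      f x * complex_of_real (v x) - f' x * complex_of_real (u x) = a + moment u g x"
proof -
  let ?W = "\<lambda>x. f x * complex_of_real (v x) - f' x * complex_of_real (u x)"
  note D = bessel_jetD[OF J]
  have ac: "ac_deriv c d ?W (\<lambda>x. complex_of_real (u x) * g x)" if cd: "0 < c" "c < d" "d < b" for c d
    by (rule ac_deriv_cong[OF ac_deriv_diff[OF ac_deriv_mult[OF D(5)[OF cd] basis_sol_ac_deriv(2)[OF s cd(1)]]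
        ac_deriv_mult[OF D(4)[OF cd] basis_sol_ac_deriv(1)[OF s cd(1)]]]]) (auto simp: algebra_simps)
  have eq: "?W d - ?W c = moment u g d - moment u g c" if cd: "0 < c" "c < d" "d < b" for c d
  proof -
    have "((\<lambda>x. complex_of_real (u x) * g x) has_integral ?W d - ?W c) {c..d}"
      using cd by (intro ac_deriv_has_integral ac) auto
    moreover have "((\<lambda>x. complex_of_real (u x) * g x) has_integral moment u g d - moment u g c) {c..d}"
      using cd by (intro ac_deriv_has_integral ac_deriv_subset[OF moment_ac_deriv[OF s D(2)]]) auto
    ultimately show ?thesis by (rule has_integral_unique)
  qed
  have "?W x = (?W (b/2) - moment u g (b/2)) + moment u g x" if "0 < x" "x < b" for x
  proof -
    consider "x = b/2" | "x < b/2" | "b/2 < x" by linarith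
    then show ?thesis
      by cases (use eq[of x "b/2"] eq[of "b/2" x] that in \<open>auto simp: algebra_simps\<close>)
  qed
  then show ?thesis using that by blast
qed

text \<open>
  Cramer's rule: \<open>f\<close> and \<open>f'\<close> are determined by the Wronskians with \<open>u1\<close> and \<open>u2\<close>.
\<close>
lemma jet_from_wronskian:
  assumes "f * complex_of_real (v1 x) - f' * complex_of_real (u1 x) = a1 + moment u1 g x"
    "f * complex_of_real (v2 x) - f' * complex_of_real (u2 x) = a2 + moment u2 g x" and x: "0 < x"
  shows "f = a2 / complex_of_real w * complex_of_real (u1 x) - a1 / complex_of_real w * complex_of_real (u2 x) + res g x"
    "f' = a2 / complex_of_real w * complex_of_real (v1 x) - a1 / complex_of_real w * complex_of_real (v2 x) + dres g x"
proof -
  note w' = wronskian_complex[OF x]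
  have wc: "complex_of_real w \<noteq> 0" using w by simp
  have "f = (complex_of_real (u1 x) * (a2 + moment u2 g x) - complex_of_real (u2 x) * (a1 + moment u1 g x)) / complex_of_real w"
    unfolding assms(1,2)[symmetric] by (rule nonzero_eq_divide_eq[THEN iffD2, OF wc]) (simp add: w'[symmetric] algebra_simps)
  then show "f = a2 / complex_of_real w * complex_of_real (u1 x) - a1 / complex_of_real w * complex_of_real (u2 x) + res g x"
    by (simp add: res_def add_divide_distrib diff_divide_distrib algebra_simps)
  have "f' = (complex_of_real (v1 x) * (a2 + moment u2 g x) - complex_of_real (v2 x) * (a1 + moment u1 g x)) / complex_of_real w"
    unfolding assms(1,2)[symmetric] by (rule nonzero_eq_divide_eq[THEN iffD2, OF wc]) (simp add: w'[symmetric] algebra_simps)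
  then show "f' = a2 / complex_of_real w * complex_of_real (v1 x) - a1 / complex_of_real w * complex_of_real (v2 x) + dres g x"
    by (simp add: dres_def add_divide_distrib diff_divide_distrib algebra_simps)
qed

theorem jet_decomposition:
  assumes J: "bessel_jet \<nu> b f f' g"
  obtains \<alpha> \<beta> where "\<And>x. 0 < x \<Longrightarrow> x < b \<Longrightarrow>
      f x = comb \<alpha> \<beta> x + res g x"
proof -
  obtain a1 where a1: "\<And>x. 0 < x \<Longrightarrow> x < b \<Longrightarrow>
      f x * complex_of_real (v1 x) - f' x * complex_of_real (u1 x) = a1 + moment u1 g x"
    using jet_wronskian[OF J basis_sol12(1)] by blast
  obtain a2 where a2: "\<And>x. 0 < x \<Longrightarrow> x < b \<Longrightarrow>
      f x * complex_of_real (v2 x) - f' x * complex_of_real (u2 x) = a2 + moment u2 g x"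
    using jet_wronskian[OF J basis_sol12(2)] by blast
  have "f x = a2 / complex_of_real w * complex_of_real (u1 x) + (- a1 / complex_of_real w) * complex_of_real (u2 x) + res g x"
    if "0 < x" "x < b" for x
    using jet_from_wronskian(1)[OF a1 a2] that by simp
  then show ?thesis by (rule that)
qed

text \<open>
  The growth bounds make both Wronskians tend to \<open>0\<close> at the left endpoint, so the additive
  constants in \<open>jet_wronskian\<close> are zero.
\<close>
lemma jet_eq_res_of_growth:
  assumes J: "bessel_jet \<nu> b f f' g" and c: "0 < c" "c \<le> b"
    and f: "\<And>x. 0 < x \<Longrightarrow> x < c \<Longrightarrow> cmod (f x) \<le> M * x powr (3/2)"
    and f': "\<And>x. 0 < x \<Longrightarrow> x < c \<Longrightarrow> cmod (f' x) \<le> M * x powr (1/2)"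
    and x: "0 < x" "x < b"
  shows "f x = res g x" "f' x = dres g x"
proof -
  have *: "f x * complex_of_real (v x) - f' x * complex_of_real (u x) = 0 + moment u g x"
    if s: "basis_sol u v" "0 < x" "x < b" for u v x
  proof -
    obtain a where a: "\<And>x. 0 < x \<Longrightarrow> x < b \<Longrightarrow>
        f x * complex_of_real (v x) - f' x * complex_of_real (u x) = a + moment u g x"
      using jet_wronskian[OF J s(1)] by blast
    let ?W = "\<lambda>x. f x * complex_of_real (v x) - f' x * complex_of_real (u x)"
    have "\<forall>\<^sub>F x in at_right 0. norm (?W x) \<le> 2 * M * C * x powr (1 - \<mu>)"
      unfolding eventually_at_right_field
    proof (intro exI[of _ c] conjI allI impI c)
      fix x assume x: "0 < x" "x < c"
      have M: "M \<ge> 0" using order_trans[OF norm_ge_zero f[OF x]] x by (simp add: zero_le_mult_iff)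
      have "norm (?W x) \<le> cmod (f x) * \<bar>v x\<bar> + cmod (f' x) * \<bar>u x\<bar>"
        by (rule order_trans[OF norm_triangle_ineq4]) (simp add: norm_mult)
      also have "\<dots> \<le> (M * x powr (3/2)) * (C * x powr (- 1/2 - \<mu>)) + (M * x powr (1/2)) * (C * x powr (1/2 - \<mu>))"
        using x c M by (intro add_mono mult_mono f f' basis_solD(3,4)[OF s(1)]) auto
      also have "\<dots> = M * C * (x powr (3/2) * x powr (- 1/2 - \<mu>)) + M * C * (x powr (1/2) * x powr (1/2 - \<mu>))"
        by (simp add: algebra_simps)
      also have "\<dots> = 2 * M * C * x powr (1 - \<mu>)" unfolding powr_add[symmetric] by simp
      finally show "norm (?W x) \<le> 2 * M * C * x powr (1 - \<mu>)" .
    qed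
    moreover have "((\<lambda>x. x powr (1 - \<mu>)) \<longlongrightarrow> 0 powr (1 - \<mu>)) (at_right 0)"
      using mu by (intro tendsto_powr' tendsto_const tendsto_ident_at) (auto simp: eventually_at_filter)
    then have "((\<lambda>x. 2 * M * C * x powr (1 - \<mu>)) \<longlongrightarrow> 2 * M * C * 0) (at_right 0)"
      by (intro tendsto_mult tendsto_const) auto
    ultimately have W0: "(?W \<longlongrightarrow> 0) (at_right 0)"
      using Lim_null_comparison[where f = ?W and g = "\<lambda>x. 2 * M * C * x powr (1 - \<mu>)" and net = "at_right 0"] by simp
    have "((\<lambda>x. ?W x - moment u g x) \<longlongrightarrow> 0 - 0) (at_right 0)"
      using bessel_jetD(2)[OF J] by (intro tendsto_diff W0 moment_tendsto_0[OF s(1)])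
    moreover have "\<forall>\<^sub>F x in at_right 0. ?W x - moment u g x = a"
      unfolding eventually_at_right_field using a b by (intro exI[of _ b]) auto
    then have "((\<lambda>x. ?W x - moment u g x) \<longlongrightarrow> a) (at_right 0)" by (rule tendsto_eventually)
    ultimately have "a = 0" using tendsto_unique[of "at_right (0::real)"] by fastforce
    then show ?thesis using a s by simp
  qed
  show "f x = res g x" "f' x = dres g x"
    using jet_from_wronskian[OF *[OF basis_sol12(1) x] *[OF basis_sol12(2) x] x(1)] by simp_all
qed

text \<open>
  If a combination vanishes on an open interval, so does its derivative, and the Wronskian is the
  determinant of the resulting linear system.
\<close>
lemma basis_combination_eq_0:
  assumes c: "0 \<le> c" "c < d"
    and z: "\<And>x. c < x \<Longrightarrow> x < d \<Longrightarrow> comb \<alpha> \<beta> x = 0"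
  shows "\<alpha> = 0 \<and> \<beta> = 0"
proof -
  define x where "x = (c + d) / 2"
  have x: "c < x" "x < d" "0 < x" using c by (auto simp: x_def)
  have D: "((\<lambda>x. comb \<alpha> \<beta> x) has_vector_derivative
      dcomb \<alpha> \<beta> x) (at x)"
    by (intro has_vector_derivative_add has_vector_derivative_mult_right has_vector_derivative_complex_of_real
        u1_deriv u2_deriv x)
  have "((\<lambda>x. 0) has_vector_derivative dcomb \<alpha> \<beta> x) (at x)"
    by (rule has_vector_derivative_transform_within_open[OF D, of "{c<..<d}"]) (use x z in auto)
  then have e2: "dcomb \<alpha> \<beta> x = 0"
    using has_vector_derivative_const vector_derivative_unique_at by blast
  note e1 = z[OF x(1,2)]
  note w' = wronskian_complex[OF x(3)]
  have "\<alpha> * complex_of_real w = (comb \<alpha> \<beta> x) * complex_of_real (v2 x)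
      - (dcomb \<alpha> \<beta> x) * complex_of_real (u2 x)"
    unfolding w'[symmetric] by (simp add: algebra_simps)
  also have "\<dots> = 0" unfolding e1 e2 by simp
  finally have "\<alpha> = 0" using w by simp
  have "\<beta> * complex_of_real w = (dcomb \<alpha> \<beta> x) * complex_of_real (u1 x)
      - (comb \<alpha> \<beta> x) * complex_of_real (v1 x)"
    unfolding w'[symmetric] by (simp add: algebra_simps)
  also have "\<dots> = 0" unfolding e1 e2 by simp
  finally show ?thesis using w \<open>\<alpha> = 0\<close> by simp
qed

lemma basis_combination_jet:
  "bessel_jet \<nu> b (\<lambda>x. comb \<alpha> \<beta> x)
     (\<lambda>x. dcomb \<alpha> \<beta> x) (\<lambda>_. 0)"
  unfolding bessel_jet_def
proof (intro conjI ballI allI impI square_integrable_add square_integrable_cmult basis_sol_sqint[OF basis_sol12(1)]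
    basis_sol_sqint[OF basis_sol12(2)] square_integrable_0)
  show "((\<lambda>x. comb \<alpha> \<beta> x) has_vector_derivative
      dcomb \<alpha> \<beta> x) (at x)" if "x \<in> {0<..<b}" for x
    using that
    by (intro has_vector_derivative_add has_vector_derivative_mult_right has_vector_derivative_complex_of_real
        u1_deriv u2_deriv) auto
  show "ac_deriv c d (\<lambda>x. dcomb \<alpha> \<beta> x)
      (\<lambda>x. complex_of_real (pot \<nu> x) * (comb \<alpha> \<beta> x) - 0)" if "0 < c" for c d
    by (rule ac_deriv_cong[OF ac_deriv_add[OF ac_deriv_cmult[where k = \<alpha>, OF basis_sol_ac_deriv(2)[OF basis_sol12(1) that]]
        ac_deriv_cmult[where k = \<beta>, OF basis_sol_ac_deriv(2)[OF basis_sol12(2) that]]]]) (auto simp: algebra_simps)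
qed

lemma bessel_pair_add:
  assumes "bessel_pair \<nu> b f g" "bessel_pair \<nu> b p q"
  shows "bessel_pair \<nu> b (\<lambda>x. f x + p x) (\<lambda>x. g x + q x)"
proof -
  obtain f' p' where J: "bessel_jet \<nu> b f f' g" "bessel_jet \<nu> b p p' q"
    using assms unfolding bessel_pair_iff_jet by blast
  have "bessel_jet \<nu> b (\<lambda>x. f x + p x) (\<lambda>x. f' x + p' x) (\<lambda>x. g x + q x)"
    unfolding bessel_jet_def
  proof (intro conjI ballI allI impI square_integrable_add bessel_jetD(1,2)[OF J(1)] bessel_jetD(1,2)[OF J(2)])
    show "((\<lambda>x. f x + p x) has_vector_derivative f' x + p' x) (at x)" if "x \<in> {0<..<b}" for x
      using that by (intro has_vector_derivative_add bessel_jetD(3)[OF J(1)] bessel_jetD(3)[OF J(2)]) auto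
    show "ac_deriv c d (\<lambda>x. f' x + p' x) (\<lambda>x. complex_of_real (pot \<nu> x) * (f x + p x) - (g x + q x))"
      if cd: "0 < c" "c < d" "d < b" for c d
      by (rule ac_deriv_cong[OF ac_deriv_add[OF bessel_jetD(4)[OF J(1) cd] bessel_jetD(4)[OF J(2) cd]]])
        (auto simp: algebra_simps)
  qed
  then show ?thesis unfolding bessel_pair_iff_jet by blast
qed

text \<open>
  A combination equal to \<open>res g\<close> inherits its growth; being a solution of the homogeneous equation
  it is then \<open>res 0 = 0\<close>.
\<close>
lemma res_eq_combination_imp_0:
  assumes g: "sqint b g"
    and eq: "\<And>x. 0 < x \<Longrightarrow> x < b \<Longrightarrow> res g x = comb \<alpha> \<beta> x"
  shows "\<alpha> = 0 \<and> \<beta> = 0"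
proof -
  let ?f = "\<lambda>x. comb \<alpha> \<beta> x"
  let ?f' = "\<lambda>x. dcomb \<alpha> \<beta> x"
  have f': "?f' x = dres g x" if x: "0 < x" "x < b" for x
  proof -
    have "(res g has_vector_derivative dres g x) (at x)"
      using res_has_vector_derivative[OF g, of x] x at_within_Icc_at[of 0 x b] by simp
    then have "(?f has_vector_derivative dres g x) (at x)"
      by (rule has_vector_derivative_transform_within_open[of _ _ _ "{0<..<b}"]) (use eq x in auto)
    then show ?thesis using bessel_jetD(3)[OF basis_combination_jet x] vector_derivative_unique_at by blast
  qed
  have "?f x = res (\<lambda>_. 0) x" if x: "0 < x" "x < b" for x
    by (rule jet_eq_res_of_growth(1)[OF basis_combination_jet, where c = b and M = "res_bd * sqrt (l2sq b g)"])
      (use x b res_bound_powr[OF g] eq f' in \<open>simp_all flip: eq\<close>)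
  then have "?f x = 0" if "0 < x" "x < b" for x using that by (simp add: res_def moment_def)
  then show ?thesis using b by (intro basis_combination_eq_0[of 0 b]) auto
qed

text \<open>
  The matrix that maps the two moments at \<open>b\<close> to the boundary values at \<open>b\<close> is invertible, again
  by the Wronskian.
\<close>
lemma res_at_b:
  "res g b = 0 \<and> dres g b = 0 \<longleftrightarrow> moment u1 g b = 0 \<and> moment u2 g b = 0"
proof
  assume *: "res g b = 0 \<and> dres g b = 0"
  note w' = wronskian_complex[OF b]
  have r: "res g b * complex_of_real w = complex_of_real (u1 b) * moment u2 g b - complex_of_real (u2 b) * moment u1 g b"
    "dres g b * complex_of_real w = complex_of_real (v1 b) * moment u2 g b - complex_of_real (v2 b) * moment u1 g b"
    using w by (simp_all add: res_def dres_def)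
  have "moment u1 g b * complex_of_real w = (res g b * complex_of_real w) * complex_of_real (v1 b) - (dres g b * complex_of_real w) * complex_of_real (u1 b)"
    unfolding r unfolding w'[symmetric] by (simp add: algebra_simps)
  moreover have "moment u2 g b * complex_of_real w = (res g b * complex_of_real w) * complex_of_real (v2 b) - (dres g b * complex_of_real w) * complex_of_real (u2 b)"
    unfolding r unfolding w'[symmetric] by (simp add: algebra_simps)
  ultimately show "moment u1 g b = 0 \<and> moment u2 g b = 0" using * w by simp
qed (simp add: res_def dres_def)

lemma vector_derivative_res_b:
  "sqint b g \<Longrightarrow> vector_derivative (res g) (at b within {0..b}) = dres g b"
  using vector_derivative_within_cbox[of 0 b b "res g" "dres g b"] res_has_vector_derivative[of g b] b
  by (auto simp: box_real)

text \<open>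
  With \<open>res_in_H2_tilde_0\<close> this identifies the space of functions vanishing to first order at \<open>0\<close> with
  the range of \<open>res\<close>.
\<close>
theorem H2_tilde_0_imp_res:
  assumes f: "f \<in> H2_tilde_0 b"
  obtains g where "sqint b g" "\<And>x. 0 \<le> x \<Longrightarrow> x \<le> b \<Longrightarrow> f x = res g x"
proof -
  obtain f' g M where J: "bessel_jet \<nu> b f f' g"
    "\<And>x. x \<in> {0..b} \<Longrightarrow> (f has_vector_derivative f' x) (at x within {0..b})" "continuous_on {0..b} f'"
    "\<And>x. 0 < x \<Longrightarrow> x \<le> b \<Longrightarrow> cmod (f x) \<le> M * x powr (3/2)"
    "\<And>x. 0 < x \<Longrightarrow> x \<le> b \<Longrightarrow> cmod (f' x) \<le> M * x powr (1/2)"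
    using H2_tilde_0_jet[OF f b, where \<nu> = \<nu>] by blast
  have eq: "f x = res g x" if "x \<in> {0<..<b}" for x
    using that b J by (intro jet_eq_res_of_growth(1)[OF J(1), of b M]) auto
  note g = bessel_jetD(2)[OF J(1)]
  have contf: "continuous_on {0..b} f"
    using has_vector_derivative_continuous[OF J(2)] by (simp add: continuous_on_eq_continuous_within)
  have "f x - res g x = 0" if "x \<in> {0..b}" for x
  proof (rule continuous_constant_on_closure[of "{0<..<b}" "\<lambda>x. f x - res g x"])
    show "continuous_on (closure {0<..<b}) (\<lambda>x. f x - res g x)"
      using b by (auto intro!: continuous_on_diff contf res_continuous g)
    show "x \<in> closure {0<..<b}" using that b by simp
  qed (use eq in simp)
  then show ?thesis using that[OF g] by simp
qed

theorem H2_0_imp_res: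
  assumes f: "f \<in> H2_0 b"
  obtains g where "sqint b g" "\<And>x. 0 \<le> x \<Longrightarrow> x \<le> b \<Longrightarrow> f x = res g x"
    "moment u1 g b = 0" "moment u2 g b = 0"
proof -
  have "f \<in> H2_tilde_0 b" and fb: "f b = 0" "vector_derivative f (at b within {0..b}) = 0"
    using f by (auto simp: H2_0_def H2_tilde_0_def)
  then obtain g where g: "sqint b g" and eq: "\<And>x. 0 \<le> x \<Longrightarrow> x \<le> b \<Longrightarrow> f x = res g x"
    using H2_tilde_0_imp_res by blast
  have "(f has_vector_derivative dres g b) (at b within {0..b})"
    by (rule has_vector_derivative_transform[OF _ _ res_has_vector_derivative[OF g]]) (use b eq in auto)
  then have "dres g b = 0"
    using vector_derivative_within_cbox[of 0 b b f "dres g b"] b fb(2) by (auto simp: box_real)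
  moreover have "res g b = 0" using eq[of b] fb b by simp
  ultimately show ?thesis using res_at_b[of g] that[OF g eq] by auto
qed

lemma res_in_H2_0:
  assumes g: "sqint b g" "moment u1 g b = 0" "moment u2 g b = 0"
  shows "res g \<in> H2_0 b"
  using res_in_H2_tilde_0[OF g(1)] res_at_b[of g] g vector_derivative_res_b[OF g(1)]
  by (simp add: H2_0_def H2_tilde_0_def)

text \<open>
  Near \<open>0\<close> the growth bounds hold with constant \<open>0\<close>; near \<open>b\<close> the function and its derivative vanish,
  hence so do the moments.
\<close>
lemma compact_support_imp_res:
  assumes P: "bessel_pair \<nu> b f g" and K: "compact K" "K \<subseteq> {0<..<b}" "\<And>x. x \<in> {0<..<b} - K \<Longrightarrow> f x = 0"
  shows "\<And>x. 0 < x \<Longrightarrow> x < b \<Longrightarrow> f x = res g x" "moment u1 g b = 0" "moment u2 g b = 0"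
proof -
  obtain f' where J: "bessel_jet \<nu> b f f' g" using P unfolding bessel_pair_iff_jet by blast
  note g = bessel_jetD(2)[OF J]
  obtain c d where cd: "0 < c" "c < d" "d < b" "K \<subseteq> {c..d}"
  proof (cases "K = {}")
    case True
    then show ?thesis using that[of "b/3" "b/2"] b by auto
  next
    case False
    then have "Inf K \<in> K" "Sup K \<in> K" "\<And>x. x \<in> K \<Longrightarrow> Inf K \<le> x \<and> x \<le> Sup K"
      using K(1) by (auto intro!: closed_contains_Inf closed_contains_Sup cInf_lower cSup_upper
          simp: compact_imp_closed bounded_imp_bdd_below bounded_imp_bdd_above compact_imp_bounded)
    moreover have "{Inf K / 2..(Sup K + b) / 2} \<supseteq> K" using calculation K(2) by fastforce
    ultimately show ?thesis using K(2) by (intro that[of "Inf K / 2" "(Sup K + b) / 2"]) (force simp: subset_iff)+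
  qed
  have zero: "f x = 0" "f' x = 0" if x: "0 < x" "x < b" "x < c \<or> d < x" for x
  proof -
    have o: "open ({0<..<c} \<union> {d<..<b})" by auto
    have z: "f y = 0" if "y \<in> {0<..<c} \<union> {d<..<b}" for y
    proof (rule K(3))
      have "y \<notin> K" using that cd(4) by force
      then show "y \<in> {0<..<b} - K" using that cd(1-3) by auto
    qed
    have xo: "x \<in> {0<..<c} \<union> {d<..<b}" using x by auto
    show "f x = 0" using z xo by blast
    have "((\<lambda>_. 0) has_vector_derivative f' x) (at x)"
      by (rule has_vector_derivative_transform_within_open[OF bessel_jetD(3)[OF J x(1,2)] o xo]) (use z in auto)
    then show "f' x = 0" using has_vector_derivative_const vector_derivative_unique_at by blast
  qed
  have eq: "f x = res g x" "f' x = dres g x" if "0 < x" "x < b" for x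
    using jet_eq_res_of_growth[OF J, of c 0 x] zero that cd by auto
  then show "\<And>x. 0 < x \<Longrightarrow> x < b \<Longrightarrow> f x = res g x" by blast
  have "res g b = 0 \<and> dres g b = 0"
  proof -
    have lim: "(h \<longlongrightarrow> h b) (at_left b)" "h b = 0" if h: "continuous_on {0..b} h" "\<And>x. d < x \<Longrightarrow> x < b \<Longrightarrow> h x = 0" for h :: "real \<Rightarrow> complex"
    proof -
      show l: "(h \<longlongrightarrow> h b) (at_left b)"
        using h(1) b by (simp add: continuous_on_Icc_at_leftD)
      have "\<forall>\<^sub>F x in at_left b. h x = 0"
        unfolding eventually_at_left_field using h(2) cd by (intro exI[of _ d]) auto
      then have "(h \<longlongrightarrow> 0) (at_left b)" by (rule tendsto_eventually)
      then show "h b = 0" using l tendsto_unique[of "at_left b"] by fastforce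
    qed
    show ?thesis
      using lim(2)[OF res_continuous(1)[OF g]] lim(2)[OF res_continuous(2)[OF g]] eq zero cd by (metis order.strict_trans)
  qed
  then show "moment u1 g b = 0" "moment u2 g b = 0" using res_at_b[of g] by auto
qed

text \<open>
  To the left of the support of \<open>g\<close> both moments are zero; to its right they are equal to the moments
  at \<open>b\<close>.
\<close>
lemma res_compact_support:
  assumes g: "sqint b g" "moment u1 g b = 0" "moment u2 g b = 0" and cd: "0 < c" "c < d" "d < b"
    and z: "\<And>x. 0 < x \<Longrightarrow> x < b \<Longrightarrow> x \<notin> {c..d} \<Longrightarrow> g x = 0" and x: "0 < x" "x < b" "x \<notin> {c..d}"
  shows "res g x = 0"
proof -
  have "moment u g x = 0" if s: "basis_sol u v" "moment u g b = 0" for u v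
  proof (cases "x < c")
    case True
    have "integral {0<..<x} (\<lambda>t. complex_of_real (u t) * g t) = integral {0<..<x} (\<lambda>t. 0)"
      by (intro integral_cong) (use z True x in auto)
    then show ?thesis by (simp add: moment_def integral_open_interval_real)
  next
    case False
    have "integral {x<..<b} (\<lambda>t. complex_of_real (u t) * g t) = integral {x<..<b} (\<lambda>t. 0)"
      by (intro integral_cong) (use z False x in auto)
    then have "integral {x..b} (\<lambda>t. complex_of_real (u t) * g t) = 0" by (simp add: integral_open_interval_real)
    moreover have "integral {0..x} (\<lambda>t. complex_of_real (u t) * g t) + integral {x..b} (\<lambda>t. complex_of_real (u t) * g t) = moment u g b"
      unfolding moment_def using x
      by (intro Henstock_Kurzweil_Integration.integral_combine moment_integrable[OF s(1) g(1)]) auto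
    ultimately show ?thesis using s(2) by (simp add: moment_def)
  qed
  from this[OF basis_sol12(1) g(2)] this[OF basis_sol12(2) g(3)] show ?thesis by (simp add: res_def)
qed

end

section \<open>The Hilbert space \<open>L\<^sup>2(0,b)\<close>\<close>

lemma toL2_not_sqint: "\<not> sqint b f \<Longrightarrow> toL2 b f = 0"
  by transfer (auto simp: l2_rel_def square_integrable_0)

lemma square_integrable_extend:
  assumes "sqint b f"
  shows "square_integrable lebesgue (\<lambda>x. if x \<in> {0<..<b} then f x else 0)"
proof -
  have "integrable lebesgue (\<lambda>x. if x \<in> {0<..<b} then (cmod (f x))\<^sup>2 else 0)"
    using assms unfolding square_integrable_def
    by (simp add: integrable_restrict_space indicator_def of_bool_def if_distrib if_distribR
        cong: if_cong)
  moreover have "(\<lambda>x. if x \<in> {0<..<b} then (cmod (f x))\<^sup>2 else 0) =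
      (\<lambda>x. (cmod (if x \<in> {0<..<b} then f x else 0))\<^sup>2)"
    by auto
  moreover have "(\<lambda>x. if x \<in> {0<..<b} then f x else 0) \<in> borel_measurable lebesgue"
    using assms by (subst borel_measurable_if) (auto simp: square_integrable_def)
  ultimately show ?thesis by (simp add: square_integrable_def)
qed

lemma toL2_eq_iff:
  assumes "sqint b f" "sqint b g"
  shows "toL2 b f = toL2 b g \<longleftrightarrow> (\<exists>N. negligible N \<and> (\<forall>x\<in>{0<..<b} - N. f x = g x))"
proof -
  have "toL2 b f = toL2 b g \<longleftrightarrow> (AE x in lebesgue. x \<in> {0<..<b} \<longrightarrow> f x = g x)"
    using assms square_integrable_extend[OF assms(1)] square_integrable_extend[OF assms(2)]
    by transfer (auto simp: l2_rel_def elim!: eventually_mono)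
  also have "\<dots> \<longleftrightarrow> (AE x in lebesgue_on {0<..<b}. f x = g x)"
    by (rule AE_restrict_space_iff[symmetric]) simp
  finally show ?thesis by (simp add: AE_lebesgue_on_Ioo_iff)
qed

lemma toL2_cong:
  assumes "sqint b f" "\<And>x. 0 < x \<Longrightarrow> x < b \<Longrightarrow> f x = g x"
  shows "toL2 b f = toL2 b g"
  using assms sqint_cong[OF assms] by (subst toL2_eq_iff) (auto intro!: exI[of _ "{}"])

lemma cinner_toL2:
  assumes "sqint b f" "sqint b g"
  shows "cinner (toL2 b f) (toL2 b g) = integral {0..b} (\<lambda>x. f x * cnj (g x))"
proof -
  have "cinner (toL2 b f) (toL2 b g) =
      integral\<^sup>L lebesgue (\<lambda>x. (if x \<in> {0<..<b} then f x else 0) * cnj (if x \<in> {0<..<b} then g x else 0))"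
    using assms by transfer simp
  also have "\<dots> = (LINT x:{0<..<b}|lebesgue. f x * cnj (g x))"
    unfolding set_lebesgue_integral_def by (intro Bochner_Integration.integral_cong) auto
  also have "\<dots> = integral {0<..<b} (\<lambda>x. f x * cnj (g x))"
    using sqint_mult_integrable[OF assms(1) sqint_cnj[OF assms(2)]]
    by (intro set_lebesgue_integral_eq_integral(2)) (simp add: absolutely_integrable_on_Icc_iff_Ioo)
  finally show ?thesis by (simp add: integral_open_interval_real)
qed

lemma toL2_add:
  assumes "sqint b f" "sqint b g"
  shows "toL2 b (\<lambda>x. f x + g x) = toL2 b f + toL2 b g"
  using assms square_integrable_add[OF assms]
proof transfer
  fix b f g assume *: "sqint b f" "sqint b g" "sqint b (\<lambda>x. f x + g x)"
  note ext = square_integrable_extend[OF *(1)] square_integrable_extend[OF *(2)]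
  have eq: "(\<lambda>x. if x \<in> {0<..<b} then f x + g x else 0) =
      (\<lambda>x. (if x \<in> {0<..<b} then f x else 0) + (if x \<in> {0<..<b} then g x else 0))" by auto
  show "l2_rel (if sqint b (\<lambda>x. f x + g x) then \<lambda>x. if x \<in> {0<..<b} then f x + g x else 0 else (\<lambda>_. 0))
      (\<lambda>x. (if sqint b f then \<lambda>x. if x \<in> {0<..<b} then f x else 0 else (\<lambda>_. 0)) x +
           (if sqint b g then \<lambda>x. if x \<in> {0<..<b} then g x else 0 else (\<lambda>_. 0)) x)"
    unfolding if_P[OF *(1)] if_P[OF *(2)] if_P[OF *(3)] eq l2_rel_def
    using square_integrable_add[OF ext] by (intro conjI AE_I2) simp_all
qed

lemma toL2_scaleC:
  assumes "sqint b f"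
  shows "toL2 b (\<lambda>x. c * f x) = c *\<^sub>C toL2 b f"
  using assms square_integrable_cmult[OF assms, of c]
proof transfer
  fix b f c assume *: "sqint b f" "sqint b (\<lambda>x. c * f x)"
  have eq: "(\<lambda>x. if x \<in> {0<..<b} then c * f x else 0) =
      (\<lambda>x. c * (if x \<in> {0<..<b} then f x else 0))" by auto
  show "l2_rel (if sqint b (\<lambda>x. c * f x) then \<lambda>x. if x \<in> {0<..<b} then c * f x else 0 else (\<lambda>_. 0))
      (\<lambda>x. c * (if sqint b f then \<lambda>x. if x \<in> {0<..<b} then f x else 0 else (\<lambda>_. 0)) x)"
    unfolding if_P[OF *(1)] if_P[OF *(2)] eq l2_rel_def
    using square_integrable_cmult[OF square_integrable_extend[OF *(1)], of c] by (intro conjI AE_I2) simp_all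
qed

lemma L2_intervalE:
  assumes "u \<in> L2_interval b"
  obtains f where "sqint b f" "u = toL2 b f"
proof -
  obtain f where "u = toL2 b f" using assms by (auto simp: L2_interval_def)
  moreover have "toL2 b (\<lambda>_. 0) = 0" by transfer (auto simp: l2_rel_def square_integrable_0)
  ultimately show ?thesis using that[of f] that[of "\<lambda>_. 0"] toL2_not_sqint[of b f]
    by (cases "sqint b f") (auto simp: square_integrable_0)
qed

lemma toL2_in: "toL2 b f \<in> L2_interval b" by (simp add: L2_interval_def)

lemma minus_l2: "u - v = u + (-1) *\<^sub>C (v::l2)"
  by (rule minus_l2_def[unfolded uminus_l2_def])

lemma toL2_diff:
  assumes "sqint b f" "sqint b g"
  shows "toL2 b (\<lambda>x. f x - g x) = toL2 b f - toL2 b g"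
proof -
  have "toL2 b (\<lambda>x. f x + (-1) * g x) = toL2 b f + (-1) *\<^sub>C toL2 b g"
    using toL2_add[OF assms(1) square_integrable_cmult[OF assms(2)]] toL2_scaleC[OF assms(2)] by metis
  then show ?thesis unfolding minus_l2 by simp
qed

lemma toL2_linear:
  assumes "sqint b f" "sqint b g"
  shows "toL2 b (\<lambda>x. p * f x + q * g x) = p *\<^sub>C toL2 b f + q *\<^sub>C toL2 b g"
  using assms by (simp add: toL2_add toL2_scaleC square_integrable_cmult)

lemma cinner_add_right: "cinner w (u + v) = cinner w u + cinner w v"
  by (metis cinner_add_left cinner_commute complex_cnj_add)

lemma cinner_scaleC_right: "cinner u (c *\<^sub>C v) = cnj c * cinner u v"
  by (metis cinner_commute cinner_scaleC_left complex_cnj_mult)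

lemma cinner_diff_left: "cinner (u - v) w = cinner u w - cinner v w"
  unfolding minus_l2 cinner_add_left cinner_scaleC_left by simp

lemma cinner_diff_right: "cinner w (u - v) = cinner w u - cinner w v"
  unfolding minus_l2 cinner_add_right cinner_scaleC_right by simp

lemma cinner_self_norm: "cinner u u = complex_of_real ((norm u)\<^sup>2)"
proof -
  have "Im (cinner u u) = 0" using arg_cong[OF cinner_commute[of u u], of Im] by simp
  moreover have "Re (cinner u u) = (norm u)\<^sup>2"
    by (simp add: power2_norm_eq_inner inner_l2_def)
  ultimately show ?thesis by (simp add: complex_eq_iff)
qed

lemma norm_scaleC: "norm (c *\<^sub>C u) = cmod c * norm (u::l2)"
proof -
  have "complex_of_real ((norm (c *\<^sub>C u))\<^sup>2) = complex_of_real ((cmod c * norm u)\<^sup>2)"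
    unfolding cinner_self_norm[symmetric] cinner_scaleC_left cinner_scaleC_right
    by (simp add: cinner_self_norm power_mult_distrib complex_norm_square[of c, unfolded of_real_power] mult.assoc[symmetric])
  then show ?thesis by (simp add: of_real_eq_iff del: of_real_power)
qed

lemma norm_cinner_le: "cmod (cinner u v) \<le> 2 * (norm u * norm v)"
proof -
  have "\<bar>Re (cinner u v)\<bar> \<le> norm u * norm v"
    using Cauchy_Schwarz_ineq2[of u v] by (simp add: inner_l2_def)
  moreover have "\<bar>Im (cinner u v)\<bar> \<le> norm u * norm v"
    using Cauchy_Schwarz_ineq2[of "\<i> *\<^sub>C u" v] by (simp add: inner_l2_def cinner_scaleC_left norm_scaleC)
  ultimately show ?thesis using cmod_le[of "cinner u v"] by linarith
qed

lemma tendsto_cinner_left: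
  assumes "(f \<longlongrightarrow> l) F"
  shows "((\<lambda>x. cinner (f x) v) \<longlongrightarrow> cinner l v) F"
proof -
  have "((\<lambda>x. norm (f x - l)) \<longlongrightarrow> 0) F" by (rule tendsto_norm_zero[OF LIM_zero[OF assms]])
  then have "((\<lambda>x. 2 * (norm (f x - l) * norm v)) \<longlongrightarrow> 2 * (0 * norm v)) F" by (intro tendsto_intros)
  then have "((\<lambda>x. 2 * (norm (f x - l) * norm v)) \<longlongrightarrow> 0) F" by simp
  then have "((\<lambda>x. cinner (f x - l) v) \<longlongrightarrow> 0) F"
    by (rule Lim_null_comparison[OF always_eventually, rotated]) (simp add: norm_cinner_le)
  then show ?thesis unfolding cinner_diff_left by (rule LIM_zero_cancel)
qed

lemma tendsto_scaleC_zero: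
  assumes "(c \<longlongrightarrow> 0) F"
  shows "((\<lambda>x. c x *\<^sub>C (v::l2)) \<longlongrightarrow> 0) F"
proof -
  have "((\<lambda>x. cmod (c x) * norm v) \<longlongrightarrow> 0 * norm v) F"
    using assms by (intro tendsto_mult tendsto_const tendsto_norm_zero)
  then have "((\<lambda>x. norm (c x *\<^sub>C v)) \<longlongrightarrow> 0) F" by (simp add: norm_scaleC)
  then show ?thesis by (rule tendsto_norm_zero_cancel)
qed

lemma norm_toL2: "sqint b f \<Longrightarrow> (norm (toL2 b f))\<^sup>2 = l2sq b f"
proof -
  assume f: "sqint b f"
  have "complex_of_real ((norm (toL2 b f))\<^sup>2) = integral {0..b} (\<lambda>x. complex_of_real ((cmod (f x))\<^sup>2))"
    unfolding cinner_self_norm[symmetric] cinner_toL2[OF f f] by (simp only: complex_norm_square)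
  also have "\<dots> = complex_of_real (l2sq b f)"
    unfolding l2sq_def
    by (intro integral_unique has_integral_of_real integrable_integral sqint_norm2_integrable[OF f]) auto
  finally show ?thesis by (simp only: of_real_eq_iff)
qed

text \<open>
  The projection is restriction to \<open>(0,b)\<close>. It is what makes \<open>L\<^sup>2(0,b)\<close> a closed subspace.
\<close>
lemma orthogonal_projection_L2_interval:
  obtains f where "sqint b f" "\<And>v. v \<in> L2_interval b \<Longrightarrow> cinner (u - toL2 b f) v = 0"
proof -
  have "\<exists>f. sqint b f \<and> (\<forall>h. sqint b h \<longrightarrow> cinner u (toL2 b h) = cinner (toL2 b f) (toL2 b h))"
  proof transfer
    fix b and u :: "real \<Rightarrow> complex" assume "l2_rel u u"
    then have u: "square_integrable lebesgue u" by (simp add: l2_rel_def)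
    have ub: "sqint b u"
    proof -
      have "integrable lebesgue (\<lambda>x. (cmod (u x))\<^sup>2)" using u by (simp add: square_integrable_def)
      then have "(\<lambda>x. (cmod (u x))\<^sup>2) absolutely_integrable_on {0..b}"
        unfolding set_integrable_def by (intro integrable_mult_indicator) auto
      then show ?thesis using u
        by (auto simp: square_integrable_def integrable_lebesgue_on_Ioo_iff intro: measurable_restrict_space1)
    qed
    show "\<exists>f. sqint b f \<and> (\<forall>h. sqint b h \<longrightarrow>
         integral\<^sup>L lebesgue (\<lambda>x. u x * cnj ((if sqint b h then \<lambda>x. if x \<in> {0<..<b} then h x else 0 else (\<lambda>_. 0)) x)) =
         integral\<^sup>L lebesgue (\<lambda>x. (if sqint b f then \<lambda>x. if x \<in> {0<..<b} then f x else 0 else (\<lambda>_. 0)) x *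
             cnj ((if sqint b h then \<lambda>x. if x \<in> {0<..<b} then h x else 0 else (\<lambda>_. 0)) x)))"
      using ub by (intro exI[of _ u]) (auto intro!: Bochner_Integration.integral_cong)
  qed
  then obtain f where f: "sqint b f" "\<And>h. sqint b h \<Longrightarrow> cinner u (toL2 b h) = cinner (toL2 b f) (toL2 b h)"
    by blast
  show ?thesis
  proof (rule that[OF f(1)])
    fix v assume "v \<in> L2_interval b"
    then obtain h where "sqint b h" "v = toL2 b h" by (rule L2_intervalE)
    then show "cinner (u - toL2 b f) v = 0" using f(2)[of h] by (simp add: cinner_diff_left)
  qed
qed

lemma closed_L2_interval:
  assumes "\<And>n. q n \<in> L2_interval b" "q \<longlonglongrightarrow> l"
  shows "l \<in> L2_interval b"
proof -
  obtain f where f: "sqint b f" "\<And>v. v \<in> L2_interval b \<Longrightarrow> cinner (l - toL2 b f) v = 0"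
    using orthogonal_projection_L2_interval by blast
  let ?d = "l - toL2 b f"
  have "(\<lambda>n. cinner (q n) ?d) \<longlonglongrightarrow> cinner l ?d" by (rule tendsto_cinner_left[OF assms(2)])
  moreover have "cinner (q n) ?d = 0" for n
    using f(2)[OF assms(1)[of n]] cinner_commute[of "q n" ?d] by simp
  ultimately have "cinner l ?d = 0" by (simp add: LIMSEQ_const_iff)
  moreover have "cinner (toL2 b f) ?d = 0"
    using f(2)[OF toL2_in[of b f]] cinner_commute[of "toL2 b f" ?d] by simp
  ultimately have "cinner ?d ?d = 0" by (simp add: cinner_diff_left)
  then have "l = toL2 b f" using cinner_self(2)[of ?d] by simp
  then show ?thesis by (simp add: toL2_in)
qed

lemma orthogonalize:
  fixes d p :: l2
  obtains \<alpha> where "cinner (d - \<alpha> *\<^sub>C p) p = 0"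
proof (cases "p = 0")
  case True
  have "cinner d 0 = 0" using cinner_scaleC_right[of d 0 0] by (simp add: cvec.scale_zero_left)
  then show ?thesis using that[of 0] True by simp
next
  case False
  then have "cinner p p \<noteq> 0" by (simp add: cinner_self)
  then show ?thesis using that[of "cinner d p / cinner p p"] by (simp add: cinner_diff_left cinner_scaleC_left)
qed

text \<open>
  Subtract from \<open>d\<close> its orthogonal projection to the span of \<open>p\<close> and \<open>q\<close>, found by Gram-Schmidt; the
  difference is orthogonal to \<open>p\<close> and \<open>q\<close>, hence to \<open>d\<close>, hence to itself.
\<close>
lemma in_span2_of_orthogonal:
  assumes H: "\<And>\<alpha> \<beta>. d - (\<alpha> *\<^sub>C p + \<beta> *\<^sub>C q) \<in> H"
    and d: "\<And>h. h \<in> H \<Longrightarrow> cinner h p = 0 \<Longrightarrow> cinner h q = 0 \<Longrightarrow> cinner h d = 0"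
  obtains \<alpha> \<beta> where "d = \<alpha> *\<^sub>C p + \<beta> *\<^sub>C q"
proof -
  obtain \<gamma> where g: "cinner (q - \<gamma> *\<^sub>C p) p = 0" using orthogonalize by blast
  let ?q = "q - \<gamma> *\<^sub>C p"
  obtain \<alpha> where a: "cinner (d - \<alpha> *\<^sub>C p) p = 0" using orthogonalize by blast
  obtain \<beta> where b: "cinner (d - \<beta> *\<^sub>C ?q) ?q = 0" using orthogonalize by blast
  let ?h = "d - (\<alpha> *\<^sub>C p + \<beta> *\<^sub>C ?q)"
  have h: "?h = d - ((\<alpha> - \<beta> * \<gamma>) *\<^sub>C p + \<beta> *\<^sub>C q)"
    by (simp add: cvec.scale_right_diff_distrib cvec.scale_left_diff_distrib)
  have g': "cinner p ?q = 0" using g cinner_commute[of p ?q] by simp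
  have hp: "cinner ?h p = 0" using a g by (simp add: cinner_diff_left cinner_add_left cinner_scaleC_left)
  have hq': "cinner ?h ?q = 0"
    using b g' by (simp add: cinner_diff_left[of d] cinner_add_left cinner_scaleC_left)
  have hq: "cinner ?h q = 0" using hq' hp by (simp add: cinner_diff_right cinner_scaleC_right)
  have "cinner ?h d = 0" using d[of ?h] H[of "\<alpha> - \<beta> * \<gamma>" \<beta>] hp hq unfolding h by blast
  then have "cinner ?h ?h = 0" using hp hq' by (simp only: cinner_diff_right[of ?h d] cinner_add_right cinner_scaleC_right mult_zero_right add_0_left diff_self)
  then have "d = (\<alpha> - \<beta> * \<gamma>) *\<^sub>C p + \<beta> *\<^sub>C q" using cinner_self(2)[of ?h] h by simp
  then show ?thesis by (rule that)
qed

lemma continuous_eq_0_of_ae: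
  fixes f :: "real \<Rightarrow> complex"
  assumes f: "continuous_on {c<..<d} f" and N: "negligible N" and z: "\<And>x. x \<in> {c<..<d} - N \<Longrightarrow> f x = 0"
    and x: "x \<in> {c<..<d}"
  shows "f x = 0"
proof (rule ccontr)
  assume "f x \<noteq> 0"
  define S where "S = {c<..<d} \<inter> f -` (- {0})"
  have "open S" unfolding S_def by (rule continuous_open_preimage[OF f]) auto
  moreover have "S \<noteq> {}" using x \<open>f x \<noteq> 0\<close> by (auto simp: S_def)
  moreover have "S \<subseteq> N" using z by (auto simp: S_def)
  ultimately show False using open_not_negligible negligible_subset[OF N] by blast
qed

section \<open>The graphs of the minimal and the maximal operator\<close>

context bessel_system
begin

abbreviation U1 :: l2 where "U1 \<equiv> toL2 b (\<lambda>x. complex_of_real (u1 x))"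
abbreviation U2 :: l2 where "U2 \<equiv> toL2 b (\<lambda>x. complex_of_real (u2 x))"

lemma moment_eq_cinner:
  assumes "basis_sol u v" "sqint b g"
  shows "moment u g b = cinner (toL2 b g) (toL2 b (\<lambda>x. complex_of_real (u x)))"
  unfolding moment_def cinner_toL2[OF assms(2) basis_sol_sqint[OF assms(1)]] by (simp add: mult.commute)

lemmas moment_cinner = moment_eq_cinner[OF basis_sol12(1)] moment_eq_cinner[OF basis_sol12(2)]
lemmas u_sqint = basis_sol_sqint[OF basis_sol12(1)] basis_sol_sqint[OF basis_sol12(2)]

text \<open>
  \<open>bessel_min_eq\<close> and \<open>bessel_max_eq\<close> identify these sets with the graphs of the minimal and the maximal
  operator.
\<close>
definition min_graph :: l2_op where
  "min_graph = {(toL2 b (res g), toL2 b g) | g. sqint b g \<and> moment u1 g b = 0 \<and> moment u2 g b = 0}"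

definition max_graph :: l2_op where
  "max_graph = {(\<alpha> *\<^sub>C U1 + \<beta> *\<^sub>C U2 + toL2 b (res g), toL2 b g) | \<alpha> \<beta> g. sqint b g}"

lemma toL2_combination:
  assumes "sqint b g"
  shows "toL2 b (\<lambda>x. comb \<alpha> \<beta> x + res g x)
    = \<alpha> *\<^sub>C U1 + \<beta> *\<^sub>C U2 + toL2 b (res g)"
  using toL2_add[OF bessel_jetD(1)[OF basis_combination_jet[of \<alpha> \<beta>]] res_sqint[OF assms]]
    toL2_linear[OF u_sqint, of \<alpha> \<beta>] by simp

lemma norm_res_le:
  assumes g: "sqint b g"
  shows "norm (toL2 b (res g)) \<le> res_bd * b\<^sup>2 * norm (toL2 b g)"
proof (rule power2_le_imp_le)
  have "l2sq b (res g) \<le> integral {0..b} (\<lambda>x. res_bd\<^sup>2 * l2sq b g * b ^ 3)"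
    unfolding l2sq_def
  proof (rule integral_le)
    fix x assume x: "x \<in> {0..b}"
    show "(cmod (res g x))\<^sup>2 \<le> res_bd\<^sup>2 * integral {0..b} (\<lambda>t. (cmod (g t))\<^sup>2) * b ^ 3"
    proof (cases "x = 0")
      case True
      then show ?thesis using l2sq_nonneg[of b g] b by (simp add: l2sq_def)
    next
      case False
      then have "(cmod (res g x))\<^sup>2 \<le> (res_bd * sqrt (l2sq b g) * x powr (3/2))\<^sup>2"
        using x by (intro power_mono res_bound_powr g) auto
      also have "\<dots> = res_bd\<^sup>2 * l2sq b g * (x powr (3/2))\<^sup>2"
        by (simp add: power_mult_distrib l2sq_nonneg)
      also have "(x powr (3/2))\<^sup>2 = x ^ 3"
        using x False by (simp add: power2_eq_square powr_add[symmetric] powr_numeral)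
      also have "res_bd\<^sup>2 * l2sq b g * x ^ 3 \<le> res_bd\<^sup>2 * l2sq b g * b ^ 3"
        using x by (intro mult_left_mono power_mono mult_nonneg_nonneg l2sq_nonneg) auto
      finally show ?thesis by (simp add: l2sq_def)
    qed
  qed (use sqint_norm2_integrable[OF res_sqint[OF g], of b] in auto)
  also have "\<dots> = (res_bd * b\<^sup>2)\<^sup>2 * l2sq b g" using b by (simp add: power2_eq_square power3_eq_cube)
  finally show "(norm (toL2 b (res g)))\<^sup>2 \<le> (res_bd * b\<^sup>2 * norm (toL2 b g))\<^sup>2"
    by (simp add: norm_toL2 g res_sqint power_mult_distrib)
  show "0 \<le> res_bd * b\<^sup>2 * norm (toL2 b g)" using res_bd_nonneg by simp
qed

lemma res_tendsto:
  assumes g: "\<And>n. sqint b (g n)" "sqint b h" and lim: "(\<lambda>n::nat. toL2 b (g n)) \<longlonglongrightarrow> toL2 b h"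
  shows "(\<lambda>n. toL2 b (res (g n))) \<longlonglongrightarrow> toL2 b (res h)"
proof -
  have le: "norm (toL2 b (res (g n)) - toL2 b (res h)) \<le> res_bd * b\<^sup>2 * norm (toL2 b (g n) - toL2 b h)" for n
  proof -
    have s: "sqint b (\<lambda>x. g n x - h x)" using g by (intro sqint_diff)
    have "toL2 b (res (g n)) - toL2 b (res h) = toL2 b (\<lambda>x. res (g n) x - res h x)"
      using g by (intro toL2_diff[symmetric] res_sqint)
    also have "\<dots> = toL2 b (res (\<lambda>x. g n x - h x))"
      using res_linear[OF g(1)[of n] g(2), of _ 1 "-1"]
      by (intro toL2_cong sqint_diff res_sqint g) auto
    finally show ?thesis using norm_res_le[OF s] toL2_diff[OF g(1)[of n] g(2)] by simp
  qed
  have "(\<lambda>n. norm (toL2 b (g n) - toL2 b h)) \<longlonglongrightarrow> 0" by (rule tendsto_norm_zero[OF LIM_zero[OF lim]])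
  then have "(\<lambda>n. res_bd * b\<^sup>2 * norm (toL2 b (g n) - toL2 b h)) \<longlonglongrightarrow> res_bd * b\<^sup>2 * 0" by (intro tendsto_intros)
  then have "(\<lambda>n. res_bd * b\<^sup>2 * norm (toL2 b (g n) - toL2 b h)) \<longlonglongrightarrow> 0" by simp
  then have "(\<lambda>n. toL2 b (res (g n)) - toL2 b (res h)) \<longlonglongrightarrow> 0"
    by (rule Lim_null_comparison[OF always_eventually, rotated]) (use le in simp)
  then show ?thesis by (rule LIM_zero_cancel)
qed

text \<open>
  \<open>res\<close> is bounded and the moments at \<open>b\<close> are inner products with \<open>u1\<close> and \<open>u2\<close>, so the description of
  the graph passes to limits.
\<close>
lemma closed_min_graph: "closed min_graph"
  unfolding closed_sequential_limits
proof (intro allI impI, elim conjE)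
  fix x l assume x: "\<forall>n. x n \<in> min_graph" and l: "x \<longlonglongrightarrow> l"
  obtain p q where pq: "l = (p, q)" by fastforce
  from x have "\<forall>n. \<exists>g. x n = (toL2 b (res g), toL2 b g) \<and> sqint b g \<and> moment u1 g b = 0 \<and> moment u2 g b = 0"
    unfolding min_graph_def by blast
  then obtain g where g: "\<And>n. x n = (toL2 b (res (g n)), toL2 b (g n))" "\<And>n. sqint b (g n)"
      "\<And>n. moment u1 (g n) b = 0" "\<And>n. moment u2 (g n) b = 0" by metis
  have lp: "(\<lambda>n. toL2 b (res (g n))) \<longlonglongrightarrow> p" and lq: "(\<lambda>n. toL2 b (g n)) \<longlonglongrightarrow> q"
    using tendsto_fst[OF l] tendsto_snd[OF l] by (simp_all add: g(1) pq)
  have "q \<in> L2_interval b" by (rule closed_L2_interval[OF toL2_in lq])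
  then obtain h where h: "sqint b h" "q = toL2 b h" by (rule L2_intervalE)
  have "p = toL2 b (res h)"
    using LIMSEQ_unique[OF lp res_tendsto[OF g(2) h(1)]] lq h(2) by simp
  moreover have "moment u1 h b = 0" "moment u2 h b = 0"
    using tendsto_cinner_left[OF lq, of U1] tendsto_cinner_left[OF lq, of U2] g h
    by (simp_all add: moment_cinner LIMSEQ_const_iff)
  ultimately show "l \<in> min_graph" using h pq unfolding min_graph_def by blast
qed

lemma toL2_on_subinterval_0:
  assumes cd: "0 \<le> c" "c < d" "d \<le> b"
    and z: "toL2 b (\<lambda>x. if x \<in> {c..d} then comb \<alpha> \<beta> x else 0) = 0"
    and s: "sqint b (\<lambda>x. if x \<in> {c..d} then comb \<alpha> \<beta> x else 0)"
  shows "\<alpha> = 0 \<and> \<beta> = 0"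
proof -
  have "toL2 b (\<lambda>_. 0) = 0" by transfer (auto simp: l2_rel_def square_integrable_0)
  then obtain N where N: "negligible N"
    "\<And>x. x \<in> {0<..<b} - N \<Longrightarrow> (if x \<in> {c..d} then comb \<alpha> \<beta> x else 0) = 0"
    using z toL2_eq_iff[OF s square_integrable_0] by metis
  have cont: "continuous_on {c<..<d} (\<lambda>x. comb \<alpha> \<beta> x)"
    using cd by (intro continuous_intros basis_sol_continuous[OF basis_sol12(1)] basis_sol_continuous[OF basis_sol12(2)]) auto
  have "comb \<alpha> \<beta> x = 0" if "c < x" "x < d" for x
  proof (rule continuous_eq_0_of_ae[OF cont N(1)])
    fix y assume y: "y \<in> {c<..<d} - N"
    then show "comb \<alpha> \<beta> y = 0"
      using N(2)[of y] cd by auto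
  qed (use that in auto)
  then show ?thesis using basis_combination_eq_0[OF cd(1,2)] by blast
qed

lemma sqint_restrict:
  assumes f: "sqint b f"
  shows "sqint b (\<lambda>x. if x \<in> {c..d} then f x else 0)"
proof (rule sqint_bound)
  have "(\<lambda>x. if x \<in> {c..d} then f x else 0) = (\<lambda>x. indicator {c..d} x *\<^sub>R f x)" by auto
  moreover have "indicator {c..d} \<in> borel_measurable (lebesgue_on {0<..<b})"
    by (intro measurable_restrict_space1 borel_measurable_indicator) auto
  then have "(\<lambda>x. indicator {c..d} x *\<^sub>R f x) \<in> borel_measurable (lebesgue_on {0<..<b})"
    by (intro borel_measurable_scaleR sqint_imp_measurable[OF f])
  ultimately show "(\<lambda>x. if x \<in> {c..d} then f x else 0) \<in> borel_measurable (lebesgue_on {0<..<b})" by simp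
  show "(\<lambda>x. (cmod (f x))\<^sup>2) integrable_on {0..b}" by (rule sqint_norm2_integrable[OF f order_refl])
qed auto

lemma cinner_restrict:
  assumes "sqint b f" "sqint b h"
  shows "cinner (toL2 b (\<lambda>x. if x \<in> {c..d} then f x else 0)) (toL2 b h) =
    cinner (toL2 b (\<lambda>x. if x \<in> {c..d} then f x else 0)) (toL2 b (\<lambda>x. if x \<in> {c..d} then h x else 0))"
  unfolding cinner_toL2[OF sqint_restrict[OF assms(1)] assms(2)]
    cinner_toL2[OF sqint_restrict[OF assms(1)] sqint_restrict[OF assms(2)]]
  by (intro integral_cong) auto

text \<open>
  Dominated convergence, with majorant \<open>|g|\<^sup>2\<close>.
\<close>
lemma truncation_tendsto:
  assumes g: "sqint b g" and c: "c \<longlonglongrightarrow> 0" and d: "d \<longlonglongrightarrow> b"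
  shows "(\<lambda>n::nat. toL2 b (\<lambda>x. if x \<in> {c n..d n} then g x else 0)) \<longlonglongrightarrow> toL2 b g"
proof -
  let ?r = "\<lambda>n x. g x - (if x \<in> {c n..d n} then g x else 0)"
  have s: "sqint b (?r n)" for n by (intro sqint_diff g sqint_restrict)
  have "(\<lambda>n. integral {0<..<b} (\<lambda>x. (cmod (?r n x))\<^sup>2)) \<longlonglongrightarrow> integral {0<..<b} (\<lambda>x. 0)"
  proof (rule dominated_convergence(2)[where h = "\<lambda>x. (cmod (g x))\<^sup>2"])
    show "(\<lambda>x. (cmod (?r n x))\<^sup>2) integrable_on {0<..<b}" for n
      using sqint_norm2_integrable[OF s order_refl] by (simp add: integrable_on_Icc_iff_Ioo)
    show "(\<lambda>x. (cmod (g x))\<^sup>2) integrable_on {0<..<b}"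
      using sqint_norm2_integrable[OF g order_refl] by (simp add: integrable_on_Icc_iff_Ioo)
    show "(\<lambda>n. (cmod (?r n x))\<^sup>2) \<longlonglongrightarrow> 0" if x: "x \<in> {0<..<b}" for x
    proof (rule tendsto_eventually)
      have "\<forall>\<^sub>F n in sequentially. c n < x" "\<forall>\<^sub>F n in sequentially. x < d n"
        using order_tendstoD(2)[OF c, of x] order_tendstoD(1)[OF d, of x] x by auto
      then show "\<forall>\<^sub>F n in sequentially. (cmod (?r n x))\<^sup>2 = 0" by eventually_elim simp
    qed
  qed auto
  then have "(\<lambda>n. (norm (toL2 b (?r n)))\<^sup>2) \<longlonglongrightarrow> 0"
    unfolding norm_toL2[OF s] l2sq_def integral_open_interval_real by simp
  then have "(\<lambda>n. sqrt ((norm (toL2 b (?r n)))\<^sup>2)) \<longlonglongrightarrow> sqrt 0" by (rule tendsto_real_sqrt)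
  then have "(\<lambda>n. norm (toL2 b (?r n))) \<longlonglongrightarrow> 0" by simp
  then have "(\<lambda>n. toL2 b (?r n)) \<longlonglongrightarrow> 0" by (rule tendsto_norm_zero_cancel)
  then have "(\<lambda>n. toL2 b g - toL2 b (\<lambda>x. if x \<in> {c n..d n} then g x else 0)) \<longlonglongrightarrow> 0"
    unfolding toL2_diff[OF g sqint_restrict[OF g]] .
  then have "(\<lambda>n. toL2 b g - (toL2 b g - toL2 b (\<lambda>x. if x \<in> {c n..d n} then g x else 0))) \<longlonglongrightarrow> toL2 b g - 0"
    by (intro tendsto_diff tendsto_const)
  then show ?thesis by simp
qed

definition pre_min :: l2_op where
  "pre_min = {(toL2 b f, toL2 b g) | f g. bessel_pair \<nu> b f g \<and>
     (\<exists>K. compact K \<and> K \<subseteq> {0<..<b} \<and> (\<forall>x \<in> {0<..<b} - K. f x = 0))}"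

lemma pre_min_subset: "pre_min \<subseteq> min_graph"
proof
  fix p assume "p \<in> pre_min"
  then obtain f g K where p: "p = (toL2 b f, toL2 b g)" "bessel_pair \<nu> b f g"
    "compact K" "K \<subseteq> {0<..<b}" "\<And>x. x \<in> {0<..<b} - K \<Longrightarrow> f x = 0"
    unfolding pre_min_def by blast
  note c = compact_support_imp_res[OF p(2-5)]
  have "sqint b f" "sqint b g" using p(2) by (auto simp: bessel_pair_def)
  then show "p \<in> min_graph" unfolding min_graph_def p(1) using c toL2_cong[of b f "res g"] by auto
qed

text \<open>
  Let \<open>g\<close> have vanishing moments. Its truncations \<open>G n\<close> to compact intervals converge to \<open>g\<close>, but
  their moments are only close to \<open>0\<close>. They are corrected by small multiples of two fixed functions,
  \<open>u1\<close> and \<open>u2 - \<gamma> u1\<close> cut off to the middle third of the interval, with \<open>\<gamma>\<close> chosen so that the two are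
  orthogonal. The corrected functions \<open>h n\<close> have compact support and vanishing moments, hence so has
  \<open>res (h n)\<close> compact support.
\<close>
lemma min_graph_subset_closure: "min_graph \<subseteq> closure pre_min"
proof
  fix p assume "p \<in> min_graph"
  then obtain g where p: "p = (toL2 b (res g), toL2 b g)" and g: "sqint b g" "moment u1 g b = 0" "moment u2 g b = 0"
    unfolding min_graph_def by blast
  define c where "c = (\<lambda>n::nat. b / (real n + 3))"
  have c: "0 < c n" "c n < b - c n" "b - c n < b" "c n \<le> b/3" for n
    using b by (auto simp: c_def field_simps intro: add_pos_nonneg)
  have "c \<longlonglongrightarrow> 0" unfolding c_def by real_asymp
  define cut where "cut = (\<lambda>(f::real \<Rightarrow> complex) x. if x \<in> {b/3..b - b/3} then f x else 0)"
  have cut_sq: "sqint b (cut f)" if "sqint b f" for f unfolding cut_def by (rule sqint_restrict[OF that])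
  let ?w1 = "\<lambda>x. complex_of_real (u1 x)" and ?w2 = "\<lambda>x. complex_of_real (u2 x)"
  define p1 p2 where "p1 = toL2 b (cut ?w1)" and "p2 = toL2 b (cut ?w2)"
  obtain \<gamma> where gam: "cinner (p2 - \<gamma> *\<^sub>C p1) p1 = 0" using orthogonalize by blast
  \<comment> \<open>\<open>p1\<close> and \<open>e2\<close> are orthogonal, and both are non-zero because \<open>u1, u2\<close> are independent on the middle third\<close>
  define e2 where "e2 = p2 - \<gamma> *\<^sub>C p1"
  have comb: "toL2 b (cut (\<lambda>x. \<alpha> * ?w1 x + \<beta> * ?w2 x)) = \<alpha> *\<^sub>C p1 + \<beta> *\<^sub>C p2" for \<alpha> \<beta>
  proof -
    have "cut (\<lambda>x. \<alpha> * ?w1 x + \<beta> * ?w2 x) = (\<lambda>x. \<alpha> * cut ?w1 x + \<beta> * cut ?w2 x)" by (auto simp: cut_def)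
    then show ?thesis using toL2_linear[OF cut_sq[OF u_sqint(1)] cut_sq[OF u_sqint(2)]] by (simp add: p1_def p2_def)
  qed
  have comb_sq: "sqint b (\<lambda>x. \<alpha> * ?w1 x + \<beta> * ?w2 x)" for \<alpha> \<beta> by (rule bessel_jetD(1)[OF basis_combination_jet])
  have nz: "\<alpha> = 0 \<and> \<beta> = 0" if "\<alpha> *\<^sub>C p1 + \<beta> *\<^sub>C p2 = 0" for \<alpha> \<beta>
    using toL2_on_subinterval_0[of "b/3" "b - b/3" \<alpha> \<beta>] that comb[of \<alpha> \<beta>] cut_sq[OF comb_sq[of \<alpha> \<beta>]] b
    by (simp add: cut_def)
  have "p1 \<noteq> 0" using nz[of 1 0] by auto
  then have n1: "cinner p1 p1 \<noteq> 0" by (simp add: cinner_self)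
  have "e2 \<noteq> 0" using nz[of "-\<gamma>" 1] by (auto simp: e2_def)
  then have n2: "cinner e2 e2 \<noteq> 0" by (simp add: cinner_self)
  have e2p1: "cinner e2 p1 = 0" using gam by (simp add: e2_def)
  then have p1e2: "cinner p1 e2 = 0" using cinner_commute[of p1 e2] by simp
  have e2_eq: "e2 = toL2 b (cut (\<lambda>x. (-\<gamma>) * ?w1 x + 1 * ?w2 x))"
    unfolding comb by (simp add: e2_def)
  have cutU: "cinner (toL2 b (cut f)) U1 = cinner (toL2 b (cut f)) p1" "cinner (toL2 b (cut f)) U2 = cinner (toL2 b (cut f)) p2"
    if "sqint b f" for f
    unfolding cut_def p1_def p2_def
    by (rule cinner_restrict[OF that u_sqint(1)], rule cinner_restrict[OF that u_sqint(2)])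
  \<comment> \<open>vanishing moments are the same as orthogonality to \<open>U1\<close> and \<open>V2\<close>, which form a system biorthogonal to \<open>p1, e2\<close> up to factors\<close>
  define V2 where "V2 = U2 - \<gamma> *\<^sub>C U1"
  have pU: "cinner p1 U1 = cinner p1 p1" "cinner p1 V2 = 0" "cinner e2 U1 = 0" "cinner e2 V2 = cinner e2 e2"
  proof -
    show "cinner p1 U1 = cinner p1 p1" using cutU(1)[OF u_sqint(1)] by (simp add: p1_def)
    have "cinner p1 V2 = cinner p1 e2"
      using cutU[OF u_sqint(1)] by (simp add: p1_def[symmetric] V2_def e2_def cinner_diff_right cinner_scaleC_right)
    then show "cinner p1 V2 = 0" using p1e2 by simp
    have *: "cinner e2 U1 = cinner e2 p1" "cinner e2 U2 = cinner e2 p2"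
      unfolding e2_eq by (rule cutU[OF comb_sq])+
    then show "cinner e2 U1 = 0" using e2p1 by simp
    have "cinner e2 V2 = cinner e2 U2 - cnj \<gamma> * cinner e2 U1" by (simp add: V2_def cinner_diff_right cinner_scaleC_right)
    also have "\<dots> = cinner e2 (p2 - \<gamma> *\<^sub>C p1)" unfolding * cinner_diff_right cinner_scaleC_right ..
    finally show "cinner e2 V2 = cinner e2 e2" by (simp only: e2_def[symmetric])
  qed
  define G where "G = (\<lambda>n x. if x \<in> {c n..b - c n} then g x else 0)"
  have Gs: "sqint b (G n)" for n unfolding G_def by (rule sqint_restrict[OF g(1)])
  have "(\<lambda>n. b - c n) \<longlonglongrightarrow> b - 0" by (intro tendsto_diff tendsto_const \<open>c \<longlonglongrightarrow> 0\<close>)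
  then have Glim: "(\<lambda>n. toL2 b (G n)) \<longlonglongrightarrow> toL2 b g"
    unfolding G_def by (intro truncation_tendsto g(1) \<open>c \<longlonglongrightarrow> 0\<close>) simp
  \<comment> \<open>the multiples of \<open>p1\<close> and \<open>e2\<close> that restore the moments; they tend to \<open>0\<close> with the moments of \<open>G n\<close>\<close>
  define \<kappa> \<eta> where "\<kappa> = (\<lambda>n. cinner (toL2 b (G n)) U1 / cinner p1 p1)" and "\<eta> = (\<lambda>n. cinner (toL2 b (G n)) V2 / cinner e2 e2)"
  have g0: "cinner (toL2 b g) U1 = 0" "cinner (toL2 b g) V2 = 0"
    using g moment_cinner[OF g(1)] by (simp_all add: V2_def cinner_diff_right cinner_scaleC_right)
  have klim: "\<kappa> \<longlonglongrightarrow> 0" "\<eta> \<longlonglongrightarrow> 0"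
    unfolding \<kappa>_def \<eta>_def
    using tendsto_divide_zero[OF tendsto_cinner_left[OF Glim, of U1, unfolded g0]]
      tendsto_divide_zero[OF tendsto_cinner_left[OF Glim, of V2, unfolded g0]] by auto
  define h where "h = (\<lambda>n x. G n x - cut (\<lambda>x. (\<kappa> n - \<eta> n * \<gamma>) * ?w1 x + \<eta> n * ?w2 x) x)"
  have hs: "sqint b (h n)" for n unfolding h_def by (intro sqint_diff Gs cut_sq comb_sq)
  have hL: "toL2 b (h n) = toL2 b (G n) - (\<kappa> n *\<^sub>C p1 + \<eta> n *\<^sub>C e2)" for n
    unfolding h_def toL2_diff[OF Gs cut_sq[OF comb_sq]] comb e2_def
    by (simp add: cvec.scale_right_diff_distrib cvec.scale_left_diff_distrib)
  have hlim: "(\<lambda>n. toL2 b (h n)) \<longlonglongrightarrow> toL2 b g"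
  proof -
    have "(\<lambda>n. toL2 b (G n) - (\<kappa> n *\<^sub>C p1 + \<eta> n *\<^sub>C e2)) \<longlonglongrightarrow> toL2 b g - (0 + 0)"
      by (intro tendsto_diff tendsto_add tendsto_scaleC_zero Glim klim)
    then show ?thesis by (simp add: hL)
  qed
  have hm: "moment u1 (h n) b = 0" "moment u2 (h n) b = 0" for n
  proof -
    have a: "cinner (toL2 b (h n)) U1 = 0"
      unfolding hL using n1 by (simp add: cinner_diff_left cinner_add_left cinner_scaleC_left pU \<kappa>_def)
    have "cinner (toL2 b (h n)) V2 = 0"
      unfolding hL using n2 by (simp add: cinner_diff_left[of "toL2 b (G n)"] cinner_add_left cinner_scaleC_left pU \<eta>_def)
    then have "cinner (toL2 b (h n)) U2 = 0" using a by (simp add: V2_def cinner_diff_right cinner_scaleC_right)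
    then show "moment u1 (h n) b = 0" "moment u2 (h n) b = 0" using a by (simp_all add: moment_cinner hs)
  qed
  have hz: "h n x = 0" if "0 < x" "x < b" "x \<notin> {c n..b - c n}" for n x
    using that c(4)[of n] by (auto simp: h_def G_def cut_def)
  have "(toL2 b (res (h n)), toL2 b (h n)) \<in> pre_min" for n
  proof -
    have "res (h n) x = 0" if "x \<in> {0<..<b} - {c n..b - c n}" for x
      by (rule res_compact_support[OF hs hm c(1) c(2) c(3) hz]) (use that in auto)
    moreover have "{c n..b - c n} \<subseteq> {0<..<b}" using c(1)[of n] by auto
    ultimately show ?thesis unfolding pre_min_def
      using res_bessel_pair[OF hs] by (blast intro: compact_Icc)
  qed
  moreover have "(\<lambda>n. (toL2 b (res (h n)), toL2 b (h n))) \<longlonglongrightarrow> p"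
    unfolding p by (intro tendsto_Pair hlim res_tendsto hs g)
  ultimately show "p \<in> closure pre_min"
    unfolding closure_sequential by (intro exI[of _ "\<lambda>n. (toL2 b (res (h n)), toL2 b (h n))"] conjI allI)
qed

theorem bessel_min_eq: "bessel_min \<nu> b = min_graph"
proof -
  have "bessel_min \<nu> b = closure pre_min" by (simp add: bessel_min_def pre_min_def)
  then show ?thesis
    using min_graph_subset_closure closure_minimal[OF pre_min_subset closed_min_graph] by auto
qed

theorem bessel_max_eq: "bessel_max \<nu> b = max_graph"
proof
  show "bessel_max \<nu> b \<subseteq> max_graph"
  proof
    fix p assume "p \<in> bessel_max \<nu> b"
    then obtain f f' g where p: "p = (toL2 b f, toL2 b g)" and J: "bessel_jet \<nu> b f f' g"
      unfolding bessel_max_def bessel_pair_iff_jet by blast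
    obtain \<alpha> \<beta> where "\<And>x. 0 < x \<Longrightarrow> x < b \<Longrightarrow>
      f x = comb \<alpha> \<beta> x + res g x"
      using jet_decomposition[OF J] by blast
    then have "toL2 b f = \<alpha> *\<^sub>C U1 + \<beta> *\<^sub>C U2 + toL2 b (res g)"
      unfolding toL2_combination[OF bessel_jetD(2)[OF J], symmetric]
      by (intro toL2_cong bessel_jetD(1)[OF J]) auto
    then show "p \<in> max_graph" unfolding p max_graph_def using bessel_jetD(2)[OF J] by blast
  qed
  show "max_graph \<subseteq> bessel_max \<nu> b"
  proof
    fix p assume "p \<in> max_graph"
    then obtain \<alpha> \<beta> g where p: "p = (\<alpha> *\<^sub>C U1 + \<beta> *\<^sub>C U2 + toL2 b (res g), toL2 b g)" and g: "sqint b g"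
      unfolding max_graph_def by blast
    have "bessel_pair \<nu> b (\<lambda>x. comb \<alpha> \<beta> x + res g x) (\<lambda>x. 0 + g x)"
      by (intro bessel_pair_add res_bessel_pair g) (use basis_combination_jet bessel_pair_iff_jet in blast)
    then show "p \<in> bessel_max \<nu> b"
      unfolding bessel_max_def p toL2_combination[OF g, symmetric] by auto
  qed
qed

text \<open>
  Integrate the derivative of the Wronskian of \<open>res h\<close> and the conjugate of \<open>res g\<close> over \<open>[0,b]\<close>. It
  vanishes at \<open>0\<close> because both factors do, and at \<open>b\<close> because \<open>res h\<close> and its derivative do.
\<close>
lemma green_res:
  assumes h: "sqint b h" "moment u1 h b = 0" "moment u2 h b = 0" and g: "sqint b g"
  shows "cinner (toL2 b h) (toL2 b (res g)) = cinner (toL2 b (res h)) (toL2 b g)"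
proof -
  note A = res_ac_deriv_0[OF h(1)] and B = res_ac_deriv_0[OF g, THEN ac_deriv_cnj]
  let ?W = "\<lambda>x. res h x * cnj (dres g x) - dres h x * cnj (res g x)"
  have "ac_deriv 0 b ?W (\<lambda>x. h x * cnj (res g x) - res h x * cnj (g x))"
    by (rule ac_deriv_cong[OF ac_deriv_diff[OF ac_deriv_mult[OF A(1) B(2)] ac_deriv_mult[OF A(2) B(1)]]])
      (auto simp: algebra_simps)
  from ac_deriv_has_integral[OF this less_imp_le[OF b]]
  have "((\<lambda>x. h x * cnj (res g x) - res h x * cnj (g x)) has_integral 0) {0..b}"
    using res_at_b[of h] h by simp
  moreover have "((\<lambda>x. h x * cnj (res g x) - res h x * cnj (g x)) has_integral
      (cinner (toL2 b h) (toL2 b (res g)) - cinner (toL2 b (res h)) (toL2 b g))) {0..b}"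
    unfolding cinner_toL2[OF h(1) res_sqint[OF g]] cinner_toL2[OF res_sqint[OF h(1)] g]
    by (intro has_integral_diff integrable_integral absolutely_integrable_imp_integrable_on
        sqint_mult_integrable sqint_cnj res_sqint g h)
  ultimately have "0 = cinner (toL2 b h) (toL2 b (res g)) - cinner (toL2 b (res h)) (toL2 b g)"
    by (rule has_integral_unique)
  then show ?thesis by simp
qed

text \<open>
  One inclusion is Green's identity. For the other let \<open>(w,z)\<close> be in the adjoint and \<open>z\<close> the class of
  \<open>g\<close>. By Green's identity \<open>w - res g\<close> is orthogonal to every \<open>h\<close> that is orthogonal to \<open>u1\<close> and \<open>u2\<close>,
  so it is a combination of \<open>u1\<close> and \<open>u2\<close>.
\<close>
theorem adjoint_min_graph: "adjoint_op (L2_interval b) min_graph = max_graph"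
proof
  show "max_graph \<subseteq> adjoint_op (L2_interval b) min_graph"
  proof
    fix p assume "p \<in> max_graph"
    then obtain \<alpha> \<beta> g where p: "p = (\<alpha> *\<^sub>C U1 + \<beta> *\<^sub>C U2 + toL2 b (res g), toL2 b g)" and g: "sqint b g"
      unfolding max_graph_def by blast
    have "\<alpha> *\<^sub>C U1 + \<beta> *\<^sub>C U2 + toL2 b (res g) \<in> L2_interval b"
      unfolding toL2_combination[OF g, symmetric] by (rule toL2_in)
    moreover have "cinner (toL2 b h) (\<alpha> *\<^sub>C U1 + \<beta> *\<^sub>C U2 + toL2 b (res g)) = cinner (toL2 b (res h)) (toL2 b g)"
      if h: "sqint b h" "moment u1 h b = 0" "moment u2 h b = 0" for h
      using green_res[OF h g] h moment_cinner[OF h(1)] by (simp add: cinner_add_right cinner_scaleC_right)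
    ultimately show "p \<in> adjoint_op (L2_interval b) min_graph"
      unfolding adjoint_op_def p min_graph_def using toL2_in by auto
  qed
  show "adjoint_op (L2_interval b) min_graph \<subseteq> max_graph"
  proof
    fix p assume p: "p \<in> adjoint_op (L2_interval b) min_graph"
    obtain w z where wz: "p = (w, z)" by fastforce
    have wH: "w \<in> L2_interval b" and zH: "z \<in> L2_interval b"
      and ad: "\<And>h. sqint b h \<Longrightarrow> moment u1 h b = 0 \<Longrightarrow> moment u2 h b = 0 \<Longrightarrow>
          cinner (toL2 b h) w = cinner (toL2 b (res h)) z"
      using p unfolding wz adjoint_op_def min_graph_def by blast+
    obtain f where f: "sqint b f" "w = toL2 b f" using wH by (rule L2_intervalE)
    obtain g where g: "sqint b g" "z = toL2 b g" using zH by (rule L2_intervalE)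
    \<comment> \<open>subtracting a solution of \<open>\<tau> y = z\<close> reduces to the case \<open>z = 0\<close>\<close>
    let ?d = "w - toL2 b (res g)"
    obtain \<alpha> \<beta> where "?d = \<alpha> *\<^sub>C U1 + \<beta> *\<^sub>C U2"
    proof (rule in_span2_of_orthogonal[of ?d U1 U2 "L2_interval b"])
      fix \<alpha> \<beta>
      have "?d - (\<alpha> *\<^sub>C U1 + \<beta> *\<^sub>C U2) = toL2 b (\<lambda>x. (f x - res g x) - (comb \<alpha> \<beta> x))"
        using f g by (simp add: toL2_diff toL2_linear u_sqint res_sqint sqint_diff bessel_jetD(1)[OF basis_combination_jet])
      then show "?d - (\<alpha> *\<^sub>C U1 + \<beta> *\<^sub>C U2) \<in> L2_interval b" by (simp add: toL2_in)
    next
      fix q assume q: "q \<in> L2_interval b" "cinner q U1 = 0" "cinner q U2 = 0"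
      obtain h where h: "sqint b h" "q = toL2 b h" using q(1) by (rule L2_intervalE)
      have m: "moment u1 h b = 0" "moment u2 h b = 0" using q h moment_cinner[OF h(1)] by auto
      show "cinner q ?d = 0"
        using ad[OF h(1) m] green_res[OF h(1) m g(1)] by (simp add: cinner_diff_right h g)
    qed
    then have "w = \<alpha> *\<^sub>C U1 + \<beta> *\<^sub>C U2 + toL2 b (res g)" by (simp add: algebra_simps)
    then show "p \<in> max_graph" unfolding wz max_graph_def g(2) using g(1) by blast
  qed
qed

theorem Domain_min_graph: "Domain min_graph = toL2 b ` H2_0 b"
proof
  show "Domain min_graph \<subseteq> toL2 b ` H2_0 b"
    unfolding min_graph_def using res_in_H2_0 by blast
  show "toL2 b ` H2_0 b \<subseteq> Domain min_graph"
  proof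
    fix u assume "u \<in> toL2 b ` H2_0 b"
    then obtain f where f: "f \<in> H2_0 b" "u = toL2 b f" by blast
    obtain g where g: "sqint b g" "\<And>x. 0 \<le> x \<Longrightarrow> x \<le> b \<Longrightarrow> f x = res g x"
      "moment u1 g b = 0" "moment u2 g b = 0" using H2_0_imp_res[OF f(1)] by blast
    have "toL2 b (res g) = toL2 b f" using g by (intro toL2_cong res_sqint) auto
    then show "u \<in> Domain min_graph" unfolding min_graph_def f(2) using g by force
  qed
qed

lemma H2_tilde_0_image: "toL2 b ` H2_tilde_0 b = {toL2 b (res g) | g. sqint b g}"
proof
  show "{toL2 b (res g) | g. sqint b g} \<subseteq> toL2 b ` H2_tilde_0 b"
    using res_in_H2_tilde_0 by blast
  show "toL2 b ` H2_tilde_0 b \<subseteq> {toL2 b (res g) | g. sqint b g}"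
  proof
    fix u assume "u \<in> toL2 b ` H2_tilde_0 b"
    then obtain f where f: "f \<in> H2_tilde_0 b" "u = toL2 b f" by blast
    obtain g where g: "sqint b g" "\<And>x. 0 \<le> x \<Longrightarrow> x \<le> b \<Longrightarrow> f x = res g x"
      using H2_tilde_0_imp_res[OF f(1)] by blast
    have "toL2 b (res g) = toL2 b f" using g by (intro toL2_cong res_sqint) auto
    then show "u \<in> {toL2 b (res g) | g. sqint b g}" using f g by force
  qed
qed

lemma span_U: "cvec.span {U1, U2} = {\<alpha> *\<^sub>C U1 + \<beta> *\<^sub>C U2 | \<alpha> \<beta>. True}"
proof -
  have "x \<in> cvec.span {U1, U2} \<longleftrightarrow> (\<exists>\<alpha> \<beta>. x = \<alpha> *\<^sub>C U1 + \<beta> *\<^sub>C U2)" for x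
  proof -
    have "x \<in> cvec.span {U1, U2} \<longleftrightarrow> (\<exists>\<alpha> \<beta>. x - \<alpha> *\<^sub>C U1 = \<beta> *\<^sub>C U2)"
      unfolding cvec.span_insert[of U1 "{U2}"] cvec.span_singleton by auto
    then show ?thesis by (simp only: diff_eq_eq add.commute)
  qed
  then show ?thesis by auto
qed

text \<open>
  The sum is the definition of the graph; it is direct since a combination of \<open>u1\<close> and \<open>u2\<close> of the
  form \<open>res g\<close> is zero.
\<close>
theorem direct_sum_Domain_max_graph:
  "direct_sum_decomp (Domain max_graph) (toL2 b ` H2_tilde_0 b) (cvec.span {U1, U2})"
  unfolding direct_sum_decomp_def
proof (intro conjI)
  show "cvec.subspace (cvec.span {U1, U2})" by (rule cvec.subspace_span)
  show sub: "cvec.subspace (toL2 b ` H2_tilde_0 b)"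
    unfolding H2_tilde_0_image cvec.subspace_def
  proof (intro conjI ballI allI)
    have "toL2 b (res (\<lambda>_. 0)) = 0"
      using norm_res_le[OF square_integrable_0] norm_toL2[OF square_integrable_0, of b]
      by (simp add: l2sq_def)
    then show "0 \<in> {toL2 b (res g) | g. sqint b g}" using square_integrable_0 by (metis (mono_tags, lifting) CollectI)
    have lin: "p *\<^sub>C toL2 b (res f) + q *\<^sub>C toL2 b (res g) \<in> {toL2 b (res g) | g. sqint b g}"
      if "sqint b f" "sqint b g" for f g p q
    proof -
      have s: "sqint b (\<lambda>x. p * f x + q * g x)" using that by (intro square_integrable_add square_integrable_cmult)
      have "p *\<^sub>C toL2 b (res f) + q *\<^sub>C toL2 b (res g) = toL2 b (\<lambda>x. p * res f x + q * res g x)"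
        using that by (intro toL2_linear[symmetric] res_sqint)
      also have "\<dots> = toL2 b (res (\<lambda>x. p * f x + q * g x))"
        using that res_linear[OF that] by (intro toL2_cong square_integrable_add square_integrable_cmult res_sqint) auto
      finally show ?thesis using s by blast
    qed
    show "x + y \<in> {toL2 b (res g) | g. sqint b g}" if "x \<in> {toL2 b (res g) | g. sqint b g}" "y \<in> {toL2 b (res g) | g. sqint b g}" for x y
      using that lin[of _ _ 1 1] by auto
    show "c *\<^sub>C x \<in> {toL2 b (res g) | g. sqint b g}" if "x \<in> {toL2 b (res g) | g. sqint b g}" for x c
      using that lin[of _ _ c 0] by auto
  qed
  show "toL2 b ` H2_tilde_0 b \<inter> cvec.span {U1, U2} = {0}"
  proof
    show "{0} \<subseteq> toL2 b ` H2_tilde_0 b \<inter> cvec.span {U1, U2}"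
      using cvec.subspace_0[OF sub] cvec.span_zero by simp
    show "toL2 b ` H2_tilde_0 b \<inter> cvec.span {U1, U2} \<subseteq> {0}"
    proof
      fix u assume "u \<in> toL2 b ` H2_tilde_0 b \<inter> cvec.span {U1, U2}"
      then obtain g \<alpha> \<beta> where g: "sqint b g" "u = toL2 b (res g)" and u: "u = \<alpha> *\<^sub>C U1 + \<beta> *\<^sub>C U2"
        unfolding H2_tilde_0_image span_U by blast
      let ?c = "\<lambda>x. comb \<alpha> \<beta> x"
      have cs: "sqint b ?c" by (rule bessel_jetD(1)[OF basis_combination_jet])
      have "toL2 b (res g) = toL2 b ?c" using g u toL2_linear[OF u_sqint] by simp
      then obtain N where N: "negligible N" "\<And>x. x \<in> {0<..<b} - N \<Longrightarrow> res g x = ?c x"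
        using toL2_eq_iff[OF res_sqint[OF g(1)] cs] by blast
      have cont: "continuous_on {0<..<b} (\<lambda>x. res g x - ?c x)"
        by (intro continuous_on_diff bessel_jetD(6)[OF basis_combination_jet] continuous_on_subset[OF res_continuous(1)[OF g(1)]]) auto
      have "res g x - ?c x = 0" if "0 < x" "x < b" for x
        by (rule continuous_eq_0_of_ae[OF cont N(1)]) (use N(2) that in auto)
      then have "\<alpha> = 0 \<and> \<beta> = 0" using res_eq_combination_imp_0[OF g(1), of \<alpha> \<beta>] by simp
      then show "u \<in> {0}" using u by simp
    qed
  qed
  show "Domain max_graph = {v + w |v w. v \<in> toL2 b ` H2_tilde_0 b \<and> w \<in> cvec.span {U1, U2}}"
    unfolding H2_tilde_0_image span_U max_graph_def
    by (auto simp: Domain_iff) (metis add.commute)+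
qed

section \<open>Non-negativity and deficiency indices\<close>

text \<open>
  Let \<open>f = res g\<close>, \<open>s = 1/2 + \<nu>\<close> and \<open>D = f' - (s/x) f\<close>; the function \<open>s/x\<close> is the logarithmic derivative
  of the positive solution \<open>x\<^sup>s\<close>. Then \<open>(D cnj f)' = |D|\<^sup>2 - g cnj f\<close>, because \<open>s\<^sup>2 - s = \<nu>\<^sup>2 - 1/4\<close>. The
  boundary terms at \<open>0\<close> and \<open>b\<close> vanish, and \<open>\<integral> g cnj f = \<integral> |D|\<^sup>2 \<ge> 0\<close>.
\<close>
theorem nonneg_min_graph: "nonneg_op min_graph"
  unfolding nonneg_op_def
proof clarify
  fix u v assume "(u, v) \<in> min_graph"
  then obtain g where uv: "u = toL2 b (res g)" "v = toL2 b g" and g: "sqint b g" "moment u1 g b = 0" "moment u2 g b = 0"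
    unfolding min_graph_def by blast
  define s where "s = 1/2 + \<nu>"
  have s2: "s * s - s = \<nu>\<^sup>2 - 1/4" by (simp add: s_def power2_eq_square algebra_simps)
  let ?f = "res g" and ?f' = "dres g"
  let ?a = "\<lambda>x. complex_of_real (s / x)"
  define D where "D = (\<lambda>x. ?f' x - ?a x * ?f x)"
  define I where "I = (\<lambda>c. integral {0..c} (\<lambda>x. g x * cnj (?f x)))"
  have gf: "(\<lambda>x. g x * cnj (?f x)) absolutely_integrable_on {0..b}"
    by (intro sqint_mult_integrable sqint_cnj res_sqint g)
  have fb: "?f b = 0" using res_at_b[of g] g by simp
  have pos: "I b - I c - D c * cnj (?f c) \<in> \<real>\<^sub>\<ge>\<^sub>0" if c: "0 < c" "c < b" for c
  proof -
    note A = res_ac_deriv[OF g(1) c(1)]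
    have a: "ac_deriv c b ?a (\<lambda>x. complex_of_real (- s / x\<^sup>2))"
    proof (rule ac_deriv_C1)
      show "(?a has_vector_derivative complex_of_real (- s / x\<^sup>2)) (at x within {c..b})" if "x \<in> {c..b}" for x
        using that c by (intro has_vector_derivative_complex_of_real)
          (auto intro!: derivative_eq_intros simp: power2_eq_square)
    qed (use c in \<open>auto intro!: continuous_intros\<close>)
    have "ac_deriv c b (\<lambda>x. D x * cnj (?f x)) (\<lambda>x. D x * cnj (D x) - g x * cnj (?f x))"
      unfolding D_def
    proof (rule ac_deriv_cong[OF ac_deriv_mult[OF ac_deriv_diff[OF A(2) ac_deriv_mult[OF a A(1)]] ac_deriv_cnj[OF A(1)]]])
      fix x assume x: "x \<in> {c<..<b}"
      then have "x \<noteq> 0" using c by auto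
      have pot: "pot \<nu> x = (s * s - s) / x\<^sup>2" by (simp add: pot_def s2)
      \<comment> \<open>the Riccati equation \<open>a\<^sup>2 + a' = (\<nu>\<^sup>2 - 1/4) / x\<^sup>2\<close>\<close>
      have e: "complex_of_real (pot \<nu> x) = ?a x * ?a x + complex_of_real (- s / x\<^sup>2)"
        unfolding pot of_real_mult[symmetric] of_real_add[symmetric]
        by (rule arg_cong[where f = complex_of_real]) (use \<open>x \<noteq> 0\<close> in \<open>simp add: field_simps power2_eq_square\<close>)
      show "(?f' x - ?a x * ?f x) * cnj (?f' x) +
        (complex_of_real (pot \<nu> x) * ?f x - g x - (?a x * ?f' x + complex_of_real (- s / x\<^sup>2) * ?f x)) * cnj (?f x) =
        (?f' x - ?a x * ?f x) * cnj (?f' x - ?a x * ?f x) - g x * cnj (?f x)"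
        unfolding e complex_cnj_diff complex_cnj_mult complex_cnj_complex_of_real by (simp only: ring_distribs) (simp add: algebra_simps)
    qed simp
    from ac_deriv_has_integral[OF this less_imp_le[OF c(2)]]
    have h1: "((\<lambda>x. D x * cnj (D x) - g x * cnj (?f x)) has_integral - (D c * cnj (?f c))) {c..b}"
      using fb by simp
    have gi: "(\<lambda>x. g x * cnj (?f x)) integrable_on {0..b}" by (rule absolutely_integrable_imp_integrable_on[OF gf])
    have h2: "((\<lambda>x. g x * cnj (?f x)) has_integral (I b - I c)) {c..b}"
    proof -
      have "(\<lambda>x. g x * cnj (?f x)) integrable_on {c..b}" using gi by (rule integrable_on_subinterval) (use c in auto)
      moreover have "I c + integral {c..b} (\<lambda>x. g x * cnj (?f x)) = I b"
        unfolding I_def using c by (intro Henstock_Kurzweil_Integration.integral_combine gi) auto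
      ultimately show ?thesis by (metis add_diff_cancel_left' integrable_integral)
    qed
    have h3: "((\<lambda>x. D x * cnj (D x)) has_integral (I b - I c - D c * cnj (?f c))) {c..b}"
      using has_integral_add[OF h1 h2] by (simp add: algebra_simps)
    have "0 \<le> Re (I b - I c - D c * cnj (?f c))"
      by (rule has_integral_nonneg[OF has_integral_Re[OF h3]]) simp
    moreover have "Im (I b - I c - D c * cnj (?f c)) = 0"
    proof -
      have "((\<lambda>x. Im (D x * cnj (D x))) has_integral Im (I b - I c - D c * cnj (?f c))) {c..b}" by (rule has_integral_Im[OF h3])
      then have "((\<lambda>x. 0::real) has_integral Im (I b - I c - D c * cnj (?f c))) {c..b}"
        by (simp add: mult.commute)
      then show ?thesis by simp
    qed
    ultimately show ?thesis by (simp add: complex_nonneg_Reals_iff)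
  qed
  have lim0: "((\<lambda>c. D c * cnj (?f c)) \<longlongrightarrow> 0) (at_right 0)"
  proof -
    define M where "M = res_bd * sqrt (l2sq b g)"
    have M: "M \<ge> 0" using res_bd_nonneg l2sq_nonneg by (simp add: M_def)
    have ev: "\<forall>\<^sub>F c in at_right 0. norm (D c * cnj (?f c)) \<le> ((1 + \<bar>s\<bar>) * M * M) * c powr 2"
      unfolding eventually_at_right_field
    proof (intro exI[of _ b] conjI allI impI b)
      fix c assume c: "0 < c" "c < b"
      note B = res_bound_powr[OF g(1), of c, folded M_def]
      have "cmod (D c) \<le> cmod (?f' c) + \<bar>s\<bar> / c * cmod (?f c)"
        unfolding D_def using c by (intro order_trans[OF norm_triangle_ineq4]) (simp add: norm_mult norm_divide)
      also have "\<dots> \<le> M * c powr (1/2) + \<bar>s\<bar> / c * (M * c powr (3/2))"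
        using B c by (intro add_mono mult_left_mono) auto
      also have "c powr (3/2) = c * c powr (1/2)"
        using c powr_add[of c 1 "1/2"] by simp
      finally have "cmod (D c) \<le> (1 + \<bar>s\<bar>) * M * c powr (1/2)" using c by (simp add: algebra_simps)
      then have "cmod (D c) * cmod (?f c) \<le> ((1 + \<bar>s\<bar>) * M * c powr (1/2)) * (M * c powr (3/2))"
        using B c M by (intro mult_mono) auto
      also have "\<dots> = ((1 + \<bar>s\<bar>) * M * M) * (c powr (1/2) * c powr (3/2))" by (simp only: mult_ac)
      also have "c powr (1/2) * c powr (3/2) = c powr 2" unfolding powr_add[symmetric] by simp
      finally show "norm (D c * cnj (?f c)) \<le> ((1 + \<bar>s\<bar>) * M * M) * c powr 2" by (simp add: norm_mult)
    qed
    have "((\<lambda>c. c powr 2) \<longlongrightarrow> 0 powr 2) (at_right (0::real))"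
      by (intro tendsto_powr' tendsto_const tendsto_ident_at) (auto simp: eventually_at_filter)
    then have "((\<lambda>c. ((1 + \<bar>s\<bar>) * M * M) * c powr 2) \<longlongrightarrow> ((1 + \<bar>s\<bar>) * M * M) * 0) (at_right 0)"
      by (intro tendsto_mult tendsto_const) simp
    then have "((\<lambda>c. ((1 + \<bar>s\<bar>) * M * M) * c powr 2) \<longlongrightarrow> 0) (at_right 0)" by simp
    then show ?thesis by (rule Lim_null_comparison[OF ev])
  qed
  have "continuous_on {0..b} I"
    unfolding I_def[abs_def] by (rule ac_derivD[OF ac_deriv_indefinite_integral[OF gf]])
  then have "(I \<longlongrightarrow> I 0) (at_right 0)"
    using b continuous_on_Icc_at_rightD by blast
  then have limI: "(I \<longlongrightarrow> 0) (at_right 0)" by (simp add: I_def)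
  have lim: "((\<lambda>c. I b - I c - D c * cnj (?f c)) \<longlongrightarrow> I b - 0 - 0) (at_right 0)"
    by (intro tendsto_diff tendsto_const limI lim0)
  have "I b - 0 - 0 \<in> \<real>\<^sub>\<ge>\<^sub>0"
    by (rule Lim_in_closed_set[OF closed_nonneg_Reals_complex _ _ lim])
      (use b pos in \<open>auto simp: eventually_at_right_field intro!: exI[of _ b]\<close>)
  then show "cinner v u \<in> \<real>\<^sub>\<ge>\<^sub>0"
    unfolding uv cinner_toL2[OF g(1) res_sqint[OF g(1)]] by (simp add: I_def)
qed

text \<open>
  Each application of \<open>res\<close> raises the order of vanishing at \<open>0\<close> by \<open>2\<close> and gains a factor of order
  \<open>1/(s + 1)\<close>: \<open>res\<close> is a Volterra operator.
\<close>
lemma res_iteration_bound: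
  assumes v: "sqint b v" and A: "A \<ge> 0" and s: "s \<ge> 0"
    and le: "\<And>t. 0 < t \<Longrightarrow> t < b \<Longrightarrow> cmod (v t) \<le> A * t powr (1/2 - \<mu> + 2 * s)"
    and x: "0 < x" "x < b"
  shows "cmod (res v x) \<le> A * (C / \<bar>w\<bar> / (2 - 2 * \<mu>)) / (s + 1) * x powr (1/2 - \<mu> + 2 * (s + 1))"
proof -
  have hi: "((\<lambda>t. A * t powr (1 - 2 * \<mu> + 2 * s)) has_integral (A * (x powr (2 - 2 * \<mu> + 2 * s) / (2 - 2 * \<mu> + 2 * s)))) {0..x}"
    using has_integral_mult_right[OF has_integral_powr_from_0[of "1 - 2 * \<mu> + 2 * s" x], of A] mu s x
    by (simp add: algebra_simps)
  have "wint \<mu> v x = integral {0<..<x} (\<lambda>t. t powr (1/2 - \<mu>) * cmod (v t))"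
    by (simp add: wint_def integral_open_interval_real)
  also have "\<dots> \<le> integral {0<..<x} (\<lambda>t. A * t powr (1 - 2 * \<mu> + 2 * s))"
  proof (rule integral_le)
    show "(\<lambda>t. t powr (1/2 - \<mu>) * cmod (v t)) integrable_on {0<..<x}"
      using wint_integrable[OF v mu(2) less_imp_le[OF x(2)] b] by (simp add: integrable_on_Icc_iff_Ioo)
    show "(\<lambda>t. A * t powr (1 - 2 * \<mu> + 2 * s)) integrable_on {0<..<x}"
      using hi by (auto simp: integrable_on_Icc_iff_Ioo[symmetric])
    fix t assume t: "t \<in> {0<..<x}"
    have "t powr (1/2 - \<mu>) * cmod (v t) \<le> t powr (1/2 - \<mu>) * (A * t powr (1/2 - \<mu> + 2 * s))"
      using t x by (intro mult_left_mono le) auto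
    also have "\<dots> = A * (t powr (1/2 - \<mu>) * t powr (1/2 - \<mu> + 2 * s))" by (simp only: mult_ac)
    also have "t powr (1/2 - \<mu>) * t powr (1/2 - \<mu> + 2 * s) = t powr (1 - 2 * \<mu> + 2 * s)"
      unfolding powr_add[symmetric] by (simp add: algebra_simps)
    finally show "t powr (1/2 - \<mu>) * cmod (v t) \<le> A * t powr (1 - 2 * \<mu> + 2 * s)" .
  qed
  also have "\<dots> = A * (x powr (2 - 2 * \<mu> + 2 * s) / (2 - 2 * \<mu> + 2 * s))"
    using integral_unique[OF hi] by (simp add: integral_open_interval_real)
  also have "\<dots> \<le> A * (x powr (2 - 2 * \<mu> + 2 * s) / ((2 - 2 * \<mu>) * (s + 1)))"
  proof -
    have "(2 - 2 * \<mu>) * (s + 1) \<le> 2 - 2 * \<mu> + 2 * s" using mu s by (simp add: algebra_simps)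
    then show ?thesis using A mu s by (intro mult_left_mono divide_left_mono) auto
  qed
  finally have W: "wint \<mu> v x \<le> A * (x powr (2 - 2 * \<mu> + 2 * s) / ((2 - 2 * \<mu>) * (s + 1)))" .
  have "cmod (res v x) \<le> C / \<bar>w\<bar> * x powr (1/2 + \<mu>) * wint \<mu> v x" using res_bound(1)[OF v] x by simp
  also have "\<dots> \<le> C / \<bar>w\<bar> * x powr (1/2 + \<mu>) * (A * (x powr (2 - 2 * \<mu> + 2 * s) / ((2 - 2 * \<mu>) * (s + 1))))"
    using C_nonneg by (intro mult_left_mono W) auto
  also have "\<dots> = A * (C / \<bar>w\<bar> / (2 - 2 * \<mu>)) / (s + 1) * (x powr (1/2 + \<mu>) * x powr (2 - 2 * \<mu> + 2 * s))"
    using mu by (simp add: field_simps)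
  also have "x powr (1/2 + \<mu>) * x powr (2 - 2 * \<mu> + 2 * s) = x powr (1/2 - \<mu> + 2 * (s + 1))"
    unfolding powr_add[symmetric] by (simp add: algebra_simps)
  finally show ?thesis .
qed

text \<open>
  The factor that each iteration of \<open>res\<close> contributes, apart from the decay.
\<close>
definition \<kappa> :: real where "\<kappa> = C / \<bar>w\<bar> / (2 - 2 * \<mu>)"

lemma kappa_nonneg: "\<kappa> \<ge> 0" using C_nonneg mu by (simp add: \<kappa>_def)

lemma power_over_fact_sums: "(\<lambda>n. q ^ n / fact n :: real) sums exp q"
  using exp_converges[of q] by (simp add: scaleR_conv_of_real divide_inverse mult.commute)

text \<open>
  The gains multiply to \<open>1/n!\<close>. This factorial decay gives both existence and uniqueness of solutions
  of \<open>f = p + z res f\<close>, whatever the complex number \<open>z\<close>.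
\<close>
lemma neumann_iterates_bound:
  fixes T :: "nat \<Rightarrow> real \<Rightarrow> complex"
  assumes T: "\<And>n. sqint b (T n)" and M: "M \<ge> 0"
    and T0: "\<And>t. 0 < t \<Longrightarrow> t < b \<Longrightarrow> cmod (T 0 t) \<le> M * t powr (1/2 - \<mu>)"
    and Suc: "\<And>n t. 0 < t \<Longrightarrow> t < b \<Longrightarrow> T (Suc n) t = res (\<lambda>t. z * T n t) t"
    and x: "0 < x" "x < b"
  shows "cmod (T n x) \<le> M * x powr (1/2 - \<mu>) * ((cmod z * \<kappa> * b\<^sup>2) ^ n / fact n)"
proof -
  have *: "cmod (T n t) \<le> M * (cmod z * \<kappa>) ^ n / fact n * t powr (1/2 - \<mu> + 2 * real n)"
    if "0 < t" "t < b" for n t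
    using that
  proof (induction n arbitrary: t)
    case 0
    then show ?case using T0 by simp
  next
    case (Suc n)
    have "cmod (res (\<lambda>t. z * T n t) t) \<le> (cmod z * (M * (cmod z * \<kappa>) ^ n / fact n)) * (C / \<bar>w\<bar> / (2 - 2 * \<mu>)) / (real n + 1) * t powr (1/2 - \<mu> + 2 * (real n + 1))"
    proof (rule res_iteration_bound)
      show "sqint b (\<lambda>t. z * T n t)" by (intro square_integrable_cmult T)
      show "cmod (z * T n t) \<le> cmod z * (M * (cmod z * \<kappa>) ^ n / fact n) * t powr (1/2 - \<mu> + 2 * real n)"
        if "0 < t" "t < b" for t
        using mult_left_mono[OF Suc.IH[OF that], of "cmod z"] by (simp add: norm_mult mult.assoc)
    qed (use Suc.prems M kappa_nonneg in auto)
    also have "\<dots> = M * (cmod z * \<kappa>) ^ Suc n / fact (Suc n) * t powr (1/2 - \<mu> + 2 * real (Suc n))"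
      by (simp add: \<kappa>_def field_simps)
    finally show ?case using assms(4) Suc.prems by simp
  qed
  have "cmod (T n x) \<le> M * (cmod z * \<kappa>) ^ n / fact n * x powr (1/2 - \<mu> + 2 * real n)" by (rule *[OF x])
  also have "\<dots> = M * (cmod z * \<kappa>) ^ n / fact n * (x powr (1/2 - \<mu>) * (x\<^sup>2) ^ n)"
    using x powr_realpow[of x "2 * n"] by (simp add: powr_add power_mult)
  also have "\<dots> \<le> M * (cmod z * \<kappa>) ^ n / fact n * (x powr (1/2 - \<mu>) * (b\<^sup>2) ^ n)"
    using x M kappa_nonneg by (intro mult_left_mono power_mono) auto
  also have "\<dots> = M * x powr (1/2 - \<mu>) * ((cmod z * \<kappa> * b\<^sup>2) ^ n / fact n)"
    by (simp add: power_mult_distrib field_simps)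
  finally show ?thesis .
qed

text \<open>
  A solution of the homogeneous equation is its own Neumann iterate of every order.
\<close>
lemma volterra_unique:
  assumes f: "sqint b f" and eq: "\<And>x. 0 < x \<Longrightarrow> x < b \<Longrightarrow> f x = res (\<lambda>t. z * f t) x" and x: "0 < x" "x < b"
  shows "f x = 0"
proof -
  have zf: "sqint b (\<lambda>t. z * f t)" by (rule square_integrable_cmult[OF f])
  \<comment> \<open>being in the range of \<open>res\<close>, \<open>f\<close> satisfies the bound that starts the iteration\<close>
  define M where "M = res_bd * sqrt (l2sq b (\<lambda>t. z * f t)) * b powr (1 + \<mu>)"
  have M: "M \<ge> 0" using res_bd_nonneg l2sq_nonneg by (simp add: M_def)
  have f0: "cmod (f t) \<le> M * t powr (1/2 - \<mu>)" if t: "0 < t" "t < b" for t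
  proof -
    have "cmod (f t) \<le> res_bd * sqrt (l2sq b (\<lambda>t. z * f t)) * t powr (3/2)"
      unfolding eq[OF t] using t by (intro res_bound_powr zf) auto
    also have "t powr (3/2) = t powr (1 + \<mu>) * t powr (1/2 - \<mu>)" unfolding powr_add[symmetric] by simp
    also have "\<dots> \<le> b powr (1 + \<mu>) * t powr (1/2 - \<mu>)" using t mu by (intro mult_right_mono powr_mono2) auto
    finally show ?thesis
      using res_bd_nonneg l2sq_nonneg by (simp add: M_def mult_left_mono mult.assoc)
  qed
  have "cmod (f x) \<le> M * x powr (1/2 - \<mu>) * ((cmod z * \<kappa> * b\<^sup>2) ^ n / fact n)" for n
    using neumann_iterates_bound[of "\<lambda>_. f", OF f M f0 eq x] .
  moreover have "(\<lambda>n. M * x powr (1/2 - \<mu>) * ((cmod z * \<kappa> * b\<^sup>2) ^ n / fact n)) \<longlonglongrightarrow> M * x powr (1/2 - \<mu>) * 0"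
    by (intro tendsto_mult tendsto_const summable_LIMSEQ_zero sums_summable[OF power_over_fact_sums])
  ultimately have "cmod (f x) \<le> M * x powr (1/2 - \<mu>) * 0" by (intro LIMSEQ_le_const) auto
  then show ?thesis by simp
qed

text \<open>
  Picard iteration \<open>S (n + 1) = p + res (z S n)\<close> with \<open>S 0 = 0\<close>. The increments \<open>T n\<close> obey
  \<open>neumann_iterates_bound\<close>, so the iterates converge pointwise under a common majorant, and the limit
  passes through the integrals in \<open>res\<close>.
\<close>
lemma volterra_solution:
  assumes p: "sqint b p" and M: "M \<ge> 0" and pM: "\<And>t. 0 < t \<Longrightarrow> t < b \<Longrightarrow> cmod (p t) \<le> M * t powr (1/2 - \<mu>)"
  obtains f where "sqint b f" "\<And>x. 0 < x \<Longrightarrow> x < b \<Longrightarrow> f x = p x + res (\<lambda>t. z * f t) x"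
proof -
  define S where "S = rec_nat (\<lambda>_. 0) (\<lambda>_ h x. p x + res (\<lambda>t. z * h t) x)"
  have S0: "S 0 = (\<lambda>_. 0)" and SS: "S (Suc n) = (\<lambda>x. p x + res (\<lambda>t. z * S n t) x)" for n by (simp_all add: S_def)
  have Ssq: "sqint b (S n)" for n
    by (induction n) (auto simp: S0 SS square_integrable_0 intro!: square_integrable_add p res_sqint square_integrable_cmult)
  define T where "T = (\<lambda>n x. S (Suc n) x - S n x)"
  have Tsq: "sqint b (T n)" for n unfolding T_def by (intro sqint_diff Ssq)
  have T0: "cmod (T 0 t) \<le> M * t powr (1/2 - \<mu>)" if "0 < t" "t < b" for t
    using pM[OF that] by (simp add: T_def SS S0 res_def moment_def)
  have TS: "T (Suc n) t = res (\<lambda>t. z * T n t) t" if "0 < t" "t < b" for n t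
    using res_linear[OF Ssq[of "Suc n"] Ssq[of n], of t z "- z"] that
      res_linear[OF Ssq[of "Suc n"] square_integrable_0, of t z 0] res_linear[OF Ssq[of "n"] square_integrable_0, of t z 0]
    by (simp add: T_def SS[of "Suc n"] SS[of n] algebra_simps)
  define q where "q = cmod z * \<kappa> * b\<^sup>2"
  have q: "q \<ge> 0" using kappa_nonneg by (simp add: q_def)
  have TB: "cmod (T n x) \<le> M * x powr (1/2 - \<mu>) * (q ^ n / fact n)" if "0 < x" "x < b" for n x
    unfolding q_def by (rule neumann_iterates_bound[OF Tsq M T0 TS that])
  have Ssum: "S n x = (\<Sum>k<n. T k x)" for n x
    using sum_lessThan_telescope[of "\<lambda>k. S k x" n] by (simp add: T_def S0)
  define E where "E = exp q"
  have exps: "(\<lambda>n. q ^ n / fact n) sums E"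
    unfolding E_def by (rule power_over_fact_sums)
  have sm: "summable (\<lambda>k. T k x)" if x: "0 < x" "x < b" for x
    by (rule summable_comparison_test'[OF summable_mult[OF sums_summable[OF exps]] TB[OF x]])
  have SB: "cmod (S n x) \<le> M * E * x powr (1/2 - \<mu>)" if x: "0 < x" "x < b" for n x
  proof -
    have "cmod (S n x) \<le> (\<Sum>k<n. M * x powr (1/2 - \<mu>) * (q ^ k / fact k))"
      unfolding Ssum using TB[OF x] by (intro order_trans[OF norm_sum] sum_mono) auto
    also have "\<dots> = M * x powr (1/2 - \<mu>) * (\<Sum>k<n. q ^ k / fact k)" by (simp only: sum_distrib_left)
    also have "\<dots> \<le> M * x powr (1/2 - \<mu>) * E"
      using exps q M sum_le_suminf[of "\<lambda>n. q ^ n / fact n" "{..<n}"]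
      by (intro mult_left_mono) (auto simp: sums_iff)
    finally show ?thesis by (simp only: mult_ac)
  qed
  define f where "f = (\<lambda>x. \<Sum>k. T k x)"
  have lim: "(\<lambda>n. S n x) \<longlonglongrightarrow> f x" if "0 < x" "x < b" for x
    unfolding Ssum f_def using summable_LIMSEQ[OF sm[OF that]] .
  have fB: "cmod (f x) \<le> M * E * x powr (1/2 - \<mu>)" if "0 < x" "x < b" for x
    using tendsto_norm[OF lim[OF that]] SB[OF that] by (intro LIMSEQ_le_const2) auto
  have "f \<in> borel_measurable (lebesgue_on {0<..<b})"
    unfolding f_def by (intro borel_measurable_suminf sqint_imp_measurable Tsq)
  then have fsq: "sqint b f" by (rule sqint_of_powr_bound[OF _ fB]) (use mu b in auto)
  have mlim: "(\<lambda>n. moment u (\<lambda>t. z * S n t) x) \<longlonglongrightarrow> moment u (\<lambda>t. z * f t) x"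
    if s: "basis_sol u v" and x: "0 < x" "x < b" for u v x
  proof -
    have "(\<lambda>n. integral {0<..<x} (\<lambda>t. complex_of_real (u t) * (z * S n t))) \<longlonglongrightarrow>
        integral {0<..<x} (\<lambda>t. complex_of_real (u t) * (z * f t))"
    proof (rule dominated_convergence(2)[where h = "\<lambda>t. C * cmod z * M * E * t powr (1 - 2 * \<mu>)"])
      show "(\<lambda>t. complex_of_real (u t) * (z * S n t)) integrable_on {0<..<x}" for n
        using moment_integrable[OF s square_integrable_cmult[OF Ssq] less_imp_le[OF x(2)]]
        by (simp add: integrable_on_Icc_iff_Ioo)
      have "(\<lambda>t. t powr (1 - 2 * \<mu>)) integrable_on {0<..<x}"
        using integrable_on_powr_from_0[of "1 - 2 * \<mu>" x] mu x by (simp add: integrable_on_Icc_iff_Ioo)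
      then show "(\<lambda>t. C * cmod z * M * E * t powr (1 - 2 * \<mu>)) integrable_on {0<..<x}"
        by (rule integrable_on_mult_right)
      show "norm (complex_of_real (u t) * (z * S n t)) \<le> C * cmod z * M * E * t powr (1 - 2 * \<mu>)"
        if t: "t \<in> {0<..<x}" for n t
      proof -
        have "norm (complex_of_real (u t) * (z * S n t)) = \<bar>u t\<bar> * (cmod z * cmod (S n t))" by (simp add: norm_mult)
        also have "\<dots> \<le> (C * t powr (1/2 - \<mu>)) * (cmod z * (M * E * t powr (1/2 - \<mu>)))"
          using t x C_nonneg by (intro mult_mono mult_left_mono basis_solD(3)[OF s] SB) auto
        also have "\<dots> = C * cmod z * M * E * (t powr (1/2 - \<mu>) * t powr (1/2 - \<mu>))" by (simp only: mult_ac)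
        also have "t powr (1/2 - \<mu>) * t powr (1/2 - \<mu>) = t powr (1 - 2 * \<mu>)" unfolding powr_add[symmetric] by simp
        finally show ?thesis .
      qed
      show "(\<lambda>n. complex_of_real (u t) * (z * S n t)) \<longlonglongrightarrow> complex_of_real (u t) * (z * f t)"
        if "t \<in> {0<..<x}" for t
        using that x by (intro tendsto_mult tendsto_const lim) auto
    qed
    then show ?thesis by (simp add: moment_def integral_open_interval_real)
  qed
  have "f x = p x + res (\<lambda>t. z * f t) x" if x: "0 < x" "x < b" for x
  proof (rule LIMSEQ_unique)
    show "(\<lambda>n. S (Suc n) x) \<longlonglongrightarrow> f x" using lim[OF x] by (rule LIMSEQ_Suc)
    show "(\<lambda>n. S (Suc n) x) \<longlonglongrightarrow> p x + res (\<lambda>t. z * f t) x"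
      unfolding SS res_def using w
      by (intro tendsto_intros mlim[OF basis_sol12(1) x] mlim[OF basis_sol12(2) x]) auto
  qed
  then show ?thesis using that[OF fsq] by blast
qed

text \<open>
  A pair \<open>(u, z u)\<close> lies in the graph iff \<open>u = \<alpha> u1 + \<beta> u2 + z res u\<close>. For each \<open>(\<alpha>,\<beta>)\<close> this Volterra
  equation has exactly one solution, it depends linearly on \<open>(\<alpha>,\<beta>)\<close>, and it is zero only if
  \<open>\<alpha> u1 + \<beta> u2\<close> is.
\<close>
theorem dim_kernel_max_graph: "cvec.dim {u. (u, z *\<^sub>C u) \<in> max_graph} = 2"
proof -
  let ?w1 = "\<lambda>x. complex_of_real (u1 x)" and ?w2 = "\<lambda>x. complex_of_real (u2 x)"
  obtain f1 where f1: "sqint b f1" "\<And>x. 0 < x \<Longrightarrow> x < b \<Longrightarrow> f1 x = ?w1 x + res (\<lambda>t. z * f1 t) x"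
    by (rule volterra_solution[OF u_sqint(1) C_nonneg, of z]) (use u_bound in auto)
  obtain f2 where f2: "sqint b f2" "\<And>x. 0 < x \<Longrightarrow> x < b \<Longrightarrow> f2 x = ?w2 x + res (\<lambda>t. z * f2 t) x"
    by (rule volterra_solution[OF u_sqint(2) C_nonneg, of z]) (use u_bound in auto)
  let ?F1 = "toL2 b f1" and ?F2 = "toL2 b f2"
  let ?f = "\<lambda>\<alpha> \<beta> x. \<alpha> * f1 x + \<beta> * f2 x"
  have fs: "sqint b (?f \<alpha> \<beta>)" for \<alpha> \<beta> by (intro square_integrable_add square_integrable_cmult f1 f2)
  have fL: "toL2 b (?f \<alpha> \<beta>) = \<alpha> *\<^sub>C ?F1 + \<beta> *\<^sub>C ?F2" for \<alpha> \<beta> by (rule toL2_linear[OF f1(1) f2(1)])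
  have feq: "?f \<alpha> \<beta> x = \<alpha> * ?w1 x + \<beta> * ?w2 x + res (\<lambda>t. z * ?f \<alpha> \<beta> t) x" if x: "0 < x" "x < b" for \<alpha> \<beta> x
  proof -
    have "res (\<lambda>t. z * ?f \<alpha> \<beta> t) x = res (\<lambda>t. \<alpha> * (z * f1 t) + \<beta> * (z * f2 t)) x"
      by (simp add: algebra_simps)
    also have "\<dots> = \<alpha> * res (\<lambda>t. z * f1 t) x + \<beta> * res (\<lambda>t. z * f2 t) x"
      using x by (intro res_linear square_integrable_cmult f1 f2) auto
    finally show ?thesis using f1(2)[OF x] f2(2)[OF x] by (simp add: algebra_simps)
  qed
  have ker: "{u. (u, z *\<^sub>C u) \<in> max_graph} = {\<alpha> *\<^sub>C ?F1 + \<beta> *\<^sub>C ?F2 | \<alpha> \<beta>. True}"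
  proof
    show "{\<alpha> *\<^sub>C ?F1 + \<beta> *\<^sub>C ?F2 | \<alpha> \<beta>. True} \<subseteq> {u. (u, z *\<^sub>C u) \<in> max_graph}"
    proof clarify
      fix \<alpha> \<beta>
      have zs: "sqint b (\<lambda>t. z * ?f \<alpha> \<beta> t)" by (rule square_integrable_cmult[OF fs])
      have "toL2 b (?f \<alpha> \<beta>) = \<alpha> *\<^sub>C U1 + \<beta> *\<^sub>C U2 + toL2 b (res (\<lambda>t. z * ?f \<alpha> \<beta> t))"
        unfolding toL2_combination[OF zs, symmetric] by (intro toL2_cong fs feq)
      moreover have "z *\<^sub>C toL2 b (?f \<alpha> \<beta>) = toL2 b (\<lambda>t. z * ?f \<alpha> \<beta> t)" by (rule toL2_scaleC[OF fs, symmetric])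
      ultimately show "(\<alpha> *\<^sub>C ?F1 + \<beta> *\<^sub>C ?F2, z *\<^sub>C (\<alpha> *\<^sub>C ?F1 + \<beta> *\<^sub>C ?F2)) \<in> max_graph"
        unfolding fL[symmetric] max_graph_def using zs by blast
    qed
    show "{u. (u, z *\<^sub>C u) \<in> max_graph} \<subseteq> {\<alpha> *\<^sub>C ?F1 + \<beta> *\<^sub>C ?F2 | \<alpha> \<beta>. True}"
    proof clarify
      fix u assume "(u, z *\<^sub>C u) \<in> max_graph"
      then obtain \<alpha> \<beta> g where g: "sqint b g" "z *\<^sub>C u = toL2 b g" and u: "u = \<alpha> *\<^sub>C U1 + \<beta> *\<^sub>C U2 + toL2 b (res g)"
        unfolding max_graph_def by blast
      let ?k = "\<lambda>x. \<alpha> * ?w1 x + \<beta> * ?w2 x + res g x"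
      have ks: "sqint b ?k" by (intro square_integrable_add square_integrable_cmult u_sqint res_sqint g)
      have uk: "u = toL2 b ?k" unfolding u toL2_combination[OF g(1)] ..
      have zk: "toL2 b (\<lambda>t. z * ?k t) = toL2 b g" using toL2_scaleC[OF ks, of z] g(2) uk by simp
      have "\<exists>N. negligible N \<and> (\<forall>x\<in>{0<..<b} - N. z * ?k x = g x)"
        by (rule iffD1[OF toL2_eq_iff[OF square_integrable_cmult[OF ks] g(1)] zk])
      then obtain N where N: "negligible N" "\<And>x. x \<in> {0<..<b} - N \<Longrightarrow> z * ?k x = g x" by blast
      \<comment> \<open>the difference solves the homogeneous Volterra equation\<close>
      let ?h = "\<lambda>x. ?k x - ?f \<alpha> \<beta> x"
      have hs: "sqint b ?h" by (intro sqint_diff ks fs)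
      have "?h x = 0" if x: "0 < x" "x < b" for x
      proof (rule volterra_unique[OF hs _ x, of z])
        fix x assume x: "0 < x" "x < b"
        have "res (\<lambda>t. z * ?h t) x = res (\<lambda>t. 1 * g t + (-1) * (z * ?f \<alpha> \<beta> t)) x"
          by (rule res_cong(1)[OF N(1)]) (use x in \<open>simp_all add: N(2)[symmetric] algebra_simps\<close>)
        also have "\<dots> = 1 * res g x + (-1) * res (\<lambda>t. z * ?f \<alpha> \<beta> t) x"
          using x by (intro res_linear g square_integrable_cmult fs) auto
        also have "\<dots> = ?h x" unfolding feq[OF x, of \<alpha> \<beta>] by simp
        finally show "?h x = res (\<lambda>t. z * ?h t) x" by (rule sym)
      qed
      then have "u = toL2 b (?f \<alpha> \<beta>)" unfolding uk by (intro toL2_cong ks) auto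
      then have "u = \<alpha> *\<^sub>C ?F1 + \<beta> *\<^sub>C ?F2" unfolding fL .
      then show "\<exists>\<alpha> \<beta>. u = \<alpha> *\<^sub>C ?F1 + \<beta> *\<^sub>C ?F2 \<and> True" by blast
    qed
  qed
  have ind0: "\<alpha> = 0 \<and> \<beta> = 0" if "\<alpha> *\<^sub>C ?F1 + \<beta> *\<^sub>C ?F2 = 0" for \<alpha> \<beta>
  proof -
    have "toL2 b (\<lambda>_. 0) = 0" by transfer (auto simp: l2_rel_def square_integrable_0)
    then have "toL2 b (?f \<alpha> \<beta>) = toL2 b (\<lambda>_. 0)" using that unfolding fL by simp
    then have "\<exists>N. negligible N \<and> (\<forall>x\<in>{0<..<b} - N. ?f \<alpha> \<beta> x = 0)"
      by (rule iffD1[OF toL2_eq_iff[OF fs square_integrable_0]])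
    then obtain N where N: "negligible N" "\<And>x. x \<in> {0<..<b} - N \<Longrightarrow> ?f \<alpha> \<beta> x = 0" by blast
    have r0: "res (\<lambda>t. z * ?f \<alpha> \<beta> t) x = 0" if "x \<le> b" for x
    proof -
      have "res (\<lambda>t. z * ?f \<alpha> \<beta> t) x = res (\<lambda>t. 0) x"
        by (rule res_cong(1)[OF N(1) _ that]) (use N(2) in simp)
      then show ?thesis by (simp add: res_def moment_def)
    qed
    have "\<alpha> * ?w1 x + \<beta> * ?w2 x = 0" if "0 < x" "x < b" for x
    proof (rule continuous_eq_0_of_ae[OF bessel_jetD(6)[OF basis_combination_jet] N(1)])
      fix y assume y: "y \<in> {0<..<b} - N"
      then show "\<alpha> * ?w1 y + \<beta> * ?w2 y = 0" using feq[of y \<alpha> \<beta>] N(2)[OF y] r0[of y] by simp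
    qed (use that in auto)
    then show ?thesis using b by (intro basis_combination_eq_0[of 0 b]) auto
  qed
  have ne: "?F1 \<noteq> ?F2" using ind0[of 1 "-1"] by auto
  have F2: "?F2 \<noteq> 0" using ind0[of 0 1] by auto
  have sp: "cvec.span {?F1, ?F2} = {\<alpha> *\<^sub>C ?F1 + \<beta> *\<^sub>C ?F2 | \<alpha> \<beta>. True}"
  proof -
    have "x \<in> cvec.span {?F1, ?F2} \<longleftrightarrow> (\<exists>\<alpha> \<beta>. x - \<alpha> *\<^sub>C ?F1 = \<beta> *\<^sub>C ?F2)" for x
      unfolding cvec.span_insert[of ?F1 "{?F2}"] cvec.span_singleton by auto
    then show ?thesis by (auto simp: diff_eq_eq add.commute)
  qed
  have ind: "cvec.independent {?F1, ?F2}"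
  proof -
    have "?F1 \<notin> cvec.span {?F2}"
    proof
      assume "?F1 \<in> cvec.span {?F2}"
      then obtain k where "?F1 = k *\<^sub>C ?F2" unfolding cvec.span_singleton by blast
      then have "1 *\<^sub>C ?F1 + (- k) *\<^sub>C ?F2 = 0" by simp
      then show False using ind0[of 1 "-k"] by simp
    qed
    then show ?thesis using F2 ne by (simp add: cvec.independent_insert cvec.dependent_single)
  qed
  show ?thesis
    unfolding ker sp[symmetric]
    using cvec.dim_span_eq_card_independent[OF ind] ne by simp
qed

lemma deficiency_eq_2:
  "deficiency_plus (L2_interval b) min_graph = 2" "deficiency_minus (L2_interval b) min_graph = 2"
proof -
  have *: "ker_op (shift_op max_graph c) = {u. (u, (- c) *\<^sub>C u) \<in> max_graph}" for c
  proof -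
    have "v + c *\<^sub>C u = 0 \<longleftrightarrow> v = (- c) *\<^sub>C u" for u v :: l2
      by (simp add: eq_neg_iff_add_eq_0)
    then show ?thesis unfolding ker_op_def shift_op_def by auto
  qed
  show "deficiency_plus (L2_interval b) min_graph = 2" "deficiency_minus (L2_interval b) min_graph = 2"
    unfolding deficiency_plus_def deficiency_minus_def adjoint_min_graph * by (rule dim_kernel_max_graph)+
qed

theorem bessel_operator_summary:
  "nonneg_op (bessel_min \<nu> b)"
  "deficiency_plus (L2_interval b) (bessel_min \<nu> b) = 2"
  "deficiency_minus (L2_interval b) (bessel_min \<nu> b) = 2"
  "Domain (bessel_min \<nu> b) = toL2 b ` H2_0 b"
  "bessel_max \<nu> b = adjoint_op (L2_interval b) (bessel_min \<nu> b)"
  "direct_sum_decomp (Domain (adjoint_op (L2_interval b) (bessel_min \<nu> b))) (toL2 b ` H2_tilde_0 b) (cvec.span {U1, U2})"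
  unfolding bessel_min_eq bessel_max_eq adjoint_min_graph
  by (rule nonneg_min_graph deficiency_eq_2 Domain_min_graph refl direct_sum_Domain_max_graph)+

end

section \<open>The two fundamental systems and the theorem\<close>

text \<open>
  Here \<open>\<mu> = \<nu>\<close>. Where the exponent \<open>-\<nu>\<close> is wanted instead of \<open>\<nu>\<close> the bounds use
  \<open>x\<^bsup>2\<nu>\<^esup> \<le> b\<^bsup>2\<nu>\<^esup>\<close>, and in the kernel \<open>(t/x)\<^bsup>2\<nu>\<^esup> \<le> 1\<close> for \<open>t \<le> x\<close>.
\<close>
lemma bessel_system_powr:
  assumes nu: "0 < \<nu>" "\<nu> < 1" and b: "0 < b"
  shows "bessel_system \<nu> b \<nu> (3 + 2 * b powr (2 * \<nu>)) (- 2 * \<nu>)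
    (\<lambda>x. x powr (1/2 + \<nu>)) (\<lambda>x. (1/2 + \<nu>) * x powr (\<nu> - 1/2))
    (\<lambda>x. x powr (1/2 - \<nu>)) (\<lambda>x. (1/2 - \<nu>) * x powr (- 1/2 - \<nu>))"
proof
  let ?C = "3 + 2 * b powr (2 * \<nu>)"
  show "0 < b" "0 < \<nu>" "\<nu> < 1" "- 2 * \<nu> \<noteq> 0" using nu b by auto
  have grow: "x powr (p + 2 * \<nu>) \<le> b powr (2 * \<nu>) * x powr p" if "0 < x" "x \<le> b" for x p
    using that nu by (simp add: powr_add mult.commute mult_left_mono powr_mono2)
  have drop: "x powr (p - 2 * \<nu>) * t powr (q + 2 * \<nu>) \<le> x powr p * t powr q" if "0 < t" "t \<le> x" for x t p q
  proof -
    have "t powr (2 * \<nu>) / x powr (2 * \<nu>) \<le> 1" using that nu by (simp add: powr_mono2)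
    then have "(x powr p * t powr q) * (t powr (2 * \<nu>) / x powr (2 * \<nu>)) \<le> (x powr p * t powr q) * 1"
      by (intro mult_left_mono) auto
    then show ?thesis by (simp add: powr_add powr_diff field_simps)
  qed
  {
    fix x :: real assume x: "0 < x"
    have ex: "\<nu> - 1/2 = (1/2 + \<nu>) - 1" "- 1/2 - \<nu> = (1/2 - \<nu>) - 1"
      "\<nu> - 3/2 = (1/2 + \<nu>) - 2" "- 3/2 - \<nu> = (1/2 - \<nu>) - 2" by simp_all
    have ex': "- 1/2 - \<nu> - 1 = - 3/2 - \<nu>" by simp
    have p: "x powr 1 = x" "x powr 2 = x\<^sup>2" using x by (simp_all add: powr_numeral)
    have c: "(1/2 + \<nu>) * (\<nu> - 1/2) = \<nu>\<^sup>2 - 1/4" "(1/2 - \<nu>) * (- 1/2 - \<nu>) = \<nu>\<^sup>2 - 1/4"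
      by (simp_all add: power2_eq_square algebra_simps)
    have e1: "x powr (\<nu> - 1/2) = x powr (1/2 + \<nu>) / x" "x powr (- 1/2 - \<nu>) = x powr (1/2 - \<nu>) / x"
      unfolding ex(1,2) powr_diff p by simp_all
    have e2: "x powr (\<nu> - 3/2) = x powr (1/2 + \<nu>) / x\<^sup>2" "x powr (- 3/2 - \<nu>) = x powr (1/2 - \<nu>) / x\<^sup>2"
      unfolding ex(3,4) powr_diff p by simp_all
    show "((\<lambda>x. x powr (1/2 + \<nu>)) has_real_derivative (1/2 + \<nu>) * x powr (\<nu> - 1/2)) (at x)"
      using has_real_derivative_powr[OF x, of "1/2 + \<nu>"] by (simp add: algebra_simps)
    show "((\<lambda>x. x powr (1/2 - \<nu>)) has_real_derivative (1/2 - \<nu>) * x powr (- 1/2 - \<nu>)) (at x)"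
      using has_real_derivative_powr[OF x, of "1/2 - \<nu>"] unfolding ex(2) .
    have "((\<lambda>x. x powr (\<nu> - 1/2)) has_real_derivative (\<nu> - 1/2) * x powr (\<nu> - 3/2)) (at x)"
      using has_real_derivative_powr[OF x, of "\<nu> - 1/2"] by simp
    then have "((\<lambda>x. (1/2 + \<nu>) * x powr (\<nu> - 1/2)) has_real_derivative (1/2 + \<nu>) * ((\<nu> - 1/2) * x powr (\<nu> - 3/2))) (at x)"
      by (rule DERIV_cmult)
    moreover have "(1/2 + \<nu>) * ((\<nu> - 1/2) * x powr (\<nu> - 3/2)) = pot \<nu> x * x powr (1/2 + \<nu>)"
      unfolding e2 pot_def c(1)[symmetric] by simp
    ultimately show "((\<lambda>x. (1/2 + \<nu>) * x powr (\<nu> - 1/2)) has_real_derivative pot \<nu> x * x powr (1/2 + \<nu>)) (at x)" by simp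
    have "((\<lambda>x. x powr (- 1/2 - \<nu>)) has_real_derivative (- 1/2 - \<nu>) * x powr (- 3/2 - \<nu>)) (at x)"
      using has_real_derivative_powr[OF x, of "- 1/2 - \<nu>"] unfolding ex' .
    then have "((\<lambda>x. (1/2 - \<nu>) * x powr (- 1/2 - \<nu>)) has_real_derivative (1/2 - \<nu>) * ((- 1/2 - \<nu>) * x powr (- 3/2 - \<nu>))) (at x)"
      by (rule DERIV_cmult)
    moreover have "(1/2 - \<nu>) * ((- 1/2 - \<nu>) * x powr (- 3/2 - \<nu>)) = pot \<nu> x * x powr (1/2 - \<nu>)"
      unfolding e2 pot_def c(2)[symmetric] by simp
    ultimately show "((\<lambda>x. (1/2 - \<nu>) * x powr (- 1/2 - \<nu>)) has_real_derivative pot \<nu> x * x powr (1/2 - \<nu>)) (at x)" by simp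
    have "x powr (1/2 + \<nu>) * x powr (1/2 - \<nu>) = x" unfolding powr_add[symmetric] using x by simp
    then show "x powr (1/2 + \<nu>) * ((1/2 - \<nu>) * x powr (- 1/2 - \<nu>)) - (1/2 + \<nu>) * x powr (\<nu> - 1/2) * x powr (1/2 - \<nu>) = - 2 * \<nu>"
      unfolding e1 using x by (simp add: field_simps)
    {
      assume xb: "x \<le> b"
      show "\<bar>x powr (1/2 + \<nu>)\<bar> \<le> ?C * x powr (1/2 - \<nu>)"
        using grow[OF x xb, of "1/2 - \<nu>"] by (simp add: algebra_simps)
          (smt (verit) powr_ge_zero mult_nonneg_nonneg)
      show "\<bar>x powr (1/2 - \<nu>)\<bar> \<le> ?C * x powr (1/2 - \<nu>)"
        by (simp add: algebra_simps)
      show "\<bar>(1/2 + \<nu>) * x powr (\<nu> - 1/2)\<bar> \<le> ?C * x powr (- 1/2 - \<nu>)"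
      proof -
        have "\<bar>(1/2 + \<nu>) * x powr (\<nu> - 1/2)\<bar> \<le> 2 * x powr (\<nu> - 1/2)"
          using nu by (simp add: abs_mult mult_right_mono)
        also have "x powr (\<nu> - 1/2) \<le> b powr (2 * \<nu>) * x powr (- 1/2 - \<nu>)"
          using grow[OF x xb, of "- 1/2 - \<nu>"] by simp
        also have "2 * (b powr (2 * \<nu>) * x powr (- 1/2 - \<nu>)) \<le> ?C * x powr (- 1/2 - \<nu>)"
          by (simp add: algebra_simps)
        finally show ?thesis by simp
      qed
      show "\<bar>(1/2 - \<nu>) * x powr (- 1/2 - \<nu>)\<bar> \<le> ?C * x powr (- 1/2 - \<nu>)"
      proof -
        have "\<bar>1/2 - \<nu>\<bar> \<le> ?C" using nu powr_ge_zero[of b "2 * \<nu>"] by linarith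
        then show ?thesis by (simp add: abs_mult mult_right_mono)
      qed
    }
  }
  fix t x :: real assume t: "0 < t" "t \<le> x"
  have C: "2 \<le> ?C" "3 \<le> ?C" by auto
  show "\<bar>x powr (1/2 + \<nu>) * t powr (1/2 - \<nu>) - x powr (1/2 - \<nu>) * t powr (1/2 + \<nu>)\<bar>
      \<le> ?C * x powr (1/2 + \<nu>) * t powr (1/2 - \<nu>)"
  proof -
    have "x powr (1/2 - \<nu>) * t powr (1/2 + \<nu>) \<le> x powr (1/2 + \<nu>) * t powr (1/2 - \<nu>)"
      using drop[OF t, of "1/2 + \<nu>" "1/2 - \<nu>"] by (simp add: add.commute)
    then have "\<bar>x powr (1/2 + \<nu>) * t powr (1/2 - \<nu>) - x powr (1/2 - \<nu>) * t powr (1/2 + \<nu>)\<bar>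
        \<le> 1 * (x powr (1/2 + \<nu>) * t powr (1/2 - \<nu>))" by simp
    also have "\<dots> \<le> ?C * (x powr (1/2 + \<nu>) * t powr (1/2 - \<nu>))" by (intro mult_right_mono) auto
    finally show ?thesis by (simp only: mult.assoc)
  qed
  show "\<bar>(1/2 + \<nu>) * x powr (\<nu> - 1/2) * t powr (1/2 - \<nu>) - (1/2 - \<nu>) * x powr (- 1/2 - \<nu>) * t powr (1/2 + \<nu>)\<bar>
      \<le> ?C * x powr (\<nu> - 1/2) * t powr (1/2 - \<nu>)"
  proof -
    have d: "x powr (- 1/2 - \<nu>) * t powr (1/2 + \<nu>) \<le> x powr (\<nu> - 1/2) * t powr (1/2 - \<nu>)"
    proof -
      have "\<nu> - 1/2 - 2 * \<nu> = - 1/2 - \<nu>" "1/2 - \<nu> + 2 * \<nu> = 1/2 + \<nu>" by simp_all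
      then show ?thesis using drop[OF t, of "\<nu> - 1/2" "1/2 - \<nu>"] by (simp only:)
    qed
    have "\<bar>(1/2 + \<nu>) * x powr (\<nu> - 1/2) * t powr (1/2 - \<nu>) - (1/2 - \<nu>) * x powr (- 1/2 - \<nu>) * t powr (1/2 + \<nu>)\<bar>
        \<le> \<bar>1/2 + \<nu>\<bar> * (x powr (\<nu> - 1/2) * t powr (1/2 - \<nu>)) + \<bar>1/2 - \<nu>\<bar> * (x powr (- 1/2 - \<nu>) * t powr (1/2 + \<nu>))"
      by (rule order_trans[OF abs_triangle_ineq4]) (simp add: abs_mult mult.assoc)
    also have "\<dots> \<le> 2 * (x powr (\<nu> - 1/2) * t powr (1/2 - \<nu>)) + 1 * (x powr (\<nu> - 1/2) * t powr (1/2 - \<nu>))"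
      by (rule add_mono[OF mult_right_mono mult_mono[OF _ d]]) (use nu in auto)
    also have "\<dots> \<le> ?C * (x powr (\<nu> - 1/2) * t powr (1/2 - \<nu>))" by (simp add: algebra_simps)
    finally show ?thesis by (simp only: mult.assoc)
  qed
qed

text \<open>
  The kernel is \<open>sqrt (x t) (ln t - ln x)\<close>. Any \<open>\<mu>\<close> between \<open>0\<close> and \<open>1\<close> absorbs the logarithm; \<open>1/2\<close> is
  convenient since \<open>ln y \<le> 2 sqrt y\<close>.
\<close>
lemma bessel_system_log:
  assumes b: "0 < b"
  shows "bessel_system 0 b (1/2) (4 + 2 * sqrt b + b * sqrt b) 1
    (\<lambda>x. x powr (1/2)) (\<lambda>x. 1 / (2 * sqrt x))
    (\<lambda>x. x powr (1/2) * ln x) (\<lambda>x. (1 + ln x / 2) / sqrt x)"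
proof
  let ?C = "4 + 2 * sqrt b + b * sqrt b"
  show "0 < b" "0 < (1/2::real)" "(1/2::real) < 1" "(1::real) \<noteq> 0" using b by auto
  have ln_le: "ln y \<le> 2 * sqrt y" if "0 < y" for y :: real
  proof -
    have "ln y = 2 * ln (sqrt y)" using that by (simp add: ln_sqrt)
    also have "ln (sqrt y) \<le> sqrt y" using that ln_le_minus_one[of "sqrt y"] by simp
    finally show ?thesis by simp
  qed
  {
    fix x :: real assume x: "0 < x"
    have sq: "sqrt x * sqrt x = x" "sqrt x > 0" using x by auto
    have sq': "sqrt x * (sqrt x * y) = x * y" for y using x by (simp add: mult.assoc[symmetric])
    show d1: "((\<lambda>x. x powr (1/2)) has_real_derivative 1 / (2 * sqrt x)) (at x)"
      using has_real_derivative_powr[OF x, of "1/2"] x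
      by (simp add: powr_minus_divide powr_half_sqrt)
    show "((\<lambda>x. 1 / (2 * sqrt x)) has_real_derivative pot 0 x * x powr (1/2)) (at x)"
      using x sq by (auto intro!: derivative_eq_intros simp: pot_def powr_half_sqrt field_simps power2_eq_square sq')
    show "((\<lambda>x. x powr (1/2) * ln x) has_real_derivative (1 + ln x / 2) / sqrt x) (at x)"
      by (rule DERIV_cong[OF DERIV_mult[OF d1 DERIV_ln[OF x]]])
        (use x sq in \<open>simp add: powr_half_sqrt field_simps\<close>)
    show "((\<lambda>x. (1 + ln x / 2) / sqrt x) has_real_derivative pot 0 x * (x powr (1/2) * ln x)) (at x)"
      using x sq by (auto intro!: derivative_eq_intros simp: pot_def powr_half_sqrt field_simps power2_eq_square sq')
    show "x powr (1/2) * ((1 + ln x / 2) / sqrt x) - 1 / (2 * sqrt x) * (x powr (1/2) * ln x) = 1"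
      using x by (simp add: powr_half_sqrt field_simps)
    {
      assume xb: "x \<le> b"
      have sb: "sqrt x \<le> sqrt b" using xb by simp
      have nn: "0 \<le> sqrt b" "0 \<le> b * sqrt b" using b by auto
      have xs: "x * sqrt x \<le> b * sqrt b" using x xb sb by (intro mult_mono) auto
      have one: "x powr (1/2 - 1/2) = 1" using x by simp
      have inv: "x powr (- 1/2 - 1/2) = 1 / x" using x by (simp add: powr_minus_divide)
      have lnx: "sqrt x * \<bar>ln x\<bar> \<le> 2 + b * sqrt b"
      proof (cases "x \<ge> 1")
        case True
        then have "sqrt x * \<bar>ln x\<bar> \<le> sqrt x * x" using x ln_le_minus_one[OF x] by (intro mult_left_mono) auto
        then show ?thesis using xs by (simp add: mult.commute)
      next
        case False
        have "- ln x \<le> 2 / sqrt x" using ln_le[of "1/x"] x by (simp add: ln_div real_sqrt_divide)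
        then have "sqrt x * \<bar>ln x\<bar> \<le> sqrt x * (2 / sqrt x)" using x False by (intro mult_left_mono) auto
        then show ?thesis using sq(2) b by (simp add: add_increasing2)
      qed
      show "\<bar>x powr (1/2)\<bar> \<le> ?C * x powr (1/2 - 1/2)"
        unfolding one powr_half_sqrt[OF less_imp_le[OF x]] abs_of_pos[OF sq(2)] mult_1_right using sq(2) sb nn by linarith
      show "\<bar>x powr (1/2) * ln x\<bar> \<le> ?C * x powr (1/2 - 1/2)"
        unfolding one powr_half_sqrt[OF less_imp_le[OF x]] abs_mult abs_of_pos[OF sq(2)] mult_1_right using lnx nn by linarith
      show "\<bar>1 / (2 * sqrt x)\<bar> \<le> ?C * x powr (- 1/2 - 1/2)"
      proof -
        have "1 / (2 * sqrt x) = (sqrt x / 2) / x" using x sq by (simp add: field_simps)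
        also have "\<dots> \<le> ?C / x" using sb nn sq(2) x by (intro divide_right_mono; linarith)
        finally show ?thesis unfolding inv using x by simp
      qed
      show "\<bar>(1 + ln x / 2) / sqrt x\<bar> \<le> ?C * x powr (- 1/2 - 1/2)"
      proof -
        have "\<bar>(1 + ln x / 2) / sqrt x\<bar> \<le> (1 + \<bar>ln x\<bar> / 2) / sqrt x"
          using x by (simp add: abs_divide divide_right_mono)
        also have "\<dots> = (sqrt x + sqrt x * \<bar>ln x\<bar> / 2) / x" using x sq by (simp add: field_simps sq')
        also have "\<dots> \<le> ?C / x"
        proof (rule divide_right_mono)
          show "sqrt x + sqrt x * \<bar>ln x\<bar> / 2 \<le> ?C" using lnx sb nn by linarith
        qed (use x in simp)
        finally show ?thesis unfolding inv by simp
      qed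
    }
  }
  fix t x :: real assume t: "0 < t" "t \<le> x"
  have x: "0 < x" using t by simp
  have sq: "sqrt x * sqrt x = x" "sqrt x > 0" using x by auto
  have C: "2 \<le> ?C" using b by (simp add: add_increasing2)
  have one: "t powr (1/2 - 1/2) = 1" "x powr (1/2 - 1/2) = 1" using x t by auto
  have st: "sqrt t > 0" "sqrt t \<le> sqrt x" using t by auto
  have l: "0 \<le> ln x - ln t" "ln x - ln t \<le> 2 * (sqrt x / sqrt t)"
    using ln_le[of "x / t"] t x by (auto simp: ln_div real_sqrt_divide)
  show "\<bar>x powr (1/2) * (t powr (1/2) * ln t) - x powr (1/2) * ln x * t powr (1/2)\<bar>
      \<le> ?C * x powr (1/2 + 1/2) * t powr (1/2 - 1/2)"
  proof -
    have "x powr (1/2) * (t powr (1/2) * ln t) - x powr (1/2) * ln x * t powr (1/2) = - (sqrt x * sqrt t * (ln x - ln t))"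
      using x t by (simp add: powr_half_sqrt algebra_simps)
    then have "\<bar>x powr (1/2) * (t powr (1/2) * ln t) - x powr (1/2) * ln x * t powr (1/2)\<bar> = sqrt x * sqrt t * (ln x - ln t)"
      using x t l(1) by (simp add: abs_mult)
    also have "\<dots> \<le> sqrt x * sqrt t * (2 * (sqrt x / sqrt t))" using x t l by (intro mult_left_mono) auto
    also have "\<dots> = 2 * x" using st sq by simp
    also have "\<dots> \<le> ?C * x" using C x by (intro mult_right_mono) auto
    finally show ?thesis using x one by simp
  qed
  show "\<bar>1 / (2 * sqrt x) * (t powr (1/2) * ln t) - (1 + ln x / 2) / sqrt x * t powr (1/2)\<bar>
      \<le> ?C * x powr (1/2 - 1/2) * t powr (1/2 - 1/2)"
  proof -
    have "1 / (2 * sqrt x) * (t powr (1/2) * ln t) - (1 + ln x / 2) / sqrt x * t powr (1/2)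
        = - (sqrt t / sqrt x * (1 + (ln x - ln t) / 2))"
      using x t by (simp add: powr_half_sqrt field_simps)
    then have "\<bar>1 / (2 * sqrt x) * (t powr (1/2) * ln t) - (1 + ln x / 2) / sqrt x * t powr (1/2)\<bar>
        = sqrt t / sqrt x * (1 + (ln x - ln t) / 2)"
      using x t l(1) by (simp add: abs_mult)
    also have "\<dots> \<le> sqrt t / sqrt x * (1 + (2 * (sqrt x / sqrt t)) / 2)"
      using x t l by (intro mult_left_mono add_left_mono divide_right_mono) auto
    also have "\<dots> = sqrt t / sqrt x + 1" using st sq by (simp add: field_simps)
    also have "\<dots> \<le> 2" using st sq by (simp add: field_simps)
    finally show ?thesis using C one by simp
  qed
qed

theorem theorem3p4:
  fixes \<nu> b :: real
  assumes "0 \<le> \<nu>" and "\<nu> < 1" and "0 < b"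
  shows "(nonneg_op (bessel_min \<nu> b) \<and>
          deficiency_plus (L2_interval b) (bessel_min \<nu> b) = 2 \<and>
          deficiency_minus (L2_interval b) (bessel_min \<nu> b) = 2) \<and>
         Domain (bessel_min \<nu> b) = toL2 b ` H2_0 b \<and>
         (bessel_max \<nu> b = adjoint_op (L2_interval b) (bessel_min \<nu> b) \<and>
          (\<nu> > 0 \<longrightarrow>
             direct_sum_decomp (Domain (adjoint_op (L2_interval b) (bessel_min \<nu> b)))
               (toL2 b ` H2_tilde_0 b)
               (cvec.span {toL2 b (\<lambda>x. complex_of_real (x powr (1/2 + \<nu>))),
                           toL2 b (\<lambda>x. complex_of_real (x powr (1/2 - \<nu>)))})) \<and>
          (\<nu> = 0 \<longrightarrow>
             direct_sum_decomp (Domain (adjoint_op (L2_interval b) (bessel_min \<nu> b)))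
               (toL2 b ` H2_tilde_0 b)
               (cvec.span {toL2 b (\<lambda>x. complex_of_real (x powr (1/2))),
                           toL2 b (\<lambda>x. complex_of_real (x powr (1/2) * ln x))})))"
proof (cases "\<nu> = 0")
  case True
  show ?thesis
    using bessel_system.bessel_operator_summary[OF bessel_system_log[OF assms(3)]] True by simp
next
  case False
  then have "0 < \<nu>" using assms(1) by simp
  then show ?thesis
    using bessel_system.bessel_operator_summary[OF bessel_system_powr[OF _ assms(2,3)]] by simp
qed

end
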